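(* Let $G$ and $H$ be finite abelian groups and let $e$ be the exponent of $G$. Let $F$ be a field of characteristic $0$ such that: for every odd prime $p$ dividing $e$, either $\zeta_p\in F$ or $F\cap\mathbb{Q}(\zeta_{p^2})\subseteq\mathbb{Q}(\zeta_p)$; and if $2\mid e$, either $\zeta_4\in F$ or $F\cap\mathbb{Q}(\zeta_8)=\mathbb{Q}$. Then $G\sim_F H$ implies $G\cong H$.
   Context: For a positive integer $n$, $\zeta_n$ is a primitive $n$-th root of unity; fix an algebraic closure $\bar F$ of $F$ containing the algebraic closure $\bar{\mathbb{Q}}$ of $\mathbb{Q}$, take $\zeta_n\in\bar F$, and form intersections inside $\bar F$. Twisted group rings and $\sim_R$: for a commutative ring $R$ and a finite group $G$, $H^2(G,R^* )$ is the second cohomology group with trivial action on $R^*$; for $\alpha\in Z^2(G,R^* )$ the twisted group ring $R^\alpha G$ is the free $R$-module with basis $\{u_g\}_{g\in G}$, $R$ central, $u_gu_h=\alpha(g,h)u_{gh}$. $G\sim_R H$ means there is a group isomorphism $\psi:H^2(G,R^* )\to H^2(H,R^* )$ with $R^\alpha G\cong R^{\psi(\alpha)}H$ as rings for all $[\alpha]\in H^2(G,R^* )$. *)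

theory Defs
  imports "HOL-Algebra.Algebra"
begin

definition alg_closed_field :: "'k::field itself \<Rightarrow> bool" where
  "alg_closed_field _ \<longleftrightarrow>
     (\<forall>n::nat. \<forall>c::nat \<Rightarrow> 'k. n > 0 \<longrightarrow> (\<exists>x. x ^ n + (\<Sum>i<n. c i * x ^ i) = 0))"

definition is_subfield :: "'k::field set \<Rightarrow> bool" where
  "is_subfield K \<longleftrightarrow> 0 \<in> K \<and> 1 \<in> K \<and>
     (\<forall>x\<in>K. \<forall>y\<in>K. x + y \<in> K \<and> x * y \<in> K) \<and>
     (\<forall>x\<in>K. - x \<in> K \<and> inverse x \<in> K)"

text \<open>Subfield generated by a set (over the prime field, which is \<open>\<rat>\<close> in characteristic 0).\<close>
definition gen_subfield :: "'k::field set \<Rightarrow> 'k set" where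
  "gen_subfield S = \<Inter>{K. is_subfield K \<and> S \<subseteq> K}"

definition primitive_root_of_unity :: "nat \<Rightarrow> 'k::field \<Rightarrow> bool" where
  "primitive_root_of_unity n z \<longleftrightarrow> n > 0 \<and> z ^ n = 1 \<and> (\<forall>k. 0 < k \<and> k < n \<longrightarrow> z ^ k \<noteq> 1)"

definition cyclotomic_field :: "nat \<Rightarrow> 'k::field set" where
  "cyclotomic_field n = gen_subfield {z. primitive_root_of_unity n z}"

definition group_exponent :: "('g, 'x) monoid_scheme \<Rightarrow> nat" where
  "group_exponent G = Lcm ((group.ord G) ` carrier G)"

definition cocycle :: "('g, 'x) monoid_scheme \<Rightarrow> 'k::field set \<Rightarrow> ('g \<Rightarrow> 'g \<Rightarrow> 'k) \<Rightarrow> bool" where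
  "cocycle G F \<alpha> \<longleftrightarrow>
     (\<forall>g\<in>carrier G. \<forall>h\<in>carrier G. \<alpha> g h \<in> F - {0}) \<and>
     (\<forall>g\<in>carrier G. \<forall>h\<in>carrier G. \<forall>k\<in>carrier G.
        \<alpha> g h * \<alpha> (g \<otimes>\<^bsub>G\<^esub> h) k = \<alpha> h k * \<alpha> g (h \<otimes>\<^bsub>G\<^esub> k))"

definition cohomologous :: "('g, 'x) monoid_scheme \<Rightarrow> 'k::field set \<Rightarrow>
    ('g \<Rightarrow> 'g \<Rightarrow> 'k) \<Rightarrow> ('g \<Rightarrow> 'g \<Rightarrow> 'k) \<Rightarrow> bool" where
  "cohomologous G F \<alpha> \<beta> \<longleftrightarrow>
     (\<exists>f. (\<forall>g\<in>carrier G. f g \<in> F - {0}) \<and>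
        (\<forall>g\<in>carrier G. \<forall>h\<in>carrier G. \<beta> g h = \<alpha> g h * (f g * f h / f (g \<otimes>\<^bsub>G\<^esub> h))))"

definition coh_class :: "('g, 'x) monoid_scheme \<Rightarrow> 'k::field set \<Rightarrow>
    ('g \<Rightarrow> 'g \<Rightarrow> 'k) \<Rightarrow> ('g \<Rightarrow> 'g \<Rightarrow> 'k) set" where
  "coh_class G F \<alpha> = {\<beta>. cocycle G F \<beta> \<and> cohomologous G F \<alpha> \<beta>}"

definition H2 :: "('g, 'x) monoid_scheme \<Rightarrow> 'k::field set \<Rightarrow> ('g \<Rightarrow> 'g \<Rightarrow> 'k) set monoid" where
  "H2 G F = \<lparr> carrier = coh_class G F ` {\<alpha>. cocycle G F \<alpha>},
             monoid.mult = (\<lambda>c d. coh_class G F (\<lambda>g h. (SOME \<alpha>. \<alpha> \<in> c) g h * (SOME \<beta>. \<beta> \<in> d) g h)),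
             monoid.one = coh_class G F (\<lambda>_ _. 1) \<rparr>"

text \<open>Elements \<open>\<Sum>\<^sub>g x g u\<^sub>g\<close> are represented by coefficient functions \<open>x\<close>, with coefficients
  in \<open>F\<close> on \<open>carrier G\<close> and \<open>0\<close> elsewhere; \<open>u\<^sub>g u\<^sub>h = \<alpha> g h u\<^sub>g\<^sub>h\<close>.
  The identity element is \<open>\<alpha>(1,1)\<^sup>-\<^sup>1 u\<^sub>1\<close>.\<close>
definition twisted_group_ring :: "('g, 'x) monoid_scheme \<Rightarrow> 'k::field set \<Rightarrow>
    ('g \<Rightarrow> 'g \<Rightarrow> 'k) \<Rightarrow> ('g \<Rightarrow> 'k) ring" where
  "twisted_group_ring G F \<alpha> = \<lparr>
     carrier = {x. (\<forall>g\<in>carrier G. x g \<in> F) \<and> (\<forall>g. g \<notin> carrier G \<longrightarrow> x g = 0)},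
     monoid.mult = (\<lambda>x y k. if k \<in> carrier G then
                (\<Sum>g\<in>carrier G. \<Sum>h\<in>{h\<in>carrier G. g \<otimes>\<^bsub>G\<^esub> h = k}. x g * y h * \<alpha> g h)
              else 0),
     monoid.one = (\<lambda>g. if g = \<one>\<^bsub>G\<^esub> then inverse (\<alpha> \<one>\<^bsub>G\<^esub> \<one>\<^bsub>G\<^esub>) else 0),
     ring.zero = (\<lambda>_. 0),
     ring.add = (\<lambda>x y g. x g + y g) \<rparr>"

definition twisted_equiv :: "('g, 'x) monoid_scheme \<Rightarrow> 'k::field set \<Rightarrow> ('h, 'y) monoid_scheme \<Rightarrow> bool" where
  "twisted_equiv G F H \<longleftrightarrow>
     (\<exists>\<psi>. \<psi> \<in> iso (H2 G F) (H2 H F) \<and>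
        (\<forall>\<alpha> \<beta>. cocycle G F \<alpha> \<and> cocycle H F \<beta> \<and> coh_class H F \<beta> = \<psi> (coh_class G F \<alpha>) \<longrightarrow>
           twisted_group_ring G F \<alpha> \<simeq> twisted_group_ring H F \<beta>))"

end

theory Submission
  imports Defs "HOL-Computational_Algebra.Computational_Algebra"
begin

text \<open>
  Write \<open>c\<^sub>G(n)\<close> for the number of characters of \<open>G\<close> with values in the \<open>n\<close>-th roots of unity and
  \<open>a\<^sub>G(n)\<close> for the number of alternating bimultiplicative forms on \<open>G\<close> with such values. A finite abelian
  group is determined by \<open>c\<^sub>G\<close>. For a prime \<open>p\<close> let \<open>r(t)\<close> be the number of cyclic factors
  of \<open>G\<close> whose \<open>p\<close>-part exceeds \<open>p\<^sup>t\<close>; the \<open>p\<close>-parts of \<open>c\<^sub>G(n)\<close> and \<open>a\<^sub>G(n)\<close> have exponents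
  \<open>\<Sum> r(t)\<close> and \<open>\<Sum> (r(t) choose 2)\<close>, the sums ranging over \<open>t\<close> below the multiplicity of \<open>p\<close> in \<open>n\<close>.

  The twisted group ring of \<open>\<alpha>\<close> is commutative exactly when \<open>\<alpha>\<close> is symmetric, so the given isomorphism
  of cohomology groups preserves symmetric classes. Modulo these, a class is the same as the alternating form
  \<open>\<alpha>(g,h) / \<alpha>(h,g)\<close>, hence \<open>a\<^sub>G(n) = a\<^sub>H(n)\<close> whenever \<open>F\<close> contains the \<open>n\<close>-th roots of unity. The
  trivial class gives \<open>FG \<cong> FH\<close>; matching the kernels of characters shows that \<open>G\<close> and \<open>H\<close> have
  equally many characters with values in any field \<open>K \<supseteq> F\<close>. The hypothesis on \<open>F\<close> says that the tower
  obtained from \<open>F\<close> by adjoining the \<open>p\<^sup>j\<close>-th roots of unity grows at every step above the largest \<open>m\<close>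
  such that \<open>F\<close> contains the \<open>p\<^sup>m\<close>-th ones, so the partial sums of \<open>r\<close> agree for \<open>G\<close> and \<open>H\<close> from \<open>m\<close> on. Below \<open>m\<close> the numbers \<open>r(t) choose 2\<close> agree, which leaves
  only the ambiguity between \<open>0\<close> and \<open>1\<close>; monotonicity of \<open>r\<close> and the sum up to \<open>m\<close> remove it.
\<close>

section \<open>Polynomials vanishing on roots of unity\<close>

text \<open>The equivalence supplies ring isomorphisms only, neither F-linear nor compatible with
  the bases \<open>u_g\<close>, so a single value of a character cannot be transported. What
  survives is the kernel of a character, the field it generates over F, and the order of a root of
  unity. This is why characters are counted with values in a field K containing F, that is in
  \<open>mu N \<inter> K = mu w\<close>, and not directly in \<open>mu n\<close>. Only those w that
  occur for some K are visible, and the growth of the tower is what makes every level j \<ge> m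
  visible. It can fail: over F = Q(sqrt 2), which is excluded for even e, adjoining \<zeta>_4 yields
  \<zeta>_8 as well, and no K has exact level 2. Below m nothing can be separated by enlarging F:
  every K contains the p^m-th roots of unity, so group rings give just one sum up to m, and the
  alternating forms must separate its terms. These in turn are blind to the difference between no
  factor and one factor, since a cyclic group has only the trivial alternating form.\<close>

lemma prod_linear_dvd:
  fixes m :: "'k::field poly"
  assumes "finite S" "\<And>r. r \<in> S \<Longrightarrow> poly m r = 0"
  shows "(\<Prod>r\<in>S. [:-r, 1:]) dvd m"
  using assms
proof (induction S)
  case (insert a S)
  then obtain h where h: "m = (\<Prod>r\<in>S. [:-r, 1:]) * h" by (auto elim: dvdE)
  have "poly (\<Prod>r\<in>S. [:-r, 1:]) a \<noteq> 0"
    using insert by (simp add: poly_prod)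
  then have "poly h a = 0" using insert.prems[of a] h by simp
  then have "[:-a, 1:] dvd h" by (simp add: poly_eq_0_iff_dvd)
  then have "[:-a, 1:] * (\<Prod>r\<in>S. [:-r, 1:]) dvd h * (\<Prod>r\<in>S. [:-r, 1:])"
    by (rule mult_dvd_mono) simp
  then show ?case unfolding prod.insert[OF insert.hyps] h by (simp only: mult.commute)
qed simp

lemma degree_monom_minus_const:
  assumes "n > 0"
  shows "Polynomial.degree (Polynomial.monom (1::'k::comm_ring_1) n - [:c:]) = n"
  using assms degree_add_eq_left[of "-[:c:]" "Polynomial.monom (1::'k) n"]
  by (simp add: degree_monom_eq diff_conv_add_uminus del: add_uminus_conv_diff)

text \<open>In characteristic 0 the polynomial X^n - 1 is separable: a double root would also be a
  root of the derivative n X^(n-1), which leaves only 0.\<close>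

lemma linear_sq_not_dvd_unity_poly:
  fixes r :: "'k::field_char_0"
  assumes "n > 0"
  shows "\<not> [:-r, 1:]\<^sup>2 dvd Polynomial.monom 1 n - 1"
proof
  assume "[:-r, 1:]\<^sup>2 dvd Polynomial.monom 1 n - 1"
  then obtain h where h: "Polynomial.monom 1 n - 1 = [:-r, 1:] * ([:-r, 1:] * h)"
    by (elim dvdE) (auto simp: power2_eq_square mult.assoc simp del: mult_pCons_left mult_pCons_right)
  have "poly (Polynomial.monom 1 n - 1) r = 0" by (simp add: h)
  then have r: "r ^ n = 1" by (simp add: poly_monom)
  have "poly (pderiv (Polynomial.monom 1 n - 1)) r = 0"
    unfolding h by (subst pderiv_mult) simp
  then have "of_nat n * r ^ (n - 1) = 0"
    by (simp add: pderiv_diff pderiv_monom poly_monom)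
  then show False using assms r by (metis mult_eq_0_iff of_nat_eq_0_iff not_gr_zero power_0_left power_eq_0_iff zero_neq_one)
qed

locale alg_closed_char_0 =
  fixes T :: "'k::field_char_0 itself"
  assumes alg_closed: "alg_closed_field T"
begin

lemma alg_closed_type: "alg_closed_char_0 TYPE('k)"
  using alg_closed unfolding alg_closed_char_0_def alg_closed_field_def .

lemma poly_root_exists:
  fixes p :: "'k poly"
  assumes "Polynomial.degree p > 0"
  shows "\<exists>x. poly p x = 0"
proof -
  let ?n = "Polynomial.degree p" and ?l = "lead_coeff p"
  have l: "?l \<noteq> 0" using assms by auto
  obtain x where x: "x ^ ?n + (\<Sum>i<?n. Polynomial.coeff p i / ?l * x ^ i) = 0"
    using alg_closed assms unfolding alg_closed_field_def by meson
  have "poly p x = (\<Sum>i<?n. Polynomial.coeff p i * x ^ i) + ?l * x ^ ?n"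
    by (simp add: poly_altdef flip: lessThan_Suc_atMost)
  also have "\<dots> = ?l * (x ^ ?n + (\<Sum>i<?n. Polynomial.coeff p i / ?l * x ^ i))"
    using l by (simp add: distrib_left sum_distrib_left)
  finally show ?thesis using x by auto
qed

lemma nth_root_exists:
  fixes c :: 'k
  assumes "n > 0"
  shows "\<exists>z. z ^ n = c"
proof -
  obtain z where "poly (Polynomial.monom 1 n - [:c:]) z = 0"
    using poly_root_exists assms degree_monom_minus_const by metis
  then show ?thesis by (auto simp: poly_monom)
qed

text \<open>Dividing m by the linear factors of its distinct roots leaves a cofactor without roots,
  because a further root would be a double root of X^n - 1. Over an algebraically closed field such
  a cofactor is constant, and monicity makes it 1.\<close>

lemma dvd_unity_poly_eq_prod:
  fixes m :: "'k poly"
  assumes n: "n > 0" and dvd: "m dvd Polynomial.monom 1 n - 1" and monic: "lead_coeff m = 1"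
  shows "m = (\<Prod>r | poly m r = 0. [:-r, 1:])"
proof -
  have m0: "m \<noteq> 0" using monic by auto
  have fin: "finite {r. poly m r = 0}" using m0 by (rule poly_roots_finite)
  obtain h where h: "m = (\<Prod>r | poly m r = 0. [:-r, 1:]) * h"
    using prod_linear_dvd[OF fin, of m] by (auto elim: dvdE)
  have "Polynomial.degree h = 0"
  proof (rule ccontr)
    assume "Polynomial.degree h \<noteq> 0"
    then obtain x where x: "poly h x = 0" using poly_root_exists by auto
    then have mx: "poly m x = 0" by (subst h) simp
    have "[:-x, 1:] dvd h" using x by (simp add: poly_eq_0_iff_dvd)
    moreover have "[:-x, 1:] dvd (\<Prod>r | poly m r = 0. [:-r, 1:])"
      using fin mx by (intro dvd_prodI) auto
    ultimately have "[:-x, 1:]\<^sup>2 dvd m"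
      unfolding power2_eq_square
      by (subst h, subst mult.commute[of _ h]) (rule mult_dvd_mono)
    then show False using linear_sq_not_dvd_unity_poly[OF n, of x] dvd dvd_trans by blast
  qed
  then obtain c where c: "h = [:c:]" by (meson degree_eq_zeroE)
  have "lead_coeff ((\<Prod>r | poly m r = 0. [:-r, 1:]) * h) = c"
    by (simp add: c lead_coeff_prod lead_coeff_mult del: mult_pCons_right)
  then have "lead_coeff m = c"
    using h by argo
  then have "h = 1" using c monic by simp
  then show ?thesis using h by simp
qed

lemma unity_poly_eq_prod:
  assumes "n > 0"
  shows "Polynomial.monom 1 n - 1 = (\<Prod>r | r ^ n = (1::'k). [:-r, 1:])"
proof -
  have d: "Polynomial.degree (Polynomial.monom (1::'k) n - 1) = n"
    using degree_monom_minus_const[OF assms, of 1] by (simp add: one_pCons)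
  then have "lead_coeff (Polynomial.monom (1::'k) n - 1) = 1"
    using assms by simp
  from dvd_unity_poly_eq_prod[OF assms dvd_refl this]
  show ?thesis by (simp add: poly_monom)
qed

lemma finite_roots_of_unity: "n > 0 \<Longrightarrow> finite {z::'k. z ^ n = 1}"
  using poly_roots_finite[of "Polynomial.monom (1::'k) n - 1"]
    degree_monom_minus_const[of n "1::'k"] by (cases "Polynomial.monom (1::'k) n = 1") (auto simp: poly_monom one_pCons)

lemma card_roots_of_unity:
  assumes "n > 0"
  shows "card {z::'k. z ^ n = 1} = n"
proof -
  have "Polynomial.degree (Polynomial.monom (1::'k) n - 1) = n"
    using degree_monom_minus_const[OF assms, of 1] by (simp add: one_pCons)
  then show ?thesis
    using unity_poly_eq_prod[OF assms] degree_prod_sum_eq[of "{z::'k. z ^ n = 1}" "\<lambda>r. [:-r, 1:]"]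
    by simp
qed

end

section \<open>Cyclic splittings of finite abelian groups\<close>

lemma not_dvd_imp_multiplicity_less:
  fixes m n :: nat
  assumes "\<not> n dvd m" "n > 0" "m > 0"
  shows "\<exists>p. Factorial_Ring.prime p \<and> multiplicity p m < multiplicity p n"
  using assms multiplicity_le_imp_dvd[of n m] by (metis leI not_gr_zero)

lemma (in comm_group) ord_mult_coprime:
  assumes "x \<in> carrier G" "y \<in> carrier G" "coprime (ord x) (ord y)"
  shows "ord (x \<otimes> y) = ord x * ord y"
proof (rule dvd_antisym)
  show "ord (x \<otimes> y) dvd ord x * ord y"
    using assms abelian_ord_mul_divides by blast
  let ?k = "ord (x \<otimes> y)"
  have e: "x [^] ?k \<otimes> y [^] ?k = \<one>"
    using assms pow_mult_distrib[OF m_comm, of x y ?k] by simp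
  have "x [^] (?k * ord y) = x [^] (?k * ord y) \<otimes> y [^] (?k * ord y)"
    using assms by (simp add: pow_eq_id[of y])
  also have "\<dots> = (x [^] ?k \<otimes> y [^] ?k) [^] ord y"
    using assms by (simp add: nat_pow_distrib nat_pow_pow)
  finally have "ord x dvd ?k * ord y"
    using e assms pow_eq_id[of x] by simp
  then have 1: "ord x dvd ?k"
    using assms coprime_dvd_mult_left_iff by blast
  have "y [^] (?k * ord x) = x [^] (?k * ord x) \<otimes> y [^] (?k * ord x)"
    using assms by (simp add: pow_eq_id[of x])
  also have "\<dots> = (x [^] ?k \<otimes> y [^] ?k) [^] ord x"
    using assms by (simp add: nat_pow_distrib nat_pow_pow)
  finally have "ord y dvd ?k * ord x"
    using e assms pow_eq_id[of y] by simp
  then have 2: "ord y dvd ?k"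
    using assms coprime_dvd_mult_left_iff coprime_commute by blast
  from 1 2 assms(3) show "ord x * ord y dvd ?k"
    using divides_mult by blast
qed

text \<open>For \<open>g\<close> of largest order, an order that does not divide
  \<open>ord g\<close> exceeds it at some prime p. Exchanging the p-part of \<open>g\<close> for
  that of \<open>x\<close> multiplies two elements of coprime orders and would produce a larger
  order.\<close>

lemma (in comm_group) exists_ord_eq_exponent:
  assumes fin: "finite (carrier G)"
  shows "\<exists>g\<in>carrier G. \<forall>x\<in>carrier G. ord x dvd ord g"
proof -
  have "finite (ord ` carrier G)" "ord ` carrier G \<noteq> {}" using fin by auto
  then obtain g where g: "g \<in> carrier G" "ord g = Max (ord ` carrier G)"
    by (metis (mono_tags, lifting) Max_in imageE)
  have max: "ord x \<le> ord g" if "x \<in> carrier G" for x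
    using g fin that by auto
  have "ord x dvd ord g" if x: "x \<in> carrier G" for x
  proof (rule ccontr)
    assume "\<not> ord x dvd ord g"
    moreover have pos: "ord x > 0" "ord g > 0"
      using ord_ge_1[OF fin x] ord_ge_1[OF fin g(1)] by auto
    ultimately obtain p where p: "Factorial_Ring.prime p"
      and less: "multiplicity p (ord g) < multiplicity p (ord x)"
      using not_dvd_imp_multiplicity_less by blast
    define i where "i = multiplicity p (ord g)"
    define j where "j = multiplicity p (ord x)"
    define u where "u = g [^] (p ^ i)"
    obtain c where c: "ord x = p ^ j * c"
      using multiplicity_dvd[of p "ord x"] unfolding j_def by auto
    obtain d where d: "ord g = p ^ i * d" "\<not> p dvd d"
      using multiplicity_decompose'[of "ord g" p] pos p unfolding i_def
      by (metis multiplicity_decompose' not_gr_zero not_prime_unit)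
    have cd: "c > 0" "d > 0" "p > 0" using pos c d p by (auto simp: prime_gt_0_nat)
    have u: "u \<in> carrier G" "ord u = d"
      using g(1) cd ord_pow[of g "p ^ i"] unfolding u_def d(1) by auto
    define v where "v = x [^] c"
    have v: "v \<in> carrier G" "ord v = p ^ j"
      using x cd ord_pow[of x c] unfolding v_def c by auto
    have "coprime d (p ^ j)"
      using d(2) p prime_imp_coprime coprime_commute coprime_power_right_iff by blast
    then have "ord (u \<otimes> v) = d * p ^ j"
      using ord_mult_coprime u v by metis
    then have "d * p ^ j \<le> p ^ i * d" using max[of "u \<otimes> v"] u v d by simp
    moreover have "p ^ i < p ^ j" using less p unfolding i_def j_def
      by (intro power_strict_increasing) (auto simp: prime_gt_Suc_0_nat)
    ultimately show False using cd by (simp add: mult.commute)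
  qed
  then show ?thesis using g by blast
qed

text \<open>The domain is a subset of the group rather than a group of its own, so that a character
  can be extended through a chain of subgroups; values outside \<open>A\<close> are
  arbitrary.\<close>

definition is_char :: "('g, 'x) monoid_scheme \<Rightarrow> 'g set \<Rightarrow> ('g \<Rightarrow> 'k::field) \<Rightarrow> bool" where
  "is_char G A \<chi> \<longleftrightarrow> (\<forall>a\<in>A. \<chi> a \<noteq> 0) \<and> (\<forall>a\<in>A. \<forall>b\<in>A. \<chi> (a \<otimes>\<^bsub>G\<^esub> b) = \<chi> a * \<chi> b)"

context comm_group
begin

lemma is_char_one: "is_char G A \<chi> \<Longrightarrow> \<one> \<in> A \<Longrightarrow> \<chi> \<one> = 1"
  unfolding is_char_def by (metis mult_cancel_left2 one_closed r_one)

lemma subgroup_pow_closed: "subgroup A G \<Longrightarrow> a \<in> A \<Longrightarrow> a [^] (n::nat) \<in> A"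
  by (induction n) (auto simp: subgroup.one_closed subgroup.m_closed)

lemma is_char_pow:
  "is_char G A \<chi> \<Longrightarrow> subgroup A G \<Longrightarrow> a \<in> A \<Longrightarrow> \<chi> (a [^] (n::nat)) = \<chi> a ^ n"
proof (induction n)
  case 0 then show ?case by (simp add: is_char_one subgroup.one_closed)
next
  case (Suc n)
  have "a [^] n \<in> A" using Suc.prems by (rule_tac subgroup_pow_closed)
  then show ?case using Suc by (simp add: is_char_def mult.commute)
qed

lemma least_power_in_subgroup:
  assumes fin: "finite (carrier G)" and A: "subgroup A G" and x: "x \<in> carrier G"
  shows "\<exists>k>0. x [^] k \<in> A \<and> (\<forall>d::nat. x [^] d \<in> A \<longrightarrow> k dvd d)"
proof -
  define k where "k = (LEAST k::nat. k > 0 \<and> x [^] k \<in> A)"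
  have "ord x > 0 \<and> x [^] ord x \<in> A"
    using ord_ge_1[OF fin x] x A subgroup.one_closed by auto
  then have k: "k > 0 \<and> x [^] k \<in> A" unfolding k_def by (rule LeastI[where P = "\<lambda>k::nat. 0 < k \<and> x [^] k \<in> A"])
  have "k dvd d" if d: "x [^] d \<in> A" for d :: nat
  proof -
    have "x [^] (k * (d div k)) \<in> A"
      using k A x subgroup_pow_closed[of A "x [^] k" "d div k"] by (simp add: nat_pow_pow)
    moreover have "x [^] d = x [^] (k * (d div k)) \<otimes> x [^] (d mod k)"
      using x by (simp add: nat_pow_mult)
    then have "x [^] (d mod k) = inv (x [^] (k * (d div k))) \<otimes> x [^] d"
      using x by (simp add: m_assoc[symmetric])
    ultimately have "x [^] (d mod k) \<in> A"
      using d A subgroup.m_closed subgroup.m_inv_closed by metis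
    then have "\<not> d mod k > 0"
      using not_less_Least[of "d mod k" "\<lambda>k::nat. k > 0 \<and> x [^] k \<in> A"] k
      unfolding k_def[symmetric] by auto
    then show ?thesis by auto
  qed
  then show ?thesis using k by blast
qed

text \<open>\<open>k\<close> is the order of \<open>x\<close> modulo \<open>A\<close>, so the
  equation for \<open>z\<close> is the only constraint on the value at \<open>x\<close>: the
  extension to the subgroup generated by \<open>A\<close> and \<open>x\<close> is a x^i \<mapsto>
  \<chi>(a) z^i. Leaving \<open>z\<close> free allows a value to be prescribed.\<close>

lemma char_extend_step:
  fixes \<chi> :: "'a \<Rightarrow> 'k::field"
  assumes fin: "finite (carrier G)" and A: "subgroup A G" and x: "x \<in> carrier G"
    and chi: "is_char G A \<chi>"
    and k: "k > 0" "x [^] k \<in> A" "\<And>d::nat. x [^] d \<in> A \<Longrightarrow> k dvd d"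
    and z: "z ^ k = \<chi> (x [^] k)"
  shows "\<exists>B \<chi>'. subgroup B G \<and> A \<subseteq> B \<and> x \<in> B \<and> is_char G B \<chi>' \<and> (\<forall>a\<in>A. \<chi>' a = \<chi> a) \<and> \<chi>' x = z"
proof -
  have Ac: "a \<in> carrier G" if "a \<in> A" for a by (rule subgroup.mem_carrier[OF A that])
  have A1: "\<one> \<in> A" by (rule subgroup.one_closed[OF A])
  have "\<chi> (x [^] k) \<noteq> 0" using chi k(2) by (simp add: is_char_def)
  then have z0: "z \<noteq> 0" using z k(1) by (auto simp: power_0_left)
  have zd: "\<chi> (x [^] d) = z ^ d" if "x [^] d \<in> A" for d :: nat
  proof -
    obtain q where q: "d = k * q" using k(3)[OF \<open>x [^] d \<in> A\<close>] by auto
    have "\<chi> (x [^] d) = \<chi> ((x [^] k) [^] q)" using x q by (simp add: nat_pow_pow)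
    then show ?thesis using is_char_pow[OF chi A k(2)] z q by (simp add: power_mult)
  qed
  define P where "P y p \<longleftrightarrow> fst p \<in> A \<and> y = fst p \<otimes> x [^] snd p" for y and p :: "'a \<times> nat"
  define B where "B = {y. \<exists>p. P y p}"
  \<comment> \<open>The pair (a, i) representing \<open>y\<close> is not unique; an arbitrary one is
    chosen here, and \<open>wd\<close> shows that the value does not depend on it.\<close>
  define \<chi>' where "\<chi>' y = (let p = SOME p. P y p in \<chi> (fst p) * z ^ snd p)" for y
  have wd1: "\<chi> a * z ^ i = \<chi> b * z ^ j"
    if "a \<in> A" "b \<in> A" "a \<otimes> x [^] i = b \<otimes> x [^] j" "i \<le> j" for a b and i j :: nat
  proof -
    have "a \<otimes> x [^] i = (b \<otimes> x [^] (j - i)) \<otimes> x [^] i"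
      using that x Ac by (simp add: m_assoc nat_pow_mult)
    then have e: "a = b \<otimes> x [^] (j - i)" using that x Ac by simp
    then have "x [^] (j - i) = inv b \<otimes> a" using that x Ac by (simp add: m_assoc[symmetric])
    then have m: "x [^] (j - i) \<in> A" using that A by (simp add: subgroup.m_closed subgroup.m_inv_closed)
    have "\<chi> a = \<chi> b * z ^ (j - i)" using chi that m zd[OF m] unfolding e is_char_def by simp
    then show ?thesis using \<open>i \<le> j\<close> by (simp add: mult.assoc flip: power_add)
  qed
  have wd: "\<chi> a * z ^ i = \<chi> b * z ^ j"
    if "a \<in> A" "b \<in> A" "a \<otimes> x [^] i = b \<otimes> x [^] j" for a b and i j :: nat
    using that wd1[of a b i j] wd1[of b a j i] by (metis linear)
  have val: "\<chi>' (a \<otimes> x [^] i) = \<chi> a * z ^ i" if "a \<in> A" for a and i :: nat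
  proof -
    have "P (a \<otimes> x [^] i) (a, i)" using that by (simp add: P_def)
    then have "P (a \<otimes> x [^] i) (SOME p. P (a \<otimes> x [^] i) p)" by (rule someI)
    then have "fst (SOME p. P (a \<otimes> x [^] i) p) \<in> A"
      "a \<otimes> x [^] i = fst (SOME p. P (a \<otimes> x [^] i) p) \<otimes> x [^] snd (SOME p. P (a \<otimes> x [^] i) p)"
      unfolding P_def by blast+
    from wd[OF that this] show ?thesis unfolding \<chi>'_def Let_def by simp
  qed
  have mult: "(a \<otimes> x [^] i) \<otimes> (b \<otimes> x [^] j) = (a \<otimes> b) \<otimes> x [^] (i + j)"
    if "a \<in> A" "b \<in> A" for a b and i j :: nat
    using that Ac x by (simp add: m_ac flip: nat_pow_mult)
  have four: "(a \<otimes> u) \<otimes> (b \<otimes> v) = (a \<otimes> b) \<otimes> (u \<otimes> v)"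
    if "a \<in> carrier G" "u \<in> carrier G" "b \<in> carrier G" "v \<in> carrier G" for a u b v
    using that by (simp add: m_ac)
  have Bc: "B \<subseteq> carrier G" unfolding B_def P_def using Ac x by auto
  have BI: "a \<otimes> x [^] i \<in> B" if "a \<in> A" for a and i :: nat
    using that unfolding B_def P_def by force
  have BE: "\<exists>a i. a \<in> A \<and> y = a \<otimes> x [^] (i::nat)" if "y \<in> B" for y
    using that unfolding B_def P_def by auto
  have Bm: "y \<otimes> y' \<in> B" if y: "y \<in> B" and y': "y' \<in> B" for y y'
  proof -
    obtain a i b j where "a \<in> A" "y = a \<otimes> x [^] (i::nat)" "b \<in> A" "y' = b \<otimes> x [^] (j::nat)"
      using BE[OF y] BE[OF y'] by blast
    then show ?thesis using mult[of a b i j] BI[of "a \<otimes> b" "i + j"] subgroup.m_closed[OF A, of a b] by simp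
  qed
  have "subgroup B G"
  proof (rule subgroupI)
    show "B \<subseteq> carrier G" by (rule Bc)
    show "B \<noteq> {}" using BI A1 by blast
    show "inv y \<in> B" if yB: "y \<in> B" for y
    proof -
      obtain a i where y: "a \<in> A" "y = a \<otimes> x [^] (i::nat)" using BE[OF yB] by blast
      \<comment> \<open>Exponents are natural numbers, so x^i is inverted by the power
        \<open>i * (ord x - 1)\<close> of \<open>x\<close>.\<close>
      have "x [^] (i * ord x) = \<one>" using x by (simp add: pow_eq_id)
      moreover have "i * ord x = i + i * (ord x - 1)"
        using ord_ge_1[OF fin x] by (cases "ord x") auto
      ultimately have e: "x [^] i \<otimes> x [^] (i * (ord x - 1)) = \<one>" using x by (simp add: nat_pow_mult)
      have "y \<otimes> (inv a \<otimes> x [^] (i * (ord x - 1))) = (a \<otimes> inv a) \<otimes> (x [^] i \<otimes> x [^] (i * (ord x - 1)))"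
        using four[of a "x [^] i" "inv a" "x [^] (i * (ord x - 1))"] y x Ac by simp
      then have "inv y = inv a \<otimes> x [^] (i * (ord x - 1))"
        using e y(1) x Ac[OF y(1)] unfolding y(2) by (intro inv_unique'[symmetric]) (auto simp: m_comm)
      then show ?thesis using BI[OF subgroup.m_inv_closed[OF A y(1)]] by simp
    qed
    show "y \<otimes> y' \<in> B" if "y \<in> B" "y' \<in> B" for y y' using Bm that .
  qed
  moreover have "A \<subseteq> B" using BI[of _ 0] Ac by auto
  moreover have "x \<in> B" using BI[OF A1, of 1] x by simp
  moreover have "is_char G B \<chi>'"
    unfolding is_char_def
  proof (intro conjI ballI)
    fix y assume "y \<in> B"
    then obtain a i where y: "a \<in> A" "y = a \<otimes> x [^] (i::nat)" using BE by blast
    then show "\<chi>' y \<noteq> 0" using val chi z0 by (simp add: is_char_def)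
    fix y' assume "y' \<in> B"
    then obtain b j where y': "b \<in> A" "y' = b \<otimes> x [^] (j::nat)" using BE by blast
    show "\<chi>' (y \<otimes> y') = \<chi>' y * \<chi>' y'"
      using y y' chi A by (simp add: mult val subgroup.m_closed is_char_def power_add mult_ac)
  qed
  moreover have "\<forall>a\<in>A. \<chi>' a = \<chi> a" using val[of _ 0] Ac by simp
  moreover have "\<chi>' x = z" using val[OF A1, of 1] x is_char_one[OF chi A1] by simp
  ultimately show ?thesis by blast
qed

end

context alg_closed_char_0
begin

lemma char_extend:
  fixes \<chi> :: "'g \<Rightarrow> 'k"
  assumes G: "comm_group G" and fin: "finite (carrier G)"
    and A: "subgroup A G" and chi: "is_char G A \<chi>"
  shows "\<exists>\<chi>'. is_char G (carrier G) \<chi>' \<and> (\<forall>a\<in>A. \<chi>' a = \<chi> a)"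
  using A chi
proof (induction "card (carrier G) - card A" arbitrary: A \<chi> rule: less_induct)
  case less
  interpret comm_group G by (rule G)
  have AG: "A \<subseteq> carrier G" using less.prems subgroup.subset by blast
  show ?case
  proof (cases "A = carrier G")
    case True then show ?thesis using less.prems by blast
  next
    case False
    then obtain x where x: "x \<in> carrier G" "x \<notin> A" using AG by blast
    obtain k where k: "k > 0" "x [^]\<^bsub>G\<^esub> k \<in> A" "\<And>d::nat. x [^]\<^bsub>G\<^esub> d \<in> A \<Longrightarrow> k dvd d"
      using least_power_in_subgroup[OF fin less.prems(1) x(1)] by blast
    obtain z where z: "z ^ k = \<chi> (x [^]\<^bsub>G\<^esub> k)" using nth_root_exists k by blast
    obtain B \<chi>1 where B: "subgroup B G" "A \<subseteq> B" "x \<in> B" "is_char G B \<chi>1" "\<forall>a\<in>A. \<chi>1 a = \<chi> a"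
      using char_extend_step[OF fin less.prems(1) x(1) less.prems(2) k z] by blast
    have "card A < card B" "card B \<le> card (carrier G)"
      using B x fin subgroup.subset[OF B(1)]
      by (auto intro!: psubset_card_mono card_mono dest: finite_subset)
    then have "card (carrier G) - card B < card (carrier G) - card A" by linarith
    from less.hyps[OF this B(1,4)] B(2,5) show ?thesis by (metis subsetD)
  qed
qed

text \<open>The extension starts from the trivial subgroup, relative to which the order of
  \<open>g\<close> is \<open>ord g\<close> itself; hence any root of unity of that exponent is a
  possible value.\<close>

lemma char_with_value:
  fixes z :: 'k
  assumes G: "comm_group G" and fin: "finite (carrier G)"
    and g: "g \<in> carrier G" and z: "z ^ group.ord G g = 1"
  shows "\<exists>\<chi>. is_char G (carrier G) \<chi> \<and> \<chi> g = z"
proof -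
  interpret comm_group G by (rule G)
  have A: "subgroup {\<one>\<^bsub>G\<^esub>} G" by (rule triv_subgroup)
  have chi: "is_char G {\<one>\<^bsub>G\<^esub>} (\<lambda>_. 1::'k)" by (simp add: is_char_def)
  have "ord g > 0" using ord_ge_1[OF fin g] by simp
  then obtain B \<chi> where B: "subgroup B G" "g \<in> B" "is_char G B \<chi>" "\<chi> g = z"
    using char_extend_step[OF fin A g chi, of "ord g" z] z g pow_eq_id[OF g] by auto
  then show ?thesis using char_extend[OF G fin B(1,3)] by metis
qed

end

section \<open>Primitive roots of unity and finite multiplicative groups\<close>

lemma power_mod_of_power_eq_1:
  fixes z :: "'k::field"
  assumes "z ^ m = 1"
  shows "z ^ (k mod m) = z ^ k"
proof -
  have "z ^ k = (z ^ m) ^ (k div m) * z ^ (k mod m)"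
    by (simp flip: power_mult power_add)
  then show ?thesis using assms by simp
qed

lemma primitive_root_pow_eq_1_iff:
  fixes z :: "'k::field"
  assumes "primitive_root_of_unity n z"
  shows "z ^ i = 1 \<longleftrightarrow> n dvd i"
proof
  have n: "n > 0" "z ^ n = 1" "\<And>k. 0 < k \<Longrightarrow> k < n \<Longrightarrow> z ^ k \<noteq> 1"
    using assms by (auto simp: primitive_root_of_unity_def)
  have e: "z ^ i = z ^ (i mod n)"
    using n(2) by (rule power_mod_of_power_eq_1[symmetric])
  assume "z ^ i = 1"
  then have "\<not> 0 < i mod n" using n e by (metis mod_less_divisor)
  then show "n dvd i" by auto
next
  assume "n dvd i"
  then show "z ^ i = 1" using assms by (auto simp: primitive_root_of_unity_def power_mult elim!: dvdE)
qed

lemma primitive_root_pow_inj_on: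
  fixes z :: "'k::field"
  assumes z: "primitive_root_of_unity n z"
  shows "inj_on (\<lambda>i. z ^ i) {..<n}"
proof (rule linorder_inj_onI')
  fix i j assume ij: "i \<in> {..<n}" "j \<in> {..<n}" "i < j"
  have "z ^ n = 1" "n > 0" using z by (auto simp: primitive_root_of_unity_def)
  then have z0: "z \<noteq> 0" by (auto simp: power_0_left)
  have "z ^ (j - i) \<noteq> 1" using primitive_root_pow_eq_1_iff[OF z] ij by (auto dest: dvd_imp_le)
  moreover have "z ^ j = z ^ i * z ^ (j - i)" using ij by (simp flip: power_add)
  ultimately show "z ^ i \<noteq> z ^ j" using z0 by simp
qed

context alg_closed_char_0
begin

lemma roots_of_unity_eq_powers:
  fixes z :: 'k
  assumes z: "primitive_root_of_unity n z"
  shows "{w. w ^ n = 1} = (\<lambda>i. z ^ i) ` {..<n}"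
proof (rule card_subset_eq[symmetric])
  have n: "n > 0" "z ^ n = 1" using z by (auto simp: primitive_root_of_unity_def)
  show "finite {w::'k. w ^ n = 1}" by (rule finite_roots_of_unity[OF n(1)])
  have "(z ^ i) ^ n = 1" for i using n(2) by (metis mult.commute power_mult power_one)
  then show "(\<lambda>i. z ^ i) ` {..<n} \<subseteq> {w. w ^ n = 1}" by auto
  show "card ((\<lambda>i. z ^ i) ` {..<n}) = card {w::'k. w ^ n = 1}"
    using card_roots_of_unity[OF n(1)] card_image[OF primitive_root_pow_inj_on[OF z]] by simp
qed

text \<open>An element whose order w is the exponent of \<open>U\<close> exists, so \<open>U\<close>
  consists of w-th roots of unity, and the powers of that element already exhaust these. This serves
  for all roots of unity of a given exponent, for the image of a character and for the roots of
  unity in a subfield.\<close>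

lemma finite_mult_group_eq_roots_of_unity:
  fixes U :: "'k set"
  assumes N: "N > 0" and pow: "\<And>z. z \<in> U \<Longrightarrow> z ^ N = 1" and one: "1 \<in> U"
    and mult: "\<And>x y. x \<in> U \<Longrightarrow> y \<in> U \<Longrightarrow> x * y \<in> U"
  shows "\<exists>w>0. U = {z. z ^ w = 1} \<and> (\<exists>z\<in>U. primitive_root_of_unity w z)"
proof -
  define M where "M = \<lparr>carrier = U, monoid.mult = (*), one = (1::'k)\<rparr>"
  have finU: "finite U" by (rule finite_subset[OF _ finite_roots_of_unity[OF N]]) (use pow in auto)
  have Upow: "z ^ n \<in> U" if "z \<in> U" for z n using that one mult by (induction n) auto
  have inv: "\<exists>y\<in>U. x * y = 1" if "x \<in> U" for x
  proof
    show "x * x ^ (N - 1) = 1" using pow[OF that] N by (simp flip: power_Suc)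
  qed (use Upow that in auto)
  interpret M: comm_group M
    by (rule comm_groupI) (auto simp: M_def one mult mult_ac inv)
  have pw: "x [^]\<^bsub>M\<^esub> (n::nat) = x ^ n" for x n
    by (induction n) (auto simp: M_def mult.commute nat_pow_def)
  obtain g where g: "g \<in> U" "\<And>x. x \<in> U \<Longrightarrow> M.ord x dvd M.ord g"
    using M.exists_ord_eq_exponent finU by (auto simp: M_def)
  define w where "w = M.ord g"
  have w: "w > 0" unfolding w_def using M.ord_ge_1[of g] finU g by (simp add: M_def)
  have gw: "g ^ i = 1 \<longleftrightarrow> w dvd i" for i
    using M.pow_eq_id[of g i] g unfolding w_def pw by (simp add: M_def)
  then have prim: "primitive_root_of_unity w g"
    using w by (auto simp: primitive_root_of_unity_def dest: dvd_imp_le)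
  have sub: "U \<subseteq> {z. z ^ w = 1}"
  proof
    fix x assume x: "x \<in> U"
    then have "x \<in> carrier M" by (simp add: M_def)
    then have "x [^]\<^bsub>M\<^esub> w = \<one>\<^bsub>M\<^esub>" using M.pow_eq_id[of x w] g(2)[OF x] unfolding w_def by blast
    then show "x \<in> {z. z ^ w = 1}" unfolding pw by (simp add: M_def)
  qed
  have "U = {z. z ^ w = 1}"
    using sub Upow[OF g(1)] by (auto simp: roots_of_unity_eq_powers[OF prim])
  then show ?thesis using w prim g by blast
qed

lemma primitive_root_exists:
  assumes "n > 0"
  shows "\<exists>z::'k. primitive_root_of_unity n z"
proof -
  have "\<exists>w>0. {z::'k. z ^ n = 1} = {z. z ^ w = 1} \<and> (\<exists>z\<in>{z::'k. z ^ n = 1}. primitive_root_of_unity w z)"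
    by (rule finite_mult_group_eq_roots_of_unity[OF assms]) (simp_all add: power_mult_distrib)
  then obtain w where w: "w > 0" "{z::'k. z ^ n = 1} = {z. z ^ w = 1}" "\<exists>z::'k. primitive_root_of_unity w z"
    by blast
  then have "w = n" using card_roots_of_unity[OF assms] card_roots_of_unity[OF w(1)] by metis
  then show ?thesis using w(3) by blast
qed

end

text \<open>The internal direct product of \<open>A\<close> and a cyclic group: injectivity of the
  map together with \<open>g_pow_m\<close> forces \<open>g\<close> to have order exactly
  \<open>m\<close>. Working inside \<open>G\<close> keeps the complement in the same type, as
  induction requires.\<close>

locale cyclic_splitting = comm_group G for G (structure) +
  fixes A :: "'a set" and g :: 'a and m :: nat
  assumes finite_carrier: "finite (carrier G)"
    and subgroup_A: "subgroup A G" and g_closed: "g \<in> carrier G" and m_pos: "m > 0"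
    and g_pow_m: "g [^] m = \<one>"
    and bij_split: "bij_betw (\<lambda>(a, k). a \<otimes> g [^] (k::nat)) (A \<times> {..<m}) (carrier G)"
begin

text \<open>\<open>pr\<close> and \<open>ex\<close> are the two coordinates of the splitting. The
  second is normalised to lie below \<open>m\<close>, so it is additive only modulo
  \<open>m\<close>.\<close>

definition pr :: "'a \<Rightarrow> 'a" where
  "pr x = fst (the_inv_into (A \<times> {..<m}) (\<lambda>(a, k). a \<otimes> g [^] (k::nat)) x)"

definition ex :: "'a \<Rightarrow> nat" where
  "ex x = snd (the_inv_into (A \<times> {..<m}) (\<lambda>(a, k). a \<otimes> g [^] (k::nat)) x)"

lemma A_closed: "a \<in> A \<Longrightarrow> a \<in> carrier G"
  by (rule subgroup.mem_carrier[OF subgroup_A])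

lemma A_one: "\<one> \<in> A" by (rule subgroup.one_closed[OF subgroup_A])
lemma A_mult: "a \<in> A \<Longrightarrow> b \<in> A \<Longrightarrow> a \<otimes> b \<in> A" by (rule subgroup.m_closed[OF subgroup_A])

lemma split_inv:
  assumes "x \<in> carrier G"
  shows "pr x \<in> A" "ex x < m" "x = pr x \<otimes> g [^] ex x"
proof -
  let ?f = "\<lambda>(a, k). a \<otimes> g [^] (k::nat)"
  have inj: "inj_on ?f (A \<times> {..<m})" and im: "?f ` (A \<times> {..<m}) = carrier G"
    using bij_split by (auto simp: bij_betw_def)
  have "the_inv_into (A \<times> {..<m}) ?f x \<in> A \<times> {..<m}"
    using the_inv_into_into[OF inj _ order_refl] assms im by blast
  then show "pr x \<in> A" "ex x < m" by (auto simp: pr_def ex_def mem_Times_iff)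
  have "?f (the_inv_into (A \<times> {..<m}) ?f x) = x"
    using f_the_inv_into_f[OF inj] assms im by blast
  then show "x = pr x \<otimes> g [^] ex x" by (simp add: pr_def ex_def case_prod_beta)
qed

lemma g_pow_mod: "g [^] (k mod m) = g [^] k"
proof -
  have "g [^] k = g [^] (m * (k div m)) \<otimes> g [^] (k mod m)"
    using g_closed by (simp add: nat_pow_mult)
  also have "g [^] (m * (k div m)) = \<one>" using g_closed g_pow_m by (simp flip: nat_pow_pow)
  finally show ?thesis using g_closed by simp
qed

lemma split_unique:
  assumes "a \<in> A"
  shows "pr (a \<otimes> g [^] k) = a" "ex (a \<otimes> g [^] k) = k mod m"
proof -
  let ?f = "\<lambda>(a, k). a \<otimes> g [^] (k::nat)"
  have inj: "inj_on ?f (A \<times> {..<m})" using bij_split by (auto simp: bij_betw_def)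
  have x: "a \<otimes> g [^] k \<in> carrier G" using assms A_closed g_closed by simp
  have "?f (pr (a \<otimes> g [^] k), ex (a \<otimes> g [^] k)) = ?f (a, k mod m)"
    using split_inv(3)[OF x, symmetric] by (simp add: g_pow_mod)
  then have "(pr (a \<otimes> g [^] k), ex (a \<otimes> g [^] k)) = (a, k mod m)"
    using split_inv(1,2)[OF x] assms m_pos by (intro inj_onD[OF inj]) auto
  then show "pr (a \<otimes> g [^] k) = a" "ex (a \<otimes> g [^] k) = k mod m" by auto
qed

lemma split_mult:
  assumes "x \<in> carrier G" "y \<in> carrier G"
  shows "pr (x \<otimes> y) = pr x \<otimes> pr y" "ex (x \<otimes> y) = (ex x + ex y) mod m"
proof -
  have c: "pr x \<in> carrier G" "pr y \<in> carrier G" using split_inv(1) assms A_closed by auto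
  have "x \<otimes> y = (pr x \<otimes> g [^] ex x) \<otimes> (pr y \<otimes> g [^] ex y)" by (intro arg_cong2[where f="monoid.mult G"] split_inv(3) assms)
  also have "\<dots> = (pr x \<otimes> pr y) \<otimes> g [^] (ex x + ex y)"
    using c g_closed by (simp add: m_ac flip: nat_pow_mult)
  finally have e: "x \<otimes> y = (pr x \<otimes> pr y) \<otimes> g [^] (ex x + ex y)" .
  show "pr (x \<otimes> y) = pr x \<otimes> pr y" "ex (x \<otimes> y) = (ex x + ex y) mod m"
    unfolding e using split_unique[OF A_mult[OF split_inv(1)[OF assms(1)] split_inv(1)[OF assms(2)]]] by simp_all
qed

lemma split_A: assumes "a \<in> A" shows "pr a = a" "ex a = 0"
  using split_unique[OF assms, of 0] A_closed[OF assms] by auto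

lemma split_g: "pr g = \<one>" "ex g = 1 mod m"
  using split_unique[OF A_one, of 1] g_closed by auto

lemma pow_ex_mult:
  fixes z :: "'k::field"
  assumes "x \<in> carrier G" "y \<in> carrier G" "z ^ m = 1"
  shows "z ^ ex (x \<otimes> y) = z ^ ex x * z ^ ex y"
  using split_mult(2)[OF assms(1,2)] power_mod_of_power_eq_1[OF assms(3), of "ex x + ex y"]
  by (simp add: power_add)

lemma pow_ex_g: "(z::'k::field) ^ m = 1 \<Longrightarrow> z ^ ex g = z"
proof (cases "m = 1")
  case False
  then have "1 mod m = 1" using m_pos by (intro mod_less) simp
  then show ?thesis by (simp only: split_g power_one_right)
qed simp

lemma comm_group_A: "comm_group (G\<lparr>carrier := A\<rparr>)"
  by (rule group.group_comm_groupI[OF subgroup_imp_group[OF subgroup_A]])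
    (simp, metis A_closed m_comm)

lemma card_split: "card (carrier G) = card A * m"
  using bij_betw_same_card[OF bij_split] by (simp add: card_cartesian_product)

end

context alg_closed_char_0
begin

text \<open>With \<open>g\<close> of maximal order, a character that is faithful on the powers of \<open>g\<close> takes no further
  values on \<open>G\<close>, so its kernel is a complement.\<close>

lemma cyclic_splitting_exists:
  fixes G :: "('g, 'x) monoid_scheme" (structure)
  assumes G: "comm_group G" and fin: "finite (carrier G)"
  shows "\<exists>A g m. cyclic_splitting G A g m \<and> (\<forall>x\<in>carrier G. x [^] m = \<one>)"
proof -
  interpret comm_group G by (rule G)
  obtain g where g: "g \<in> carrier G" "\<And>x. x \<in> carrier G \<Longrightarrow> ord x dvd ord g"
    using exists_ord_eq_exponent[OF fin] by blast
  define m where "m = ord g"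
  have m: "m > 0" unfolding m_def using ord_ge_1[OF fin g(1)] by simp
  have exp: "x [^] m = \<one>" if "x \<in> carrier G" for x
    using g(2)[OF that] pow_eq_id[OF that] by (simp add: m_def)
  obtain z :: 'k where z: "primitive_root_of_unity m z" using primitive_root_exists[OF m] by blast
  have zm: "z ^ m = 1" using z by (simp add: primitive_root_of_unity_def)
  obtain \<chi> where chi: "is_char G (carrier G) \<chi>" "\<chi> g = z"
    using char_with_value[OF G fin g(1)] zm unfolding m_def by blast
  have chi1: "\<chi> \<one> = 1" using is_char_one[OF chi(1)] by simp
  have chip: "\<chi> (x [^] (n::nat)) = \<chi> x ^ n" if "x \<in> carrier G" for x n
    using is_char_pow[OF chi(1) subgroup_self that] .
  have chim: "\<chi> (x \<otimes> y) = \<chi> x * \<chi> y" if "x \<in> carrier G" "y \<in> carrier G" for x y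
    using chi(1) that by (simp add: is_char_def)
  define A where "A = {x \<in> carrier G. \<chi> x = 1}"
  have A: "subgroup A G"
  proof (rule subgroupI)
    show "inv a \<in> A" if "a \<in> A" for a
      using that chim[of a "inv a"] chi1 by (simp add: A_def)
  qed (auto simp: A_def chi1 chim intro: exI[of _ \<one>])
  have surj: "\<exists>a\<in>A. \<exists>k<m. x = a \<otimes> g [^] k" if x: "x \<in> carrier G" for x
  proof -
    have "\<chi> x ^ m = 1" using chip[OF x, of m] exp[OF x] chi1 by simp
    then obtain k where k: "k < m" "\<chi> x = z ^ k" using roots_of_unity_eq_powers[OF z] by auto
    define a where "a = x \<otimes> inv (g [^] k)"
    have gk: "g [^] k \<in> carrier G" using g by simp
    have xa: "x = a \<otimes> g [^] k" using x gk by (simp add: a_def m_assoc)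
    have "a \<in> carrier G" using x gk by (simp add: a_def)
    moreover have "z ^ k \<noteq> 0" using zm m by (auto simp: power_0_left)
    ultimately have "a \<in> A" using chim[of a "g [^] k"] chip[OF g(1), of k] k xa gk chi(2) by (auto simp: A_def)
    then show ?thesis using xa k by blast
  qed
  have inj: "inj_on (\<lambda>(a, k). a \<otimes> g [^] (k::nat)) (A \<times> {..<m})"
  proof (rule inj_onI)
    fix p q assume pq: "p \<in> A \<times> {..<m}" "q \<in> A \<times> {..<m}"
      "(case p of (a, k) \<Rightarrow> a \<otimes> g [^] k) = (case q of (a, k) \<Rightarrow> a \<otimes> g [^] k)"
    obtain a k b l where pq': "p = (a, k)" "q = (b, l)" by (cases p, cases q) blast
    have h: "a \<in> A" "k \<in> {..<m}" "b \<in> A" "l \<in> {..<m}" "a \<otimes> g [^] k = b \<otimes> g [^] l"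
      using pq by (auto simp: pq')
    have ab: "a \<in> carrier G" "b \<in> carrier G" "\<chi> a = 1" "\<chi> b = 1" using h by (auto simp: A_def)
    have gk: "g [^] k \<in> carrier G" "g [^] l \<in> carrier G" using g by auto
    have "\<chi> (a \<otimes> g [^] k) = \<chi> (b \<otimes> g [^] l)" using h by simp
    then have e: "z ^ k = z ^ l" using ab gk chip[OF g(1)] by (simp add: chim chi(2))
    then have kl: "k = l" using h inj_onD[OF primitive_root_pow_inj_on[OF z]] by blast
    then have "a = b" using h ab gk by simp
    then show "p = q" using kl pq' by simp
  qed
  have "(\<lambda>(a, k). a \<otimes> g [^] (k::nat)) ` (A \<times> {..<m}) = carrier G"
  proof
    show "(\<lambda>(a, k). a \<otimes> g [^] (k::nat)) ` (A \<times> {..<m}) \<subseteq> carrier G"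
      using g by (auto simp: A_def)
    show "carrier G \<subseteq> (\<lambda>(a, k). a \<otimes> g [^] (k::nat)) ` (A \<times> {..<m})"
    proof
      fix x assume "x \<in> carrier G"
      then obtain a k where "a \<in> A" "k < m" "x = a \<otimes> g [^] k" using surj by blast
      then show "x \<in> (\<lambda>(a, k). a \<otimes> g [^] (k::nat)) ` (A \<times> {..<m})"
        by (intro image_eqI[of _ _ "(a, k)"]) auto
    qed
  qed
  then have "cyclic_splitting G A g m"
    using fin A g(1) m exp[OF g(1)] inj
    by (intro cyclic_splitting.intro cyclic_splitting_axioms.intro G) (simp_all add: bij_betw_def)
  then show ?thesis using exp by blast
qed

end

section \<open>Counting characters and alternating forms\<close>

definition mu :: "nat \<Rightarrow> 'k::field set" where
  "mu n = {z. z ^ n = 1}"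

text \<open>Unlike in \<open>is_char\<close>, the functions are extensional: equality is then
  pointwise equality on the group, and the set can be counted.\<close>

definition chars :: "('g, 'x) monoid_scheme \<Rightarrow> 'k::field set \<Rightarrow> ('g \<Rightarrow> 'k) set" where
  "chars G U = {\<chi> \<in> carrier G \<rightarrow>\<^sub>E U.
     \<forall>x\<in>carrier G. \<forall>y\<in>carrier G. \<chi> (x \<otimes>\<^bsub>G\<^esub> y) = \<chi> x * \<chi> y}"

definition bimult :: "('g, 'x) monoid_scheme \<Rightarrow> ('g \<times> 'g \<Rightarrow> 'k::field) \<Rightarrow> bool" where
  "bimult G b \<longleftrightarrow> (\<forall>x\<in>carrier G. \<forall>y\<in>carrier G. \<forall>z\<in>carrier G.
     b (x \<otimes>\<^bsub>G\<^esub> y, z) = b (x, z) * b (y, z) \<and> b (x, y \<otimes>\<^bsub>G\<^esub> z) = b (x, y) * b (x, z))"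

definition alt_forms :: "('g, 'x) monoid_scheme \<Rightarrow> 'k::field set \<Rightarrow> ('g \<times> 'g \<Rightarrow> 'k) set" where
  "alt_forms G U = {b \<in> carrier G \<times> carrier G \<rightarrow>\<^sub>E U. bimult G b \<and> (\<forall>x\<in>carrier G. b (x, x) = 1)}"

lemma mu_mult: "x \<in> mu n \<Longrightarrow> y \<in> mu n \<Longrightarrow> x * y \<in> mu n"
  and mu_power: "x \<in> mu n \<Longrightarrow> x ^ i \<in> mu n"
  and mu_divide: "x \<in> mu n \<Longrightarrow> y \<in> mu n \<Longrightarrow> x / y \<in> mu n"
  and mu_one: "1 \<in> mu n"
  by (auto simp: mu_def power_mult_distrib power_divide power_inverse simp flip: power_mult)
    (simp add: power_mult mult.commute[of i])

lemma mu_nonzero: "x \<in> mu n \<Longrightarrow> n > 0 \<Longrightarrow> x \<noteq> 0"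
  by (auto simp: mu_def power_0_left)

lemma mu_dvd: "m dvd n \<Longrightarrow> mu m \<subseteq> mu n"
  by (auto simp: mu_def power_mult elim!: dvdE)

lemma mu_gcd:
  assumes "m > 0"
  shows "mu m \<inter> mu n = (mu (gcd m n) :: 'k::field set)"
proof
  show "mu (gcd m n) \<subseteq> mu m \<inter> (mu n :: 'k set)" using mu_dvd[of "gcd m n"] by auto
  show "mu m \<inter> mu n \<subseteq> (mu (gcd m n) :: 'k set)"
  proof
    fix z :: 'k assume z: "z \<in> mu m \<inter> mu n"
    obtain x y where xy: "m * x = n * y + gcd m n" using bezout_nat[of m n] assms by auto
    have "z ^ (m * x) = 1" "z ^ (n * y) = 1" using z by (auto simp: mu_def power_mult)
    then show "z \<in> mu (gcd m n)" unfolding xy by (simp add: power_add mu_def)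
  qed
qed

lemma chars_mult: "\<chi> \<in> chars G U \<Longrightarrow> x \<in> carrier G \<Longrightarrow> y \<in> carrier G \<Longrightarrow> \<chi> (x \<otimes>\<^bsub>G\<^esub> y) = \<chi> x * \<chi> y"
  and chars_in: "\<chi> \<in> chars G U \<Longrightarrow> x \<in> carrier G \<Longrightarrow> \<chi> x \<in> U"
  by (auto simp: chars_def)

lemma chars_is_char: "\<chi> \<in> chars G U \<Longrightarrow> 0 \<notin> U \<Longrightarrow> is_char G (carrier G) \<chi>"
  by (auto simp: chars_def is_char_def PiE_def Pi_def)

lemma chars_eqI:
  assumes "\<chi> \<in> chars G U" "\<psi> \<in> chars G V" "\<And>x. x \<in> carrier G \<Longrightarrow> \<chi> x = \<psi> x"
  shows "\<chi> = \<psi>"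
  by (rule extensionalityI[of _ "carrier G"]) (use assms in \<open>auto simp: chars_def PiE_def\<close>)

lemma alt_forms_in: "b \<in> alt_forms G U \<Longrightarrow> x \<in> carrier G \<Longrightarrow> y \<in> carrier G \<Longrightarrow> b (x, y) \<in> U"
  and alt_forms_diag: "b \<in> alt_forms G U \<Longrightarrow> x \<in> carrier G \<Longrightarrow> b (x, x) = 1"
  and alt_forms_left: "b \<in> alt_forms G U \<Longrightarrow> x \<in> carrier G \<Longrightarrow> y \<in> carrier G \<Longrightarrow> z \<in> carrier G
    \<Longrightarrow> b (x \<otimes>\<^bsub>G\<^esub> y, z) = b (x, z) * b (y, z)"
  and alt_forms_right: "b \<in> alt_forms G U \<Longrightarrow> x \<in> carrier G \<Longrightarrow> y \<in> carrier G \<Longrightarrow> z \<in> carrier G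
    \<Longrightarrow> b (x, y \<otimes>\<^bsub>G\<^esub> z) = b (x, y) * b (x, z)"
  by (auto simp: alt_forms_def bimult_def)

lemma alt_forms_eqI:
  assumes "b \<in> alt_forms G U" "c \<in> alt_forms G V"
    "\<And>x y. x \<in> carrier G \<Longrightarrow> y \<in> carrier G \<Longrightarrow> b (x, y) = c (x, y)"
  shows "b = c"
  by (rule extensionalityI[of _ "carrier G \<times> carrier G"]) (use assms in \<open>auto simp: alt_forms_def PiE_def\<close>)

lemma alt_forms_antisym:
  assumes G: "group G" and b: "b \<in> alt_forms G U" and xy: "x \<in> carrier G" "y \<in> carrier G"
  shows "b (x, y) * b (y, x) = 1"
proof -
  interpret group G by (rule G)
  have "b (x \<otimes>\<^bsub>G\<^esub> y, x \<otimes>\<^bsub>G\<^esub> y) = 1" using alt_forms_diag[OF b] xy by blast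
  moreover have "b (x \<otimes>\<^bsub>G\<^esub> y, x \<otimes>\<^bsub>G\<^esub> y) = b (x, x) * b (x, y) * (b (y, x) * b (y, y))"
    using xy by (simp add: alt_forms_left[OF b] alt_forms_right[OF b])
  ultimately show ?thesis using alt_forms_diag[OF b] xy by simp
qed

context comm_group
begin

lemma chars_pow: "\<chi> \<in> chars G U \<Longrightarrow> 0 \<notin> U \<Longrightarrow> x \<in> carrier G \<Longrightarrow> \<chi> (x [^] (n::nat)) = \<chi> x ^ n"
  using is_char_pow[OF chars_is_char subgroup_self] by blast

lemma chars_one: "\<chi> \<in> chars G U \<Longrightarrow> 0 \<notin> U \<Longrightarrow> \<chi> \<one> = 1"
  using is_char_one[OF chars_is_char] by blast

lemma alt_forms_section: "b \<in> alt_forms G U \<Longrightarrow> y \<in> carrier G \<Longrightarrow>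
    (\<lambda>x\<in>carrier G. b (x, y)) \<in> chars G U"
  by (auto simp: chars_def alt_forms_in alt_forms_left)

end

context cyclic_splitting
begin

lemma mu_no_zero: "n > 0 \<Longrightarrow> 0 \<notin> (mu n :: 'k::field set)"
  using mu_nonzero by blast

lemma char_split:
  assumes chi: "\<chi> \<in> chars G U" and U: "0 \<notin> U" and x: "x \<in> carrier G"
  shows "\<chi> x = \<chi> (pr x) * \<chi> g ^ ex x"
proof -
  have "\<chi> x = \<chi> (pr x \<otimes> g [^] ex x)" using split_inv(3)[OF x] by simp
  also have "\<dots> = \<chi> (pr x) * \<chi> g ^ ex x"
    using chars_mult[OF chi] chars_pow[OF chi U g_closed] A_closed split_inv(1)[OF x] g_closed by simp
  finally show ?thesis .
qed

lemma char_g_pow: "\<chi> \<in> chars G U \<Longrightarrow> 0 \<notin> U \<Longrightarrow> \<chi> g ^ m = 1"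
  using chars_pow[of \<chi> U g m] chars_one[of \<chi> U] g_pow_m g_closed by simp

lemma chars_restrict:
  "\<chi> \<in> chars G U \<Longrightarrow> restrict \<chi> A \<in> chars (G\<lparr>carrier := A\<rparr>) U"
  by (auto simp: chars_def A_mult A_closed)

lemma chars_glue:
  assumes phi: "\<phi> \<in> chars (G\<lparr>carrier := A\<rparr>) (mu n)" and z: "z \<in> mu m \<inter> mu n"
  shows "(\<lambda>x\<in>carrier G. \<phi> (pr x) * z ^ ex x) \<in> chars G (mu n)"
  using z split_inv(1) chars_in[OF phi] chars_mult[OF phi]
  by (auto simp: chars_def split_mult(1) pow_ex_mult mu_def intro!: mu_mult[unfolded mu_def, simplified] mu_power[unfolded mu_def, simplified])

text \<open>A character of a direct product is a pair of characters, and one of the cyclic factor is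
  given by its value at \<open>g\<close>. That value must be an m-th root of unity besides lying in
  \<open>mu n\<close>, hence the intersection.\<close>

lemma bij_betw_chars:
  assumes n: "n > 0"
  shows "bij_betw (\<lambda>\<chi>. (restrict \<chi> A, \<chi> g)) (chars G (mu n))
     (chars (G\<lparr>carrier := A\<rparr>) (mu n) \<times> (mu m \<inter> (mu n :: 'k::field set)))"
proof (rule bij_betw_byWitness[where f' = "\<lambda>(\<phi>, z). \<lambda>x\<in>carrier G. \<phi> (pr x) * z ^ ex x"])
  have U: "0 \<notin> (mu n :: 'k set)" using n by (rule mu_no_zero)
  show "\<forall>\<chi>\<in>chars G (mu n :: 'k set). (\<lambda>(\<phi>, z). \<lambda>x\<in>carrier G. \<phi> (pr x) * z ^ ex x) (restrict \<chi> A, \<chi> g) = \<chi>"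
  proof
    fix \<chi> assume chi: "\<chi> \<in> chars G (mu n :: 'k set)"
    have "(\<lambda>x\<in>carrier G. \<chi> (pr x) * \<chi> g ^ ex x) = \<chi>"
      using char_split[OF chi U] chi by (auto simp: chars_def PiE_def extensional_def)
    moreover have "(\<lambda>x\<in>carrier G. restrict \<chi> A (pr x) * \<chi> g ^ ex x) = (\<lambda>x\<in>carrier G. \<chi> (pr x) * \<chi> g ^ ex x)"
      using split_inv(1) by (intro restrict_ext) simp
    ultimately show "(\<lambda>(\<phi>, z). \<lambda>x\<in>carrier G. \<phi> (pr x) * z ^ ex x) (restrict \<chi> A, \<chi> g) = \<chi>" by simp
  qed
  show "\<forall>p\<in>chars (G\<lparr>carrier := A\<rparr>) (mu n) \<times> (mu m \<inter> (mu n :: 'k set)).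
      (\<lambda>\<chi>. (restrict \<chi> A, \<chi> g)) ((\<lambda>(\<phi>, z). \<lambda>x\<in>carrier G. \<phi> (pr x) * z ^ ex x) p) = p"
  proof (rule ballI, clarify)
    fix \<phi> :: "'a \<Rightarrow> 'k" and z :: 'k assume phi: "\<phi> \<in> chars (G\<lparr>carrier := A\<rparr>) (mu n)" and z: "z \<in> mu m" "z \<in> mu n"
    have phi1: "\<phi> \<one> = 1" using comm_group.chars_one[OF comm_group_A phi U] by simp
    have "restrict (\<lambda>x\<in>carrier G. \<phi> (pr x) * z ^ ex x) A = restrict \<phi> A"
      by (rule restrict_ext) (simp add: A_closed split_A)
    also have "\<dots> = \<phi>" using phi by (auto simp: chars_def PiE_def extensional_restrict)
    finally show "restrict (\<lambda>x\<in>carrier G. \<phi> (pr x) * z ^ ex x) A = \<phi> \<and>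
        (\<lambda>x\<in>carrier G. \<phi> (pr x) * z ^ ex x) g = z"
      using z g_closed phi1 pow_ex_g[of z] by (simp add: split_g(1) mu_def)
  qed
  show "(\<lambda>\<chi>. (restrict \<chi> A, \<chi> g)) ` chars G (mu n :: 'k set) \<subseteq> chars (G\<lparr>carrier := A\<rparr>) (mu n) \<times> (mu m \<inter> mu n)"
    using chars_restrict char_g_pow[OF _ U] chars_in g_closed by (fastforce simp: mu_def)
  show "(\<lambda>(\<phi>, z). \<lambda>x\<in>carrier G. \<phi> (pr x) * z ^ ex x) ` (chars (G\<lparr>carrier := A\<rparr>) (mu n) \<times> (mu m \<inter> (mu n :: 'k set))) \<subseteq> chars G (mu n)"
    using chars_glue by auto
qed

end

section \<open>Decomposing alternating forms along a splitting\<close>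

lemma (in comm_group) alt_forms_right_section: "b \<in> alt_forms G U \<Longrightarrow> x \<in> carrier G \<Longrightarrow>
    (\<lambda>y\<in>carrier G. b (x, y)) \<in> chars G U"
  by (auto simp: chars_def alt_forms_in alt_forms_right)

context cyclic_splitting
begin

text \<open>This is the expansion in both coordinates: b(g, g) = 1 removes the term in
  \<open>g\<close> alone, and antisymmetry turns b(g, pr y) into the inverse of b(pr y, g). The form
  is thus known from its restriction to \<open>A\<close> and from its pairing of \<open>A\<close>
  with \<open>g\<close>.\<close>

lemma alt_form_split:
  fixes b :: "'a \<times> 'a \<Rightarrow> 'k::field"
  assumes b: "b \<in> alt_forms G (mu n)" and n: "n > 0" and x: "x \<in> carrier G" and y: "y \<in> carrier G"
  shows "b (x, y) = b (pr x, pr y) * b (pr x, g) ^ ex y / b (pr y, g) ^ ex x"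
proof -
  have U: "0 \<notin> (mu n :: 'k set)" using n by (rule mu_no_zero)
  have px: "pr x \<in> carrier G" and py: "pr y \<in> carrier G"
    using split_inv(1) A_closed x y by auto
  have left: "b (x, y) = b (pr x, y) * b (g, y) ^ ex x"
    using char_split[OF alt_forms_section[OF b y] U x] x px g_closed by simp
  have right: "b (u, y) = b (u, pr y) * b (u, g) ^ ex y" if "u \<in> carrier G" for u
    using char_split[OF alt_forms_right_section[OF b that] U y] y py g_closed by simp
  have "b (g, y) = b (g, pr y)"
    using right[OF g_closed] alt_forms_diag[OF b g_closed] by simp
  also have "\<dots> = 1 / b (pr y, g)"
    using alt_forms_antisym[OF is_group b g_closed py] by (metis mult_zero_right nonzero_eq_divide_eq zero_neq_one)
  finally show ?thesis using left right[OF px] by (simp add: power_divide)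
qed

lemma alt_forms_restrict:
  "b \<in> alt_forms G U \<Longrightarrow> restrict b (A \<times> A) \<in> alt_forms (G\<lparr>carrier := A\<rparr>) U"
  by (auto simp: alt_forms_def bimult_def A_mult A_closed)

lemma alt_forms_g_char:
  assumes b: "b \<in> alt_forms G (mu n)" and n: "n > 0"
  shows "(\<lambda>a\<in>A. b (a, g)) \<in> chars (G\<lparr>carrier := A\<rparr>) (mu m \<inter> mu n :: 'k::field set)"
proof -
  have U: "0 \<notin> (mu n :: 'k set)" using n by (rule mu_no_zero)
  have "b (a, g) ^ m = 1" if a: "a \<in> A" for a
    using char_g_pow[OF alt_forms_right_section[OF b A_closed[OF a]] U] g_closed by simp
  then show ?thesis
    using b g_closed by (auto simp: chars_def A_mult A_closed alt_forms_in alt_forms_left mu_def[of m])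
qed

text \<open>The right-hand side of \<open>alt_form_split\<close> with \<phi> in place of a \<mapsto>
  b(a, g); it rebuilds a form from its two components.\<close>

definition alt_glue :: "('a \<times> 'a \<Rightarrow> 'k::field) \<Rightarrow> ('a \<Rightarrow> 'k) \<Rightarrow> 'a \<times> 'a \<Rightarrow> 'k" where
  "alt_glue b \<phi> = (\<lambda>(x, y)\<in>carrier G \<times> carrier G.
     b (pr x, pr y) * \<phi> (pr x) ^ ex y / \<phi> (pr y) ^ ex x)"

lemma alt_glue_in:
  fixes b :: "'a \<times> 'a \<Rightarrow> 'k::field"
  assumes b: "b \<in> alt_forms (G\<lparr>carrier := A\<rparr>) (mu n)"
    and phi: "\<phi> \<in> chars (G\<lparr>carrier := A\<rparr>) (mu m \<inter> mu n)" and n: "n > 0"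
  shows "alt_glue b \<phi> \<in> alt_forms G (mu n)"
proof -
  have phin: "\<phi> a \<in> mu n" and phim: "\<phi> a ^ m = 1" if "a \<in> A" for a
    using chars_in[OF phi] that by (auto simp: mu_def)
  have phi0: "\<phi> a \<noteq> 0" if "a \<in> A" for a using mu_nonzero[OF phin[OF that] n] .
  have phimul: "\<phi> (a \<otimes> c) = \<phi> a * \<phi> c" if "a \<in> A" "c \<in> A" for a c
    using chars_mult[OF phi] that by simp
  show ?thesis
    unfolding alt_forms_def bimult_def
  proof (intro CollectI conjI ballI)
    show "alt_glue b \<phi> \<in> carrier G \<times> carrier G \<rightarrow>\<^sub>E mu n"
      using split_inv(1) by (auto simp: alt_glue_def intro!: mu_mult mu_divide mu_power phin alt_forms_in[OF b])
    fix x y z assume xyz: "x \<in> carrier G" "y \<in> carrier G" "z \<in> carrier G"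
    note p = split_inv(1)[OF xyz(1)] split_inv(1)[OF xyz(2)] split_inv(1)[OF xyz(3)]
    show "alt_glue b \<phi> (x \<otimes> y, z) = alt_glue b \<phi> (x, z) * alt_glue b \<phi> (y, z)"
      using xyz p alt_forms_left[OF b, of "pr x" "pr y" "pr z"]
      by (simp add: alt_glue_def split_mult(1) pow_ex_mult phim phimul power_mult_distrib)
    show "alt_glue b \<phi> (x, y \<otimes> z) = alt_glue b \<phi> (x, y) * alt_glue b \<phi> (x, z)"
      using xyz p alt_forms_right[OF b, of "pr x" "pr y" "pr z"]
      by (simp add: alt_glue_def split_mult(1) pow_ex_mult phim phimul power_mult_distrib)
  next
    fix x assume x: "x \<in> carrier G"
    show "alt_glue b \<phi> (x, x) = 1"
      using x split_inv(1)[OF x] phi0[of "pr x"] alt_forms_diag[OF b, of "pr x"] by (simp add: alt_glue_def)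
  qed
qed

text \<open>This is the decomposition of the exterior square of a direct sum, where the cyclic
  summand has trivial exterior square. Since \<open>g [^] m = \<one>\<close>, the pairing with
  \<open>g\<close> takes m-th roots of unity as values, which is why the second component is cut
  down to \<open>mu m\<close>.\<close>

lemma bij_betw_alt_forms:
  assumes n: "n > 0"
  shows "bij_betw (\<lambda>b. (restrict b (A \<times> A), \<lambda>a\<in>A. b (a, g))) (alt_forms G (mu n))
     (alt_forms (G\<lparr>carrier := A\<rparr>) (mu n) \<times> chars (G\<lparr>carrier := A\<rparr>) (mu m \<inter> (mu n :: 'k::field set)))"
proof (rule bij_betw_byWitness[where f' = "\<lambda>(b, \<phi>). alt_glue b \<phi>"])
  have U: "0 \<notin> (mu n :: 'k set)" using n by (rule mu_no_zero)
  show "\<forall>b\<in>alt_forms G (mu n :: 'k set).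
      (\<lambda>(b, \<phi>). alt_glue b \<phi>) (restrict b (A \<times> A), \<lambda>a\<in>A. b (a, g)) = b"
  proof
    fix b assume b: "b \<in> alt_forms G (mu n :: 'k set)"
    have "alt_glue (restrict b (A \<times> A)) (\<lambda>a\<in>A. b (a, g)) = b"
    proof (rule alt_forms_eqI[OF alt_glue_in b])
      show "restrict b (A \<times> A) \<in> alt_forms (G\<lparr>carrier := A\<rparr>) (mu n)" by (rule alt_forms_restrict[OF b])
      show "(\<lambda>a\<in>A. b (a, g)) \<in> chars (G\<lparr>carrier := A\<rparr>) (mu m \<inter> mu n)" by (rule alt_forms_g_char[OF b n])
      fix x y assume xy: "x \<in> carrier G" "y \<in> carrier G"
      then show "alt_glue (restrict b (A \<times> A)) (\<lambda>a\<in>A. b (a, g)) (x, y) = b (x, y)"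
        using alt_form_split[OF b n xy] split_inv(1) by (simp add: alt_glue_def)
    qed (rule n)
    then show "(\<lambda>(b, \<phi>). alt_glue b \<phi>) (restrict b (A \<times> A), \<lambda>a\<in>A. b (a, g)) = b" by simp
  qed
  show "\<forall>p\<in>alt_forms (G\<lparr>carrier := A\<rparr>) (mu n) \<times> chars (G\<lparr>carrier := A\<rparr>) (mu m \<inter> (mu n :: 'k set)).
      (\<lambda>b. (restrict b (A \<times> A), \<lambda>a\<in>A. b (a, g))) ((\<lambda>(b, \<phi>). alt_glue b \<phi>) p) = p"
  proof (rule ballI, clarify)
    fix b :: "'a \<times> 'a \<Rightarrow> 'k" and \<phi> :: "'a \<Rightarrow> 'k"
    assume b: "b \<in> alt_forms (G\<lparr>carrier := A\<rparr>) (mu n)"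
      and phi: "\<phi> \<in> chars (G\<lparr>carrier := A\<rparr>) (mu m \<inter> mu n)"
    have U': "0 \<notin> mu m \<inter> (mu n :: 'k set)" using U by blast
    have phi1: "\<phi> \<one> = 1" using comm_group.chars_one[OF comm_group_A phi U'] by simp
    have b1: "b (a, \<one>) = 1" if "a \<in> A" for a
      using comm_group.chars_one[OF comm_group_A comm_group.alt_forms_right_section[OF comm_group_A b] U] that A_one
      by simp
    have phim: "\<phi> a ^ m = 1" if "a \<in> A" for a
      using chars_in[OF phi] that by (auto simp: mu_def)
    have "restrict (alt_glue b \<phi>) (A \<times> A) = b"
      by (rule extensionalityI[of _ "A \<times> A"])
        (use b in \<open>auto simp: alt_glue_def alt_forms_def PiE_def A_closed split_A\<close>)
    moreover have "(\<lambda>a\<in>A. alt_glue b \<phi> (a, g)) = \<phi>"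
      by (rule extensionalityI[of _ A])
        (use phi pow_ex_g[OF phim] in \<open>auto simp: alt_glue_def chars_def PiE_def A_closed g_closed split_A split_g(1) b1 phi1\<close>)
    ultimately show "restrict (alt_glue b \<phi>) (A \<times> A) = b \<and> (\<lambda>a\<in>A. alt_glue b \<phi> (a, g)) = \<phi>" by blast
  qed
  show "(\<lambda>b. (restrict b (A \<times> A), \<lambda>a\<in>A. b (a, g))) ` alt_forms G (mu n :: 'k set)
      \<subseteq> alt_forms (G\<lparr>carrier := A\<rparr>) (mu n) \<times> chars (G\<lparr>carrier := A\<rparr>) (mu m \<inter> mu n)"
    using alt_forms_restrict alt_forms_g_char[OF _ n] by blast
  show "(\<lambda>(b, \<phi>). alt_glue b \<phi>) ` (alt_forms (G\<lparr>carrier := A\<rparr>) (mu n) \<times>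
      chars (G\<lparr>carrier := A\<rparr>) (mu m \<inter> (mu n :: 'k set))) \<subseteq> alt_forms G (mu n)"
    using alt_glue_in n by auto
qed

end

context alg_closed_char_0
begin

lemma card_mu: "n > 0 \<Longrightarrow> card (mu n :: 'k set) = n"
  using card_roots_of_unity by (simp add: mu_def)

lemma finite_mu: "n > 0 \<Longrightarrow> finite (mu n :: 'k set)"
  using finite_roots_of_unity by (simp add: mu_def)

lemma finite_chars: "finite (carrier G) \<Longrightarrow> finite U \<Longrightarrow> finite (chars G (U :: 'k set))"
  unfolding chars_def by (rule finite_subset[of _ "carrier G \<rightarrow>\<^sub>E U"]) (auto intro: finite_PiE)

lemma finite_alt_forms: "finite (carrier G) \<Longrightarrow> finite U \<Longrightarrow> finite (alt_forms G (U :: 'k set))"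
  unfolding alt_forms_def
  by (rule finite_subset[of _ "carrier G \<times> carrier G \<rightarrow>\<^sub>E U"]) (auto intro: finite_PiE)

lemma card_chars_split:
  assumes "cyclic_splitting G A g m" "n > 0"
  shows "card (chars G (mu n :: 'k set)) = card (chars (G\<lparr>carrier := A\<rparr>) (mu n :: 'k set)) * gcd m n"
proof -
  interpret cyclic_splitting G A g m by fact
  show ?thesis
    using bij_betw_same_card[OF bij_betw_chars[OF assms(2), where 'k = 'k]] m_pos
    by (simp add: card_cartesian_product mu_gcd[OF m_pos] card_mu)
qed

lemma card_alt_forms_split:
  assumes "cyclic_splitting G A g m" "n > 0"
  shows "card (alt_forms G (mu n :: 'k set)) =
    card (alt_forms (G\<lparr>carrier := A\<rparr>) (mu n :: 'k set)) * card (chars (G\<lparr>carrier := A\<rparr>) (mu (gcd m n) :: 'k set))"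
proof -
  interpret cyclic_splitting G A g m by fact
  show ?thesis
    using bij_betw_same_card[OF bij_betw_alt_forms[OF assms(2), where 'k = 'k]]
    by (simp add: card_cartesian_product mu_gcd[OF m_pos])
qed

text \<open>Each step splits off a cyclic factor annihilating the whole group. The split case passes
  this on, because a comparison of two groups has to identify their largest factors. Excluding
  \<open>m = 1\<close> makes the complement smaller.\<close>

lemma finite_abelian_induct [consumes 2, case_names trivial split]:
  fixes G :: "('g, 'x) monoid_scheme"
  assumes G: "comm_group G" and fin: "finite (carrier G)"
    and trivial: "\<And>G :: ('g, 'x) monoid_scheme. comm_group G \<Longrightarrow> carrier G = {\<one>\<^bsub>G\<^esub>} \<Longrightarrow> P G"
    and split: "\<And>(G :: ('g, 'x) monoid_scheme) A g m. cyclic_splitting G A g m \<Longrightarrow> m > 1 \<Longrightarrow>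
       (\<forall>x\<in>carrier G. x [^]\<^bsub>G\<^esub> m = \<one>\<^bsub>G\<^esub>) \<Longrightarrow> P (G\<lparr>carrier := A\<rparr>) \<Longrightarrow> P G"
  shows "P G"
  using G fin
proof (induction "card (carrier G)" arbitrary: G rule: less_induct)
  case less
  interpret comm_group G by (rule less.prems(1))
  obtain A g m where sp: "cyclic_splitting G A g m" and exp: "\<forall>x\<in>carrier G. x [^]\<^bsub>G\<^esub> m = \<one>\<^bsub>G\<^esub>"
    using cyclic_splitting_exists[OF less.prems] by blast
  interpret sp: cyclic_splitting G A g m by (rule sp)
  show ?case
  proof (cases "m = 1")
    case True
    then have "carrier G = {\<one>\<^bsub>G\<^esub>}" using exp nat_pow_eone by auto
    then show ?thesis using trivial less.prems(1) by blast
  next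
    case False
    then have m: "m > 1" using sp.m_pos by simp
    have A: "A \<subseteq> carrier G" using sp.A_closed by blast
    have "card (carrier G) > 0" using less.prems(2) card_gt_0_iff one_closed by blast
    then have "card A < card (carrier G)" using sp.card_split m by simp
    then have "P (G\<lparr>carrier := A\<rparr>)"
      using less.hyps[of "G\<lparr>carrier := A\<rparr>"] sp.comm_group_A finite_subset[OF A less.prems(2)] by simp
    then show ?thesis using split[OF sp m exp] by blast
  qed
qed

text \<open>A square root of \<open>b\<close> would not do at the prime 2, so an order on the cyclic
  factors takes its place: of the two mixed terms in \<open>alt_form_split\<close> only the one
  pairing \<open>pr x\<close> with \<open>g\<close> is kept, and antisymmetrising restores the
  other. Being bimultiplicative, \<open>\<alpha>\<close> is automatically a cocycle.\<close>

lemma alt_form_eq_commutator: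
  fixes b :: "'g \<times> 'g \<Rightarrow> 'k"
  assumes "comm_group G" "finite (carrier G)" and n: "n > 0" and "b \<in> alt_forms G (mu n)"
  shows "\<exists>\<alpha>. bimult G \<alpha> \<and> (\<forall>x\<in>carrier G. \<forall>y\<in>carrier G. \<alpha> (x, y) \<in> mu n \<and> b (x, y) = \<alpha> (x, y) / \<alpha> (y, x))"
  using assms(1,2,4)
proof (induction G arbitrary: b rule: finite_abelian_induct)
  case (trivial G)
  then interpret comm_group G by simp
  have "b (\<one>\<^bsub>G\<^esub>, \<one>\<^bsub>G\<^esub>) = 1" using alt_forms_diag[OF trivial(3)] by simp
  then show ?case using trivial(2) by (intro exI[of _ "\<lambda>_. 1"]) (auto simp: bimult_def mu_one)
next
  case (split G A g m)
  interpret cyclic_splitting G A g m by (rule split(1))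
  note b = split(5)
  obtain \<alpha> where bim: "bimult (G\<lparr>carrier := A\<rparr>) \<alpha>"
    and \<alpha>: "\<And>x y. x \<in> A \<Longrightarrow> y \<in> A \<Longrightarrow> \<alpha> (x, y) \<in> mu n \<and> restrict b (A \<times> A) (x, y) = \<alpha> (x, y) / \<alpha> (y, x)"
    using split(4)[OF alt_forms_restrict[OF b]] by auto
  have phi: "b (a, g) ^ m = 1" if "a \<in> A" for a
    using chars_in[OF alt_forms_g_char[OF b n], of a] that by (simp add: mu_def)
  have bm: "\<alpha> (x \<otimes>\<^bsub>G\<^esub> y, z) = \<alpha> (x, z) * \<alpha> (y, z)" "\<alpha> (x, y \<otimes>\<^bsub>G\<^esub> z) = \<alpha> (x, y) * \<alpha> (x, z)"
    if "x \<in> A" "y \<in> A" "z \<in> A" for x y z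
    using bim that by (auto simp: bimult_def)
  define \<beta> where "\<beta> = (\<lambda>(x, y). \<alpha> (pr x, pr y) * b (pr x, g) ^ ex y)"
  have "bimult G \<beta>"
    unfolding bimult_def
  proof (intro ballI conjI)
    fix x y z assume xyz: "x \<in> carrier G" "y \<in> carrier G" "z \<in> carrier G"
    note p = split_inv(1)[OF xyz(1)] split_inv(1)[OF xyz(2)] split_inv(1)[OF xyz(3)]
    show "\<beta> (x \<otimes>\<^bsub>G\<^esub> y, z) = \<beta> (x, z) * \<beta> (y, z)"
      using xyz p by (simp add: \<beta>_def split_mult(1) bm alt_forms_left[OF b] A_closed g_closed power_mult_distrib)
    show "\<beta> (x, y \<otimes>\<^bsub>G\<^esub> z) = \<beta> (x, y) * \<beta> (x, z)"
      using xyz p by (simp add: \<beta>_def split_mult(1) bm pow_ex_mult phi)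
  qed
  moreover have "\<beta> (x, y) \<in> mu n \<and> b (x, y) = \<beta> (x, y) / \<beta> (y, x)"
    if xy: "x \<in> carrier G" "y \<in> carrier G" for x y
  proof -
    note p = split_inv(1)[OF xy(1)] split_inv(1)[OF xy(2)]
    have "\<beta> (x, y) \<in> mu n"
      using \<alpha>[OF p] alt_forms_in[OF b A_closed[OF p(1)] g_closed] by (simp add: \<beta>_def mu_mult mu_power)
    moreover have "b (x, y) = \<beta> (x, y) / \<beta> (y, x)"
      using alt_form_split[OF b n xy] \<alpha>[OF p] p by (simp add: \<beta>_def)
    ultimately show ?thesis by blast
  qed
  ultimately show ?case by blast
qed

end

section \<open>Recovering a group from its character counts\<close>

lemma iso_of_splittings:
  assumes sG: "cyclic_splitting G A g m" and sH: "cyclic_splitting H B h m"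
    and iso: "G\<lparr>carrier := A\<rparr> \<cong> H\<lparr>carrier := B\<rparr>"
  shows "G \<cong> H"
proof -
  interpret G: cyclic_splitting G A g m by (rule sG)
  interpret H: cyclic_splitting H B h m by (rule sH)
  obtain f where f: "f \<in> iso (G\<lparr>carrier := A\<rparr>) (H\<lparr>carrier := B\<rparr>)" using iso by (auto simp: is_iso_def)
  have bij: "bij_betw f A B" and fm: "\<And>a c. a \<in> A \<Longrightarrow> c \<in> A \<Longrightarrow> f (a \<otimes>\<^bsub>G\<^esub> c) = f a \<otimes>\<^bsub>H\<^esub> f c"
    using f by (auto simp: iso_def hom_def)
  have fB: "f a \<in> B" if "a \<in> A" for a using bij that by (auto simp: bij_betw_def)
  define \<Phi> where "\<Phi> x = f (G.pr x) \<otimes>\<^bsub>H\<^esub> h [^]\<^bsub>H\<^esub> G.ex x" for x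
  have fH: "f (G.pr x) \<in> carrier H" if "x \<in> carrier G" for x
    using fB G.split_inv(1)[OF that] H.A_closed by blast
  have "\<Phi> \<in> hom G H"
  proof (rule homI)
    show "\<Phi> x \<in> carrier H" if "x \<in> carrier G" for x
      using fH[OF that] H.g_closed by (simp add: \<Phi>_def)
    fix x y assume xy: "x \<in> carrier G" "y \<in> carrier G"
    have "\<Phi> (x \<otimes>\<^bsub>G\<^esub> y) = (f (G.pr x) \<otimes>\<^bsub>H\<^esub> f (G.pr y)) \<otimes>\<^bsub>H\<^esub> h [^]\<^bsub>H\<^esub> (G.ex x + G.ex y)"
      using xy G.split_inv(1) by (simp add: \<Phi>_def G.split_mult fm H.g_pow_mod)
    then show "\<Phi> (x \<otimes>\<^bsub>G\<^esub> y) = \<Phi> x \<otimes>\<^bsub>H\<^esub> \<Phi> y"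
      using fH[OF xy(1)] fH[OF xy(2)] H.g_closed by (simp add: \<Phi>_def H.m_ac flip: H.nat_pow_mult)
  qed
  moreover have "inj_on \<Phi> (carrier G)"
  proof (rule inj_onI)
    fix x y assume xy: "x \<in> carrier G" "y \<in> carrier G" "\<Phi> x = \<Phi> y"
    have "H.pr (\<Phi> x) = f (G.pr x)" "H.ex (\<Phi> x) = G.ex x" if "x \<in> carrier G" for x
      using H.split_unique[OF fB[OF G.split_inv(1)[OF that]]] G.split_inv(2)[OF that] by (auto simp: \<Phi>_def)
    from this[OF xy(1)] this[OF xy(2)] have fe: "f (G.pr x) = f (G.pr y)" "G.ex x = G.ex y"
      using xy(3) by simp_all
    have "G.pr x = G.pr y"
      using inj_onD[OF bij_betw_imp_inj_on[OF bij] fe(1)] G.split_inv(1) xy(1,2) by blast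
    then have "G.pr x \<otimes>\<^bsub>G\<^esub> g [^]\<^bsub>G\<^esub> G.ex x = G.pr y \<otimes>\<^bsub>G\<^esub> g [^]\<^bsub>G\<^esub> G.ex y" using fe(2) by simp
    then show "x = y" using G.split_inv(3)[OF xy(1), symmetric] G.split_inv(3)[OF xy(2), symmetric] by simp
  qed
  moreover have "carrier H \<subseteq> \<Phi> ` carrier G"
  proof
    fix y assume y: "y \<in> carrier H"
    obtain a where a: "a \<in> A" "f a = H.pr y"
      using bij H.split_inv(1)[OF y] by (auto simp: bij_betw_def)
    have "\<Phi> (a \<otimes>\<^bsub>G\<^esub> g [^]\<^bsub>G\<^esub> H.ex y) = y"
      using H.split_inv(2)[OF y] H.split_inv(3)[OF y, symmetric] by (simp add: \<Phi>_def G.split_unique[OF a(1)] a(2))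
    then show "y \<in> \<Phi> ` carrier G"
      by (rule image_eqI[OF sym]) (simp add: G.A_closed[OF a(1)] G.g_closed)
  qed
  ultimately have "\<Phi> \<in> iso G H" by (auto simp: iso_def bij_betw_def hom_def)
  then show ?thesis by (rule is_isoI)
qed

lemma (in comm_group) chars_mu_exponent:
  assumes exp: "\<forall>x\<in>carrier G. x [^] m = \<one>" and m: "m > 0" and n: "n > 0"
  shows "chars G (mu n) = chars G (mu (gcd m n) :: 'k::field set)"
proof
  have U: "0 \<notin> (mu n :: 'k set)" using mu_nonzero n by blast
  show "chars G (mu (gcd m n)) \<subseteq> chars G (mu n :: 'k set)"
    using mu_dvd[of "gcd m n" n] by (auto simp: chars_def PiE_def Pi_def)
  show "chars G (mu n) \<subseteq> chars G (mu (gcd m n) :: 'k set)"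
  proof
    fix \<chi> :: "'a \<Rightarrow> 'k" assume chi: "\<chi> \<in> chars G (mu n)"
    have "\<chi> x \<in> mu (gcd m n)" if x: "x \<in> carrier G" for x
    proof -
      have "\<chi> x ^ m = 1" using chars_pow[OF chi U x, of m] chars_one[OF chi U] exp x by simp
      then show ?thesis using chars_in[OF chi x] mu_gcd[OF m, of n, where 'k = 'k] by (auto simp: mu_def)
    qed
    then show "\<chi> \<in> chars G (mu (gcd m n))" using chi unfolding chars_def PiE_def Pi_def by blast
  qed
qed

lemma one_char: "(\<lambda>x\<in>carrier G. 1::'k::field) \<in> chars G (mu n)" if "group G"
proof -
  interpret group G by fact
  show ?thesis by (auto simp: chars_def mu_one)
qed

lemma one_alt_form: "(\<lambda>x\<in>carrier G \<times> carrier G. 1::'k::field) \<in> alt_forms G (mu n)" if "group G"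
proof -
  interpret group G by fact
  show ?thesis by (auto simp: alt_forms_def bimult_def mu_one)
qed

context alg_closed_char_0
begin

lemma card_chars_pos:
  "group G \<Longrightarrow> finite (carrier G) \<Longrightarrow> n > 0 \<Longrightarrow> card (chars G (mu n :: 'k set)) > 0"
  using one_char[of G n, where 'k = 'k] finite_chars[of G "mu n"] finite_mu[of n] by (auto simp: card_gt_0_iff)

lemma card_alt_forms_pos:
  "group G \<Longrightarrow> finite (carrier G) \<Longrightarrow> n > 0 \<Longrightarrow> card (alt_forms G (mu n :: 'k set)) > 0"
  using one_alt_form[of G n, where 'k = 'k] finite_alt_forms[of G "mu n"] finite_mu[of n] by (auto simp: card_gt_0_iff)

lemma card_chars_trivial:
  assumes "comm_group G" "carrier G = {\<one>\<^bsub>G\<^esub>}" and n: "n > 0"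
  shows "card (chars G (mu n :: 'k set)) = 1"
proof -
  interpret comm_group G by fact
  have "\<chi> = (\<lambda>x\<in>carrier G. 1)" if chi: "\<chi> \<in> chars G (mu n :: 'k set)" for \<chi>
  proof (rule chars_eqI[OF chi one_char[OF is_group, of n]])
    have "\<chi> \<one>\<^bsub>G\<^esub> = 1"
      using mu_nonzero[OF _ n] by (intro chars_one[OF chi]) auto
    then show "\<chi> x = (\<lambda>x\<in>carrier G. 1) x" if "x \<in> carrier G" for x
      using that unfolding assms(2) by simp
  qed
  then have "chars G (mu n :: 'k set) = {\<lambda>x\<in>carrier G. 1}" using one_char[OF is_group] by blast
  then show ?thesis by simp
qed

lemma card_alt_forms_trivial:
  assumes "group G" "carrier G = {\<one>\<^bsub>G\<^esub>}"
  shows "card (alt_forms G (mu n :: 'k set)) = 1"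
proof -
  interpret group G by fact
  have "b = (\<lambda>x\<in>carrier G \<times> carrier G. 1)" if b: "b \<in> alt_forms G (mu n :: 'k set)" for b
  proof (rule alt_forms_eqI[OF b one_alt_form[OF is_group, of n]])
    fix x y assume xy: "x \<in> carrier G" "y \<in> carrier G"
    then have "x = y" using assms(2) by auto
    then show "b (x, y) = (\<lambda>x\<in>carrier G \<times> carrier G. 1) (x, y)"
      using alt_forms_diag[OF b] xy by auto
  qed
  then have "alt_forms G (mu n :: 'k set) = {\<lambda>x\<in>carrier G \<times> carrier G. 1}"
    using one_alt_form[OF is_group] by blast
  then show ?thesis by simp
qed

text \<open>Passing from \<open>mu m\<close> to \<open>mu (m * k)\<close> adds no character of
  \<open>G\<close>, whose exponent divides \<open>m\<close>, and hence none of \<open>H\<close>. In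
  \<open>H\<close> the count for the complement cannot drop, while the cyclic factor goes from
  \<open>gcd k m\<close> to \<open>k\<close>; so these two numbers agree.\<close>

lemma splitting_order_dvd:
  assumes sG: "cyclic_splitting G A g m" and sH: "cyclic_splitting H B h k"
    and exp: "\<forall>x\<in>carrier G. x [^]\<^bsub>G\<^esub> m = \<one>\<^bsub>G\<^esub>"
    and eq: "\<And>n. n > 0 \<Longrightarrow> card (chars G (mu n :: 'k set)) = card (chars H (mu n :: 'k set))"
  shows "k dvd m"
proof -
  interpret G: cyclic_splitting G A g m by (rule sG)
  interpret H: cyclic_splitting H B h k by (rule sH)
  let ?c = "\<lambda>n. card (chars (H\<lparr>carrier := B\<rparr>) (mu n :: 'k set))"
  have pos: "m > 0" "m * k > 0" using G.m_pos H.m_pos by auto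
  have finB: "finite B" using finite_subset[OF _ H.finite_carrier] H.A_closed by blast
  have "chars G (mu (m * k)) = chars G (mu m :: 'k set)"
    using G.chars_mu_exponent[OF exp pos, where 'k = 'k] by simp
  then have "?c (m * k) * k = ?c m * gcd k m"
    using eq[OF pos(1)] eq[OF pos(2)] card_chars_split[OF sH pos(1)] card_chars_split[OF sH pos(2)] by simp
  also have "\<dots> \<le> ?c (m * k) * gcd k m"
  proof (rule mult_right_mono[OF card_mono])
    show "finite (chars (H\<lparr>carrier := B\<rparr>) (mu (m * k) :: 'k set))"
      by (rule finite_chars) (simp_all add: finB finite_mu[OF pos(2)])
    show "chars (H\<lparr>carrier := B\<rparr>) (mu m) \<subseteq> chars (H\<lparr>carrier := B\<rparr>) (mu (m * k) :: 'k set)"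
      using mu_dvd[of m "m * k"] by (auto simp: chars_def PiE_def Pi_def)
  qed simp
  finally have "k \<le> gcd k m"
    using card_chars_pos[OF comm_group.axioms(2)[OF H.comm_group_A], of "m * k"] pos(2) finB by simp
  then have "gcd k m = k" using H.m_pos by (intro antisym) (auto intro: dvd_imp_le)
  then show ?thesis by (metis gcd_dvd2)
qed

text \<open>Divisibility in both directions shows that the cyclic factors split off from the two
  groups have the same order m. Dividing both counts by \<open>gcd m n\<close> leaves the same
  hypothesis for the complements.\<close>

theorem iso_if_card_chars_eq:
  fixes G :: "('g, 'x) monoid_scheme" and H :: "('h, 'y) monoid_scheme"
  assumes "comm_group G" "finite (carrier G)" "comm_group H" "finite (carrier H)"
    and "\<And>n. n > 0 \<Longrightarrow> card (chars G (mu n :: 'k set)) = card (chars H (mu n :: 'k set))"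
  shows "G \<cong> H"
  using assms
proof (induction G arbitrary: H rule: finite_abelian_induct)
  case (trivial G)
  interpret G: comm_group G by (rule trivial(1))
  interpret H: comm_group H by (rule trivial(3))
  obtain B h k where sH: "cyclic_splitting H B h k" and expH: "\<forall>x\<in>carrier H. x [^]\<^bsub>H\<^esub> k = \<one>\<^bsub>H\<^esub>"
    using cyclic_splitting_exists[OF trivial(3,4)] by blast
  have k: "k > 0" by (rule cyclic_splitting.m_pos[OF sH])
  have "card (chars H (mu k :: 'k set)) = 1"
    using trivial(5)[OF k] card_chars_trivial[OF trivial(1,2) k] by simp
  then have "k = 1" using card_chars_split[OF sH k] by simp
  then have "carrier H = {\<one>\<^bsub>H\<^esub>}" using expH by auto
  then have "(\<lambda>_. \<one>\<^bsub>H\<^esub>) \<in> iso G H" using trivial(2) by (auto simp: iso_def hom_def bij_betw_def)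
  then show ?case by (rule is_isoI)
next
  case (split G A g m)
  interpret G: cyclic_splitting G A g m by (rule split(1))
  obtain B h k where sH: "cyclic_splitting H B h k" and expH: "\<forall>x\<in>carrier H. x [^]\<^bsub>H\<^esub> k = \<one>\<^bsub>H\<^esub>"
    using cyclic_splitting_exists[OF split(5,6)] by blast
  interpret H: cyclic_splitting H B h k by (rule sH)
  have "k = m"
    using splitting_order_dvd[OF split(1) sH split(3) split(7)]
      splitting_order_dvd[OF sH split(1) expH split(7)[symmetric]] dvd_antisym by blast
  then have sH': "cyclic_splitting H B h m" using sH by simp
  have "G\<lparr>carrier := A\<rparr> \<cong> H\<lparr>carrier := B\<rparr>"
  proof (rule split(4)[OF H.comm_group_A])
    show "finite (carrier (H\<lparr>carrier := B\<rparr>))"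
      using finite_subset[OF _ H.finite_carrier] H.A_closed by auto
    fix n :: nat assume n: "n > 0"
    show "card (chars (G\<lparr>carrier := A\<rparr>) (mu n :: 'k set)) = card (chars (H\<lparr>carrier := B\<rparr>) (mu n :: 'k set))"
      using split(7)[OF n] card_chars_split[OF split(1) n] card_chars_split[OF sH' n] G.m_pos by simp
  qed
  then show ?case by (rule iso_of_splittings[OF split(1) sH'])
qed

text \<open>Here \<open>r t\<close> counts the cyclic factors of \<open>G\<close> whose order is divisible by \<open>p ^ Suc t\<close>.\<close>

lemma counting_profile:
  fixes G :: "('g, 'x) monoid_scheme"
  assumes "comm_group G" "finite (carrier G)" and p: "Factorial_Ring.prime p"
  shows "\<exists>r :: nat \<Rightarrow> nat. antimono r \<and>
    (\<forall>n>0. multiplicity p (card (chars G (mu n :: 'k set))) = (\<Sum>t<multiplicity p n. r t)) \<and>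
    (\<forall>n>0. multiplicity p (card (alt_forms G (mu n :: 'k set))) = (\<Sum>t<multiplicity p n. r t choose 2))"
  using assms(1,2)
proof (induction G rule: finite_abelian_induct)
  case (trivial G)
  interpret comm_group G by (rule trivial(1))
  show ?case
    using card_chars_trivial[OF trivial(1,2)] card_alt_forms_trivial[OF is_group trivial(2)]
    by (intro exI[of _ "\<lambda>_. 0"]) (auto simp: antimono_def)
next
  case (split G A g m)
  interpret G: cyclic_splitting G A g m by (rule split(1))
  interpret GA: comm_group "G\<lparr>carrier := A\<rparr>" by (rule G.comm_group_A)
  have finA: "finite (carrier (G\<lparr>carrier := A\<rparr>))"
    using finite_subset[OF _ G.finite_carrier] G.A_closed by auto
  obtain r where r: "antimono r"
    and rc: "\<And>n. n > 0 \<Longrightarrow> multiplicity p (card (chars (G\<lparr>carrier := A\<rparr>) (mu n :: 'k set))) = (\<Sum>t<multiplicity p n. r t)"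
    and ra: "\<And>n. n > 0 \<Longrightarrow> multiplicity p (card (alt_forms (G\<lparr>carrier := A\<rparr>) (mu n :: 'k set))) = (\<Sum>t<multiplicity p n. r t choose 2)"
    using split(4) by blast
  define v where "v = multiplicity p m"
  \<comment> \<open>The split-off factor of order \<open>m\<close> has p-part p^v, so it adds one
    exactly to the terms with t < v.\<close>
  define r' where "r' t = r t + (if t < v then 1 else 0)" for t
  have pe: "prime_elem p" using p by simp
  have gcd: "multiplicity p (gcd m n) = min v (multiplicity p n)" "gcd m n > 0" if "n > 0" for n
    using that G.m_pos p by (simp_all add: multiplicity_gcd v_def)
  have ind: "(\<Sum>t<s. if t < v then f t else 0) = (\<Sum>t<min v s. f t)" for s and f :: "nat \<Rightarrow> nat"
  proof -
    have "{..<s} \<inter> {t. t < v} = {..<min v s}" by auto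
    then show ?thesis by (simp add: sum.If_cases)
  qed
  have "antimono r'"
  proof (rule antimonoI)
    fix s t :: nat assume "s \<le> t"
    then show "r' t \<le> r' s" using antimonoD[OF r, of s t] by (simp add: r'_def)
  qed
  moreover have "multiplicity p (card (chars G (mu n :: 'k set))) = (\<Sum>t<multiplicity p n. r' t)" if n: "n > 0" for n
    using card_chars_split[OF split(1) n] card_chars_pos[OF GA.is_group finA n] gcd[OF n] rc[OF n]
      prime_elem_multiplicity_mult_distrib[OF pe] ind[of "\<lambda>_. 1"]
    by (simp add: r'_def sum.distrib)
  moreover have "multiplicity p (card (alt_forms G (mu n :: 'k set))) = (\<Sum>t<multiplicity p n. r' t choose 2)" if n: "n > 0" for n
  proof -
    \<comment> \<open>Pascal's rule. The extra terms \<open>r t\<close>, summed below the smaller of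
      \<open>v\<close> and the multiplicity of \<open>p\<close> in \<open>n\<close>, are the
      exponent of \<open>p\<close> in the number of characters of \<open>A\<close> with values in
      \<open>mu (gcd m n)\<close>, the second factor in \<open>card_alt_forms_split\<close>.\<close>
    have ch: "(r' t choose 2) = (r t choose 2) + (if t < v then r t else 0)" for t
      by (simp add: r'_def numeral_2_eq_2)
    show ?thesis
      using card_alt_forms_split[OF split(1) n] card_alt_forms_pos[OF GA.is_group finA n] gcd[OF n] ra[OF n]
        card_chars_pos[OF GA.is_group finA gcd(2)[OF n]] rc[OF gcd(2)[OF n]]
        prime_elem_multiplicity_mult_distrib[OF pe]
      by (simp add: ch sum.distrib ind)
  qed
  ultimately show ?case by blast
qed

end

section \<open>Conjugates of roots of unity over a subfield\<close>

definition poly_over :: "'k::field set \<Rightarrow> 'k poly \<Rightarrow> bool" where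
  "poly_over K f \<longleftrightarrow> (\<forall>i. Polynomial.coeff f i \<in> K)"

text \<open>The ring K[w]. For a root of unity w it is the field K(w), see
  \<open>adjoin_is_subfield\<close>.\<close>

definition adjoin :: "'k::field set \<Rightarrow> 'k \<Rightarrow> 'k set" where
  "adjoin K w = {poly f w |f. poly_over K f}"

section \<open>Division, minimal polynomials and adjunction over a subfield\<close>

locale subfield_of =
  fixes K :: "'k::field_char_0 set"
  assumes is_subfield: "is_subfield K"
begin

lemma zero_in: "0 \<in> K" and one_in: "1 \<in> K"
  and add_in: "x \<in> K \<Longrightarrow> y \<in> K \<Longrightarrow> x + y \<in> K"
  and mult_in: "x \<in> K \<Longrightarrow> y \<in> K \<Longrightarrow> x * y \<in> K"
  and uminus_in: "x \<in> K \<Longrightarrow> - x \<in> K"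
  and inverse_in: "x \<in> K \<Longrightarrow> inverse x \<in> K"
  using is_subfield by (auto simp: is_subfield_def)

lemma diff_in: "x \<in> K \<Longrightarrow> y \<in> K \<Longrightarrow> x - y \<in> K"
  using add_in[OF _ uminus_in, of x y] by simp

lemma divide_in: "x \<in> K \<Longrightarrow> y \<in> K \<Longrightarrow> x / y \<in> K"
  by (simp add: field_class.field_divide_inverse mult_in inverse_in)

lemma power_in: "x \<in> K \<Longrightarrow> x ^ n \<in> K"
  by (induction n) (auto simp: one_in mult_in)

lemma sum_in: "(\<And>i. i \<in> I \<Longrightarrow> f i \<in> K) \<Longrightarrow> sum f I \<in> K"
  by (induction I rule: infinite_finite_induct) (auto simp: zero_in add_in)

lemma prod_in: "(\<And>i. i \<in> I \<Longrightarrow> f i \<in> K) \<Longrightarrow> prod f I \<in> K"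
  by (induction I rule: infinite_finite_induct) (auto simp: one_in mult_in)

lemma poly_over_0: "poly_over K 0" and poly_over_1: "poly_over K 1"
  and poly_over_const: "c \<in> K \<Longrightarrow> poly_over K [:c:]"
  by (auto simp: poly_over_def zero_in one_in coeff_pCons split: nat.split)

lemma poly_over_monom: "c \<in> K \<Longrightarrow> poly_over K (Polynomial.monom c n)"
  by (auto simp: poly_over_def zero_in)

lemma poly_over_add: "poly_over K f \<Longrightarrow> poly_over K h \<Longrightarrow> poly_over K (f + h)"
  and poly_over_diff: "poly_over K f \<Longrightarrow> poly_over K h \<Longrightarrow> poly_over K (f - h)"
  and poly_over_uminus: "poly_over K f \<Longrightarrow> poly_over K (- f)"
  and poly_over_mult: "poly_over K f \<Longrightarrow> poly_over K h \<Longrightarrow> poly_over K (f * h)"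
  and poly_over_smult: "c \<in> K \<Longrightarrow> poly_over K f \<Longrightarrow> poly_over K (Polynomial.smult c f)"
  by (auto simp: poly_over_def coeff_mult intro!: add_in diff_in uminus_in mult_in sum_in)

lemma poly_in: "poly_over K f \<Longrightarrow> x \<in> K \<Longrightarrow> poly f x \<in> K"
  by (auto simp: poly_over_def poly_altdef intro!: sum_in mult_in power_in)

lemma poly_over_division:
  assumes m: "poly_over K m" "lead_coeff m = 1" and f: "poly_over K f"
  shows "\<exists>q r. poly_over K q \<and> poly_over K r \<and> f = q * m + r \<and> (r = 0 \<or> Polynomial.degree r < Polynomial.degree m)"
  using f
\<comment> \<open>The zero polynomial has measure 0 and a nonzero constant measure 1, so cancelling
  a leading constant counts as progress.\<close>
proof (induction "if f = 0 then 0 else Suc (Polynomial.degree f)" arbitrary: f rule: less_induct)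
  case less
  show ?case
  proof (cases "f = 0 \<or> Polynomial.degree f < Polynomial.degree m")
    case True
    then show ?thesis using less.prems poly_over_0 by (intro exI[of _ 0] exI[of _ f]) auto
  next
    case False
    define s where "s = Polynomial.monom (lead_coeff f) (Polynomial.degree f - Polynomial.degree m)"
    define f' where "f' = f - s * m"
    have s: "poly_over K s" using less.prems by (auto simp: s_def poly_over_def zero_in)
    have f': "poly_over K f'" using less.prems s m by (auto simp: f'_def intro!: poly_over_diff poly_over_mult)
    have s0: "s \<noteq> 0" "m \<noteq> 0" using False m by (auto simp: s_def)
    have ds: "Polynomial.degree (s * m) = Polynomial.degree f"
    proof -
      have "Polynomial.degree s = Polynomial.degree f - Polynomial.degree m"
        unfolding s_def using False by (intro Polynomial.degree_monom_eq) auto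
      then show ?thesis using False s0 by (simp add: degree_mult_eq)
    qed
    have ls: "lead_coeff (s * m) = lead_coeff f"
    proof -
      have "lead_coeff s = lead_coeff f" unfolding s_def by (rule Polynomial.lead_coeff_monom)
      then show ?thesis using m s0 by (simp add: lead_coeff_mult)
    qed
    have c0: "Polynomial.coeff f' (Polynomial.degree f) = 0"
      using ls ds by (simp add: f'_def)
    have "Polynomial.degree f' \<le> Polynomial.degree f"
      unfolding f'_def using ds by (intro degree_diff_le) auto
    then have "f' = 0 \<or> Polynomial.degree f' < Polynomial.degree f"
      using c0 by (metis leading_coeff_0_iff le_neq_implies_less)
    then have "(if f' = 0 then 0 else Suc (Polynomial.degree f')) < (if f = 0 then 0 else Suc (Polynomial.degree f))"
      using False by auto
    from less.hyps[OF this f'] obtain q r where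
      qr: "poly_over K q" "poly_over K r" "f' = q * m + r" "r = 0 \<or> Polynomial.degree r < Polynomial.degree m" by blast
    have "f = (q + s) * m + r" using qr(3) by (simp add: f'_def algebra_simps)
    then show ?thesis using qr s poly_over_add by blast
  qed
qed

lemma minimal_poly_exists:
  assumes "n > 0" "w ^ n = 1"
  shows "\<exists>m. poly_over K m \<and> lead_coeff m = 1 \<and> poly m w = 0 \<and>
    (\<forall>f. poly_over K f \<and> poly f w = 0 \<longrightarrow> m dvd f)"
proof -
  define S where "S = {f. poly_over K f \<and> f \<noteq> 0 \<and> poly f w = 0}"
  have "Polynomial.monom 1 n - 1 \<in> S"
    using assms degree_monom_minus_const[of n "1::'k"]
    by (auto simp: S_def poly_monom one_pCons intro!: poly_over_diff poly_over_monom poly_over_const one_in)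
  then obtain f where f: "f \<in> S" and min: "\<And>h. h \<in> S \<Longrightarrow> Polynomial.degree f \<le> Polynomial.degree h"
    using ex_has_least_nat[of "\<lambda>f. f \<in> S" _ Polynomial.degree] by blast
  define m where "m = Polynomial.smult (inverse (lead_coeff f)) f"
  have fS: "poly_over K f" "f \<noteq> 0" "poly f w = 0" using f by (auto simp: S_def)
  have m: "poly_over K m" "lead_coeff m = 1" "poly m w = 0" "Polynomial.degree m = Polynomial.degree f"
    using fS by (auto simp: m_def poly_over_def intro!: mult_in inverse_in)
  have "m dvd h" if h: "poly_over K h" "poly h w = 0" for h
  proof -
    obtain q r where qr: "poly_over K q" "poly_over K r" "h = q * m + r" "r = 0 \<or> Polynomial.degree r < Polynomial.degree m"
      using poly_over_division[OF m(1,2) h(1)] by blast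
    have "poly r w = 0" using qr(3) h(2) m(3) by simp
    then have "r = 0" using qr(2,4) min[of r] m(4) by (metis (mono_tags, lifting) S_def linorder_not_less mem_Collect_eq)
    then show ?thesis using qr(3) by simp
  qed
  then show ?thesis using m by blast
qed

lemma adjoin_superset: "K \<subseteq> adjoin K w" and adjoin_gen: "w \<in> adjoin K w"
proof -
  show "w \<in> adjoin K w"
    unfolding adjoin_def using poly_over_monom[OF one_in, of 1]
    by (intro CollectI exI[of _ "Polynomial.monom 1 1"]) (auto simp: poly_monom)
  show "K \<subseteq> adjoin K w"
  proof
    fix c assume "c \<in> K"
    then show "c \<in> adjoin K w"
      unfolding adjoin_def using poly_over_const by (intro CollectI exI[of _ "[:c:]"]) auto
  qed
qed

text \<open>Inverses come from dividing the minimal polynomial: m = q f + r gives q(w) f(w) = -r(w),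
  and r has smaller degree than f, so induction inverts r(w). It is nonzero, since otherwise m = q f
  with q(w) = 0, although q has smaller degree than m.\<close>

lemma adjoin_is_subfield:
  assumes n: "n > 0" and w: "w ^ n = 1"
  shows "is_subfield (adjoin K w)"
proof -
  obtain m where m: "poly_over K m" "lead_coeff m = 1" "poly m w = 0"
    and min: "\<And>f. poly_over K f \<Longrightarrow> poly f w = 0 \<Longrightarrow> m dvd f"
    using minimal_poly_exists[OF n w] by blast
  have zero: "h = 0" if "poly_over K h" "poly h w = 0" "Polynomial.degree h < Polynomial.degree m" for h
    using min[OF that(1,2)] that(3) dvd_imp_degree_le[of m h] by (cases "h = 0") auto
  have inv: "\<exists>h. poly_over K h \<and> poly h w * poly f w = 1"
    if "poly_over K f" "poly f w \<noteq> 0" "Polynomial.degree f < Polynomial.degree m" for f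
    using that
  proof (induction "Polynomial.degree f" arbitrary: f rule: less_induct)
    case less
    show ?case
    proof (cases "Polynomial.degree f = 0")
      case True
      then obtain c where "f = [:c:]" by (meson degree_eq_zeroE)
      then show ?thesis using less.prems
        by (intro exI[of _ "[:inverse c:]"]) (auto simp: poly_over_def coeff_pCons zero_in inverse_in split: nat.splits)
    next
      case False
      define f1 where "f1 = Polynomial.smult (inverse (lead_coeff f)) f"
      have f0: "lead_coeff f \<noteq> 0" using less.prems by auto
      have f1: "poly_over K f1" "lead_coeff f1 = 1" "Polynomial.degree f1 = Polynomial.degree f"
        using less.prems f0 by (auto simp: f1_def poly_over_def intro!: mult_in inverse_in)
      obtain q r where qr: "poly_over K q" "poly_over K r" "m = q * f1 + r" "r = 0 \<or> Polynomial.degree r < Polynomial.degree f1"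
        using poly_over_division[OF f1(1,2) m(1)] by blast
      have rdeg: "Polynomial.degree r < Polynomial.degree f" using qr(4) f1(3) False by auto
      have qf: "poly q w * (inverse (lead_coeff f) * poly f w) + poly r w = 0"
        using m(3) unfolding qr(3) by (simp add: f1_def mult_ac)
      have "poly r w \<noteq> 0"
      proof
        assume r0: "poly r w = 0"
        then have "r = 0" using zero qr(2) rdeg less.prems by simp
        then have mq: "m = q * f1" using qr(3) by simp
        have "poly q w = 0" using qf r0 less.prems f0 by simp
        moreover have "m \<noteq> 0" using m(2) by auto
        then have "Polynomial.degree q < Polynomial.degree m"
          using mq f1(3) False by (auto simp: degree_mult_eq)
        ultimately have "q = 0" using zero qr(1) by blast
        then show False using mq \<open>m \<noteq> 0\<close> by simp
      qed
      then obtain h where h: "poly_over K h" "poly h w * poly r w = 1"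
        using less.hyps[of r] qr(2) rdeg less.prems by auto
      define h' where "h' = Polynomial.smult (- inverse (lead_coeff f)) (h * q)"
      have "poly h' w * poly f w = poly h w * (- (poly q w * (inverse (lead_coeff f) * poly f w)))"
        by (simp add: h'_def)
      also have "\<dots> = 1" using h(2) qf by (simp add: eq_neg_iff_add_eq_0[symmetric] neg_equal_iff_equal)
      finally have "poly h' w * poly f w = 1" .
      moreover have "poly_over K h'"
        unfolding h'_def using less.prems(1) h(1) qr(1)
        by (intro poly_over_smult poly_over_mult uminus_in inverse_in) (auto simp: poly_over_def)
      ultimately show ?thesis by blast
    qed
  qed
  show ?thesis
    unfolding is_subfield_def
  proof (intro conjI ballI)
    show "0 \<in> adjoin K w" "1 \<in> adjoin K w" using adjoin_superset zero_in one_in by auto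
    fix x assume "x \<in> adjoin K w"
    then obtain f where f: "poly_over K f" "x = poly f w" by (auto simp: adjoin_def)
    show "- x \<in> adjoin K w" using f(2) poly_over_uminus[OF f(1)] poly_minus[of f w] unfolding adjoin_def by force
    show "inverse x \<in> adjoin K w"
    proof (cases "x = 0")
      case True then show ?thesis using adjoin_superset zero_in by auto
    next
      case False
      obtain q r where qr: "poly_over K q" "poly_over K r" "f = q * m + r" "r = 0 \<or> Polynomial.degree r < Polynomial.degree m"
        using poly_over_division[OF m(1,2) f(1)] by blast
      have x: "x = poly r w" using f(2) qr(3) m(3) by simp
      then have "Polynomial.degree r < Polynomial.degree m" using False qr(4) by auto
      then obtain h where "poly_over K h" "poly h w * x = 1" using inv[of r] qr(2) x False by auto
      moreover from this have "inverse x = poly h w" by (simp add: inverse_unique mult.commute)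
      ultimately show ?thesis unfolding adjoin_def by blast
    qed
    fix y assume "y \<in> adjoin K w"
    then obtain h where h: "poly_over K h" "y = poly h w" by (auto simp: adjoin_def)
    show "x + y \<in> adjoin K w" unfolding adjoin_def using f h poly_over_add[OF f(1) h(1)] by (intro CollectI exI[of _ "f + h"]) simp
    show "x * y \<in> adjoin K w" unfolding adjoin_def using f h poly_over_mult[OF f(1) h(1)] by (intro CollectI exI[of _ "f * h"]) simp
  qed
qed

end

text \<open>Vieta's formula for the second highest coefficient; it puts the trace of a root of unity
  into the base field.\<close>

lemma coeff_prod_linear:
  fixes R :: "'k::idom set"
  assumes "finite R" "card R = Suc k"
  shows "Polynomial.coeff (\<Prod>r\<in>R. [:-r, 1:]) k = - \<Sum>R"
  using assms
proof (induction R arbitrary: k rule: finite_induct)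
  case (insert a R)
  let ?P = "\<Prod>r\<in>R. [:-r, 1:]"
  have k: "card R = k" using insert by simp
  have "Polynomial.degree ?P = k" using k by (simp add: degree_prod_sum_eq)
  moreover have "lead_coeff ?P = 1" by (simp add: lead_coeff_prod)
  ultimately have top: "Polynomial.coeff ?P k = 1" by simp
  have "Polynomial.coeff ([:-a, 1:] * ?P) k = - a + (case k of 0 \<Rightarrow> 0 | Suc j \<Rightarrow> Polynomial.coeff ?P j)"
    using top by (simp add: coeff_pCons split: nat.split)
  also have "\<dots> = - a + - \<Sum>R"
    using insert.IH insert.hyps k by (auto split: nat.split)
  finally show ?case using insert.hyps by simp
qed simp

locale subfield_of_alg_closed = subfield_of K + alg_closed_char_0 "TYPE('k)" for K :: "'k::field_char_0 set"
begin

text \<open>R is the root set of the minimal polynomial of \<open>w\<close>, which divides X^n - 1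
  and so splits with distinct roots; its coefficients give the product and the sum up to sign. The
  last clause replaces the Galois action: every relation of \<open>w\<close> over K holds for all
  conjugates.\<close>

lemma conjugates_exist:
  assumes n: "n > 0" and w: "w ^ n = 1"
  obtains R where "finite R" "w \<in> R" "R \<subseteq> mu n" "\<Prod>R \<in> K" "\<Sum>R \<in> K"
    "\<forall>f r. poly_over K f \<longrightarrow> poly f w = 0 \<longrightarrow> r \<in> R \<longrightarrow> poly f r = 0"
proof -
  obtain m where m: "poly_over K m" "lead_coeff m = 1" "poly m w = 0"
    and min: "\<And>f. poly_over K f \<Longrightarrow> poly f w = 0 \<Longrightarrow> m dvd f"
    using minimal_poly_exists[OF n w] by blast
  define R where "R = {r. poly m r = 0}"
  have "poly_over K (Polynomial.monom 1 n - 1)"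
    by (intro poly_over_diff poly_over_monom poly_over_1 one_in)
  then have dvd: "m dvd Polynomial.monom 1 n - 1" using w by (intro min) (auto simp: poly_monom)
  have m_eq: "m = (\<Prod>r\<in>R. [:-r, 1:])"
    unfolding R_def by (rule dvd_unity_poly_eq_prod[OF n dvd m(2)])
  have finR: "finite R" unfolding R_def using m(2) by (intro poly_roots_finite) auto
  have roots: "poly f r = 0" if "poly_over K f" "poly f w = 0" "r \<in> R" for f r
    using min[OF that(1,2)] that(3) by (auto simp: R_def elim!: dvdE)
  have wR: "w \<in> R" using m(3) by (simp add: R_def)
  have "R \<subseteq> mu n"
  proof
    fix r assume "r \<in> R"
    then have "[:-r, 1:] dvd m" by (simp add: R_def poly_eq_0_iff_dvd)
    then have "[:-r, 1:] dvd Polynomial.monom 1 n - 1" using dvd by (rule dvd_trans)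
    then have "poly (Polynomial.monom 1 n - 1) r = 0" by (simp only: poly_eq_0_iff_dvd)
    then show "r \<in> mu n" by (simp add: poly_monom mu_def)
  qed
  moreover have "\<Prod>R \<in> K"
  proof -
    have "poly m 0 = (\<Prod>r\<in>R. - r)" by (subst m_eq) (simp add: poly_prod)
    also have "\<dots> = (-1) ^ card R * \<Prod>R" by (simp add: prod_uminus)
    finally have "\<Prod>R = (-1) ^ card R * poly m 0"
      by (simp add: power_mult_distrib[symmetric] mult.assoc[symmetric] flip: power_add mult_2)
    then show ?thesis using poly_in[OF m(1) zero_in] by (simp add: mult_in power_in uminus_in one_in)
  qed
  moreover have "\<Sum>R \<in> K"
  proof -
    obtain k where "card R = Suc k" using wR finR by (metis card_gt_0_iff empty_iff gr0_implies_Suc)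
    then have "- \<Sum>R = Polynomial.coeff m k" by (subst m_eq) (simp add: coeff_prod_linear[OF finR])
    then have "- \<Sum>R \<in> K" using m(1) by (simp add: poly_over_def)
    then show ?thesis using uminus_in by fastforce
  qed
  ultimately show thesis using that finR wR roots by blast
qed

end

section \<open>Roots of unity that are not generated by their p-th powers\<close>

lemma primitive_root_power:
  fixes z :: "'k::field"
  assumes z: "primitive_root_of_unity (a * b) z"
  shows "primitive_root_of_unity b (z ^ a)"
proof -
  have pos: "a > 0" "b > 0" using z by (auto simp: primitive_root_of_unity_def)
  have "(z ^ a) ^ k = 1 \<longleftrightarrow> b dvd k" for k
    using primitive_root_pow_eq_1_iff[OF z, of "a * k"] pos by (simp add: power_mult)
  then show ?thesis using pos by (auto simp: primitive_root_of_unity_def dest: dvd_imp_le)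
qed

lemma not_square_eq_2_rat: "(q::rat)\<^sup>2 \<noteq> 2"
proof
  assume q: "q\<^sup>2 = 2"
  obtain a b where ab: "quotient_of q = (a, b)" by (cases "quotient_of q")
  have b: "b > 0" using ab quotient_of_denom_pos by blast
  have "of_int a = q * of_int b" using quotient_of_div[OF ab] b by simp
  then have "of_int (a ^ 2) = (of_int (2 * b ^ 2) :: rat)" using q by (simp add: power_mult_distrib)
  then have e: "a ^ 2 = 2 * b ^ 2" by (simp only: of_int_eq_iff)
  then have a: "a \<noteq> 0" using b by auto
  have "2 * multiplicity 2 a = multiplicity 2 (a ^ 2)"
    using a by (simp add: prime_elem_multiplicity_power_distrib)
  also have "\<dots> = 1 + 2 * multiplicity 2 b"
    using b unfolding e by (simp add: prime_elem_multiplicity_mult_distrib prime_elem_multiplicity_power_distrib)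
  finally show False by presburger
qed

context subfield_of
begin

lemma poly_over_pcompose: "poly_over K f \<Longrightarrow> poly_over K h \<Longrightarrow> poly_over K (pcompose f h)"
proof (induction f)
  case 0 then show ?case by (simp add: poly_over_0)
next
  case (pCons a f)
  have "a \<in> K" using pCons.prems(1) by (auto simp: poly_over_def dest: spec[of _ 0])
  moreover have "poly_over K f"
    using pCons.prems(1) by (auto simp: poly_over_def coeff_pCons dest: spec[of _ "Suc _"])
  ultimately show ?case
    using pCons by (auto simp: pcompose_pCons intro!: poly_over_add poly_over_mult poly_over_const)
qed

end

context alg_closed_char_0
begin

text \<open>This is the constant term of X^n - 1, read off from its linear factors. The sign is what
  makes the argument for p = 2 differ from the one for odd p.\<close>

lemma prod_mu:
  assumes n: "n > 0"
  shows "\<Prod>(mu n :: 'k set) = (-1) ^ Suc n"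
proof -
  have "poly (Polynomial.monom 1 n - 1) 0 = (\<Prod>r\<in>mu n. - r :: 'k)"
    unfolding unity_poly_eq_prod[OF n] by (simp add: poly_prod mu_def)
  then have "- 1 = (\<Prod>r\<in>mu n. - r :: 'k)" using n by (simp add: poly_monom power_0_left)
  also have "\<dots> = (-1) ^ n * \<Prod>(mu n :: 'k set)" using n by (simp add: prod_uminus card_roots_of_unity mu_def)
  finally have "(-1) ^ n * ((-1) ^ n * \<Prod>(mu n :: 'k set)) = (-1) ^ n * (- 1)" by simp
  then show ?thesis by (simp flip: mult.assoc power_add mult_2)
qed

end

lemma mu_subset_if_primitive:
  fixes z :: "'k::field_char_0"
  assumes T: "alg_closed_char_0 TYPE('k)" and K: "is_subfield K" and z: "primitive_root_of_unity n z" "z \<in> K"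
  shows "mu n \<subseteq> K"
proof -
  interpret alg_closed_char_0 "TYPE('k)" by (rule T)
  interpret subfield_of K by unfold_locales (rule K)
  show ?thesis using roots_of_unity_eq_powers[OF z(1)] power_in[OF z(2)] by (auto simp: mu_def)
qed

context subfield_of_alg_closed
begin

text \<open>The hypothesis is a relation w = f(w^q) over K. It passes to every conjugate r, which
  can therefore be recovered from r^q.\<close>

lemma conjugates_of_generating_power:
  assumes n: "n > 0" "w ^ n = 1" and gen: "w \<in> adjoin K (w ^ q)"
  obtains R where "finite R" "w \<in> R" "R \<subseteq> mu n" "\<Prod>R \<in> K" "\<Sum>R \<in> K" "inj_on (\<lambda>r. r ^ q) R"
    "\<forall>f r. poly_over K f \<longrightarrow> poly f w = 0 \<longrightarrow> r \<in> R \<longrightarrow> poly f r = 0"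
proof -
  obtain f where f: "poly_over K f" "w = poly f (w ^ q)" using gen by (auto simp: adjoin_def)
  obtain R where R: "finite R" "w \<in> R" "R \<subseteq> mu n" "\<Prod>R \<in> K" "\<Sum>R \<in> K"
    and roots: "\<forall>f r. poly_over K f \<longrightarrow> poly f w = 0 \<longrightarrow> r \<in> R \<longrightarrow> poly f r = 0"
    by (rule conjugates_exist[OF n])
  define h where "h = Polynomial.monom 1 1 - pcompose f (Polynomial.monom 1 q)"
  have "poly_over K h"
    unfolding h_def by (intro poly_over_diff poly_over_pcompose poly_over_monom one_in f(1))
  moreover have ph: "poly h x = x - poly f (x ^ q)" for x
    by (simp add: h_def poly_pcompose poly_monom)
  ultimately have "r = poly f (r ^ q)" if "r \<in> R" for r
    using roots[rule_format, of h r] that f(2) by simp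
  then have "inj_on (\<lambda>r. r ^ q) R" by (rule inj_on_inverseI[OF sym])
  then show thesis using that R roots by blast
qed

text \<open>If \<open>w\<close> were in \<open>K(w\<^sup>p)\<close>, its conjugates would have distinct \<open>p\<close>-th powers, so there would be at most
  \<open>p\<close> of them; in each case their product, which lies in \<open>K\<close>, gives back \<open>w\<^sup>p\<close>.\<close>

lemma root_not_in_adjoin:
  assumes p: "Factorial_Ring.prime p" and mup: "mu p \<subseteq> K" and mu4: "p = 2 \<Longrightarrow> mu 4 \<subseteq> K"
    and n: "n > 0" "w ^ n = 1" and wK: "w ^ (p\<^sup>2) \<in> K" and not: "w ^ p \<notin> K"
  shows "w \<notin> adjoin K (w ^ p)"
proof
  assume gen: "w \<in> adjoin K (w ^ p)"
  obtain R where R: "finite R" "w \<in> R" "R \<subseteq> mu n" "\<Prod>R \<in> K" "\<Sum>R \<in> K" and inj: "inj_on (\<lambda>r. r ^ p) R"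
    and roots: "\<forall>f r. poly_over K f \<longrightarrow> poly f w = 0 \<longrightarrow> r \<in> R \<longrightarrow> poly f r = 0"
    by (rule conjugates_of_generating_power[OF n gen])
  have p0: "p > 0" using p by (rule prime_gt_0_nat)
  have w0: "w \<noteq> 0" using n by (auto simp: power_0_left)
  \<comment> \<open>X^(p^2) - w^(p^2) has coefficients in K and vanishes at \<open>w\<close>, so it
    vanishes at all conjugates. Their p-th powers therefore differ from w^p by p-th roots of unity,
    which lie in K.\<close>
  have "r ^ (p\<^sup>2) = w ^ (p\<^sup>2)" if "r \<in> R" for r
    using roots[rule_format, of "Polynomial.monom 1 (p\<^sup>2) - [:w ^ (p\<^sup>2):]" r] that
    by (simp add: poly_monom poly_over_diff poly_over_monom poly_over_const one_in wK)
  then have smu: "(r / w) ^ p \<in> mu p" if "r \<in> R" for r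
    using that w0 by (simp add: mu_def power_divide power2_eq_square flip: power_mult)
  define s where "s r = (r / w) ^ p" for r
  have sinj: "inj_on s R" using inj w0 by (auto simp: inj_on_def s_def power_divide)
  have card: "card R \<le> p"
    using card_inj_on_le[OF sinj _ finite_roots_of_unity[OF p0]] smu card_roots_of_unity[OF p0]
    by (auto simp: s_def mu_def)
  have cpos: "card R > 0" using R by (auto simp: card_gt_0_iff)
  have s_in: "s r \<in> K" "s r \<noteq> 0" if "r \<in> R" for r
    using smu[OF that] mup mu_nonzero[OF smu[OF that] p0] by (auto simp: s_def)
  then have prod_s: "prod s R \<in> K" "prod s R \<noteq> 0"
    using R(1) by (auto intro: prod_in)
  have eta: "(w ^ p) ^ p \<in> K" using wK by (simp add: power2_eq_square flip: power_mult)
  show False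
  proof (cases "card R < p")
    case True
    \<comment> \<open>With d < p conjugates, the p-th power of their product is (w^p)^d up to a
      factor in K. As d is prime to p and (w^p)^p lies in K, a Bezout relation between d and p
      isolates w^p.\<close>
    have "(\<Prod>R) ^ p = (\<Prod>r\<in>R. w ^ p * s r)"
      unfolding prod_power_distrib using w0 by (intro prod.cong) (auto simp: s_def power_divide)
    also have "\<dots> = (w ^ p) ^ card R * prod s R" by (simp add: prod.distrib)
    finally have "(w ^ p) ^ card R = (\<Prod>R) ^ p / prod s R" using prod_s by simp
    then have etad: "(w ^ p) ^ card R \<in> K" using prod_s R by (simp add: divide_in power_in)
    have "coprime (card R) p" using True cpos p
      by (metis coprime_commute dvd_imp_le linorder_not_less prime_imp_coprime)
    then obtain x y where xy: "card R * x = p * y + 1"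
      using bezout_nat[of "card R" p] cpos by auto
    have "((w ^ p) ^ card R) ^ x = ((w ^ p) ^ p) ^ y * w ^ p"
      by (simp only: flip: power_mult) (simp only: xy mult.assoc power_add distrib_left mult_1_right flip: power_mult)
    then have "w ^ p = ((w ^ p) ^ card R) ^ x / ((w ^ p) ^ p) ^ y" using w0 by simp
    then have "w ^ p \<in> K" using etad eta by (metis divide_in power_in)
    then show False using not by blast
  next
    case False
    then have cR: "card R = p" using card by simp
    \<comment> \<open>Each p-th root of unity now occurs once among the quotients
      \<open>s r\<close>, so u below, which is \<open>\<Prod>R\<close> divided by w^p, satisfies u^p
      = (-1)^(p+1). For odd p this puts u in \<open>mu p\<close>; for p = 2 it is a square root of
      -1, and \<open>mu 4\<close> is used.\<close>
    have "s ` R = mu p"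
    proof (rule card_subset_eq)
      show "s ` R \<subseteq> mu p" using smu by (auto simp: s_def)
      show "card (s ` R) = card (mu p :: 'k set)"
        using card_image[OF sinj] cR card_roots_of_unity[OF p0] by (simp add: mu_def)
    qed (use finite_roots_of_unity[OF p0] in \<open>simp add: mu_def\<close>)
    then have ps: "prod s R = (-1) ^ Suc p"
      using prod.reindex[OF sinj, of "\<lambda>x. x"] prod_mu[OF p0] by simp
    define u where "u = (\<Prod>r\<in>R. r / w)"
    have up: "u ^ p = (-1) ^ Suc p" unfolding u_def prod_power_distrib using ps by (simp add: s_def)
    have "u \<in> K"
    proof (cases "p = 2")
      case True
      then have "u\<^sup>2 = -1" using up by simp
      then have "u ^ 4 = 1" using power_mult[of u 2 2] by simp
      then show ?thesis using mu4[OF True] by (auto simp: mu_def)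
    next
      case False
      then have "odd p" using p primes_dvd_imp_eq two_is_prime_nat by blast
      then show ?thesis using up mup by (auto simp: mu_def)
    qed
    moreover have "u \<noteq> 0" using up p0 by (auto simp: power_0_left)
    moreover have "\<Prod>R = w ^ p * u" using w0 by (simp add: u_def prod_dividef cR)
    ultimately have "w ^ p \<in> K" using R(4) divide_in[of "\<Prod>R" u] by simp
    then show False using not by blast
  qed
qed

text \<open>If \<open>w\<close> were generated by its square, its only other conjugate would be r =
  \<plusminus>w^3, with r^2 = -w^2. The trace w + r, a square root of \<plusminus>2, would then lie
  in K and in the eighth cyclotomic field, yet it is not rational.\<close>

lemma eighth_root_not_in_adjoin:
  assumes w: "primitive_root_of_unity 8 w" and not: "w\<^sup>2 \<notin> K"
    and rat: "K \<inter> cyclotomic_field 8 \<subseteq> \<rat>"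
  shows "w \<notin> adjoin K (w\<^sup>2)"
proof
  assume gen: "w \<in> adjoin K (w\<^sup>2)"
  have w8: "w ^ 8 = 1" using w by (simp add: primitive_root_of_unity_def)
  have w4: "w ^ 4 = -1"
  proof -
    have "(w ^ 4)\<^sup>2 = 1" using w8 by (simp flip: power_mult)
    moreover have "w ^ 4 \<noteq> 1" using primitive_root_pow_eq_1_iff[OF w, of 4] by simp
    ultimately show ?thesis by (simp only: power2_eq_1_iff) simp
  qed
  obtain R where R: "finite R" "w \<in> R" "R \<subseteq> mu 8" "\<Prod>R \<in> K" "\<Sum>R \<in> K" and inj: "inj_on (\<lambda>r. r\<^sup>2) R"
    and roots: "\<forall>f r. poly_over K f \<longrightarrow> poly f w = 0 \<longrightarrow> r \<in> R \<longrightarrow> poly f r = 0"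
    by (rule conjugates_of_generating_power[OF _ w8 gen]) simp
  have r4: "r ^ 4 = -1" if "r \<in> R" for r
    using roots[rule_format, of "Polynomial.monom 1 4 - [:-1:]" r] that w4
    by (simp add: poly_monom poly_over_diff poly_over_monom poly_over_const one_in uminus_in eq_neg_iff_add_eq_0)
  have r2: "r\<^sup>2 = - w\<^sup>2" if "r \<in> R" "r \<noteq> w" for r
  proof -
    have "(r\<^sup>2)\<^sup>2 = (w\<^sup>2)\<^sup>2" using r4[OF that(1)] w4 by (simp flip: power_mult)
    moreover have "r\<^sup>2 \<noteq> w\<^sup>2" using inj R(2) that by (auto simp: inj_on_def)
    ultimately show ?thesis by (simp only: power2_eq_iff) simp
  qed
  have "R \<noteq> {w}" using R(4) not power_in[of w 2] by auto
  then obtain r where r: "r \<in> R" "r \<noteq> w" using R(2) by blast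
  have "R = {w, r}"
  proof
    show "R \<subseteq> {w, r}"
    proof
      fix t assume t: "t \<in> R"
      show "t \<in> {w, r}"
      proof (rule ccontr)
        assume "t \<notin> {w, r}"
        then have "t\<^sup>2 = r\<^sup>2" using r2[OF t] r2[OF r] by simp
        then show False using inj t r \<open>t \<notin> {w, r}\<close> by (auto simp: inj_on_def)
      qed
    qed
  qed (use R r in blast)
  then have xK: "w + r \<in> K" using R(5) r by (simp add: add.commute)
  have "(w ^ 3)\<^sup>2 = w ^ 4 * w\<^sup>2" by (simp flip: power_mult power_add)
  then have "r\<^sup>2 = (w ^ 3)\<^sup>2" using r2[OF r] w4 by simp
  then have r3: "r = w ^ 3 \<or> r = - (w ^ 3)" by (simp only: power2_eq_iff)
  have "w + r \<in> L" if L: "is_subfield L" "{z. primitive_root_of_unity 8 z} \<subseteq> L" for L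
  proof -
    interpret L: subfield_of L by unfold_locales (rule L)
    show ?thesis using r3 L(2) w by (auto intro!: L.add_in L.diff_in L.uminus_in L.power_in)
  qed
  then have "w + r \<in> cyclotomic_field 8"
    by (auto simp: cyclotomic_field_def gen_subfield_def)
  then have "w + r \<in> \<rat>" using rat xK by blast
  then obtain q where q: "w + r = of_rat q" by (auto elim: Rats_cases)
  have "(w + r)\<^sup>2 = 2 * (w * r)" using r2[OF r] by (simp add: power2_sum)
  then have "(w + r) ^ 4 = 4 * (w\<^sup>2 * r\<^sup>2)" using power_mult[of "w + r" 2 2] by (simp add: power_mult_distrib)
  also have "\<dots> = 4" using r2[OF r] w4 by (simp flip: power_add)
  finally have "of_rat (q ^ 4) = (of_rat 4 :: 'k)" using q by (simp add: of_rat_power)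
  then have "q ^ 4 = 4" by (simp only: of_rat_eq_iff)
  then have "(q\<^sup>2)\<^sup>2 = 2\<^sup>2" by (simp flip: power_mult)
  then have "q\<^sup>2 = 2" by (subst (asm) power2_eq_iff_nonneg) auto
  then show False using not_square_eq_2_rat by blast
qed

end

section \<open>The cyclotomic polynomial of order p squared\<close>

lemma prime_dvd_power_add_diff:
  fixes a b :: "'a::comm_ring_1"
  assumes p: "Factorial_Ring.prime (p::nat)"
  shows "of_nat p dvd (a + b) ^ p - (a ^ p + b ^ p)"
proof -
  have p0: "p > 0" using p by (rule prime_gt_0_nat)
  have "(a + b) ^ p = (\<Sum>k\<le>p. of_nat (p choose k) * a ^ k * b ^ (p - k))" by (rule binomial_ring)
  also have "{..p} = insert 0 (insert p {0<..<p})" by auto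
  also have "(\<Sum>k\<in>\<dots>. of_nat (p choose k) * a ^ k * b ^ (p - k)) =
      a ^ p + b ^ p + (\<Sum>k\<in>{0<..<p}. of_nat (p choose k) * a ^ k * b ^ (p - k))"
    using p0 by (simp add: algebra_simps)
  finally have "(a + b) ^ p - (a ^ p + b ^ p) = (\<Sum>k\<in>{0<..<p}. of_nat (p choose k) * a ^ k * b ^ (p - k))"
    by simp
  also have "of_nat p dvd \<dots>"
  proof (intro dvd_sum)
    fix k assume "k \<in> {0<..<p}"
    then have "p dvd (p choose k)" using p p0 by (intro dvd_choose_prime) auto
    then show "of_nat p dvd of_nat (p choose k) * a ^ k * b ^ (p - k)"
      by (metis dvd_mult2 of_nat_dvd_iff of_nat_mult dvd_def)
  qed
  finally show ?thesis .
qed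

text \<open>Let i be the first index at which \<open>p\<close> does not divide the coefficient of P.
  Modulo \<open>p\<close> the i-th coefficient of P * Q is that of P times the constant term of Q,
  hence nonzero. So i is at least d, and P takes up the whole degree.\<close>

lemma eisenstein_aux:
  fixes P Q :: "int poly"
  assumes p: "Factorial_Ring.prime p" and coeffs: "\<And>k. k < d \<Longrightarrow> p dvd Polynomial.coeff (P * Q) k"
    and deg: "Polynomial.degree (P * Q) = d" and lead: "\<not> p dvd lead_coeff (P * Q)"
    and Q0: "\<not> p dvd Polynomial.coeff Q 0"
  shows "Polynomial.degree Q = 0"
proof -
  have nz: "P * Q \<noteq> 0" using lead by auto
  then have PQ: "P \<noteq> 0" "Q \<noteq> 0" by auto
  have "\<not> p dvd lead_coeff P" using lead by (auto simp: lead_coeff_mult)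
  define i where "i = (LEAST i. \<not> p dvd Polynomial.coeff P i)"
  have i: "\<not> p dvd Polynomial.coeff P i"
    unfolding i_def by (rule LeastI) (rule \<open>\<not> p dvd lead_coeff P\<close>)
  have less: "p dvd Polynomial.coeff P k" if "k < i" for k
    using not_less_Least that unfolding i_def by blast
  have iP: "i \<le> Polynomial.degree P" using i by (intro le_degree) auto
  have "i \<ge> d"
  proof (rule ccontr)
    assume "\<not> i \<ge> d"
    then have "p dvd Polynomial.coeff (P * Q) i" using coeffs by simp
    moreover have "Polynomial.coeff (P * Q) i =
        (\<Sum>k<i. Polynomial.coeff P k * Polynomial.coeff Q (i - k)) + Polynomial.coeff P i * Polynomial.coeff Q 0"
      by (simp add: coeff_mult flip: lessThan_Suc_atMost)
    moreover have "p dvd (\<Sum>k<i. Polynomial.coeff P k * Polynomial.coeff Q (i - k))"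
      using less by (intro dvd_sum) auto
    ultimately have "p dvd Polynomial.coeff P i * Polynomial.coeff Q 0"
      by (simp add: dvd_add_right_iff)
    then show False using i Q0 p by (auto simp: prime_dvd_mult_iff)
  qed
  then show ?thesis using iP deg PQ by (simp add: degree_mult_eq)
qed

lemma eisenstein:
  fixes P Q :: "int poly"
  assumes p: "Factorial_Ring.prime p" and coeffs: "\<And>k. k < d \<Longrightarrow> p dvd Polynomial.coeff (P * Q) k"
    and deg: "Polynomial.degree (P * Q) = d" and lead: "\<not> p dvd lead_coeff (P * Q)"
    and c0: "\<not> p\<^sup>2 dvd Polynomial.coeff (P * Q) 0" and d: "d > 0"
  shows "Polynomial.degree P = 0 \<or> Polynomial.degree Q = 0"
proof -
  have c: "Polynomial.coeff (P * Q) 0 = Polynomial.coeff P 0 * Polynomial.coeff Q 0" by (simp add: coeff_mult)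
  have "p dvd Polynomial.coeff P 0 * Polynomial.coeff Q 0" using coeffs[OF d] c by simp
  then consider "p dvd Polynomial.coeff P 0" | "p dvd Polynomial.coeff Q 0"
    using p by (auto simp: prime_dvd_mult_iff)
  then show ?thesis
  proof cases
    case 1
    then have "\<not> p dvd Polynomial.coeff Q 0" using c0 c by (auto simp: power2_eq_square mult_dvd_mono)
    then show ?thesis using eisenstein_aux[OF p coeffs deg lead] by simp
  next
    case 2
    then have "\<not> p dvd Polynomial.coeff P 0" using c0 c by (auto simp: power2_eq_square mult_dvd_mono)
    then show ?thesis using eisenstein_aux[of p d Q P] p coeffs deg lead by (simp add: mult.commute)
  qed
qed

text \<open>For a prime p this is the p^2-th cyclotomic polynomial, the quotient of X^(p^2) - 1 by
  X^p - 1.\<close>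

definition cyclo :: "nat \<Rightarrow> int poly" where
  "cyclo p = (\<Sum>i<p. Polynomial.monom 1 (p * i))"

lemma coeff_cyclo: "p > 0 \<Longrightarrow> Polynomial.coeff (cyclo p) k = (if p dvd k \<and> k < p * p then 1 else 0)"
proof -
  assume p: "p > 0"
  have "Polynomial.coeff (cyclo p) k = (\<Sum>i<p. if p * i = k then 1 else 0)"
    by (simp add: cyclo_def coeff_sum)
  also have "\<dots> = (if p dvd k \<and> k < p * p then 1 else 0)"
  proof (cases "p dvd k \<and> k < p * p")
    case True
    then obtain j where j: "k = p * j" "j < p" using p by auto
    have "(\<Sum>i<p. if p * i = k then 1 else 0) = (\<Sum>i<p. if i = j then 1 else (0::int))"
      using j p by (intro sum.cong) auto
    then show ?thesis using True j by simp
  next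
    case False
    then have "(\<Sum>i<p. if p * i = k then 1 else 0) = (\<Sum>i<p. (0::int))"
      by (intro sum.cong) auto
    then show ?thesis using False by auto
  qed
  finally show ?thesis .
qed

lemma degree_cyclo:
  assumes p: "p > 0"
  shows "Polynomial.degree (cyclo p) = p * (p - 1)" "lead_coeff (cyclo p) = 1" "cyclo p \<noteq> 0"
proof -
  have lt: "p * (p - 1) < p * p" using p by simp
  have le: "k \<le> p * (p - 1)" if dvd: "p dvd k" and less: "k < p * p" for k
  proof -
    obtain j where "k = p * j" using dvd by auto
    then show ?thesis using less p by auto
  qed
  have "Polynomial.degree (cyclo p) \<le> p * (p - 1)"
    by (rule degree_le) (use le in \<open>auto simp: coeff_cyclo[OF p] leD\<close>)
  moreover have c1: "Polynomial.coeff (cyclo p) (p * (p - 1)) = 1" using lt by (simp add: coeff_cyclo[OF p])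
  ultimately show d: "Polynomial.degree (cyclo p) = p * (p - 1)"
    by (intro antisym le_degree) auto
  show "lead_coeff (cyclo p) = 1" using c1 d by simp
  then show "cyclo p \<noteq> 0" by auto
qed

lemma pcompose_monom: "pcompose (Polynomial.monom (1::int) k) h = h ^ k"
proof (induction k)
  case (Suc k)
  have "Polynomial.monom (1::int) (Suc k) = pCons 0 (Polynomial.monom 1 k)" by (simp add: monom_Suc)
  then show ?case using Suc by (simp add: pcompose_pCons)
qed (simp add: pcompose_1)

text \<open>Modulo p, (X + 1)^p is X^p + 1. Hence X^p times the shifted polynomial is congruent to
  the telescoped sum (X^p + 1)^p - 1, that is to X^(p^2), and only the leading coefficient
  survives.\<close>

lemma cyclo_shift_coeff_dvd:
  assumes p: "Factorial_Ring.prime (p::nat)" and k: "k < p * (p - 1)"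
  shows "int p dvd Polynomial.coeff (pcompose (cyclo p) [:1, 1:]) k"
proof -
  define x where "x = Polynomial.monom (1::int) 1"
  have p0: "p > 0" using p by (rule prime_gt_0_nat)
  have X1: "[:1, 1:] = x + 1" by (simp add: x_def monom_Suc one_pCons)
  define \<Psi> where "\<Psi> = pcompose (cyclo p) [:1, 1:]"
  have \<Psi>: "\<Psi> = (\<Sum>i<p. ((x + 1) ^ p) ^ i)"
    unfolding \<Psi>_def cyclo_def by (simp add: pcompose_sum pcompose_monom X1 power_mult)
  have 1: "of_nat p dvd (x + 1) ^ p - (x ^ p + 1)" using prime_dvd_power_add_diff[OF p, of x 1] by simp
  have 2: "of_nat p dvd (x ^ p + 1) ^ p - ((x ^ p) ^ p + 1)" using prime_dvd_power_add_diff[OF p, of "x ^ p" 1] by simp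
  have pow: "of_nat p dvd ((x + 1) ^ p) ^ i - (x ^ p + 1) ^ i" for i
  proof -
    have "(x + 1) ^ p - (x ^ p + 1) dvd ((x + 1) ^ p) ^ i - (x ^ p + 1) ^ i"
    proof (induction i)
      case (Suc i)
      have "a * u - b * v = a * (u - v) + (a - b) * v" for a b u v :: "int poly" by (simp add: algebra_simps)
      then show ?case using Suc by (simp only: power_Suc dvd_add dvd_mult dvd_triv_left)
    qed simp
    then show ?thesis using 1 dvd_trans by blast
  qed
  have "of_nat p dvd (\<Sum>i<p. ((x + 1) ^ p) ^ i - (x ^ p + 1) ^ i)" by (intro dvd_sum pow)
  then have 3: "of_nat p dvd \<Psi> - (\<Sum>i<p. (x ^ p + 1) ^ i)" by (simp add: \<Psi> sum_subtractf)
  have "x ^ p * (\<Sum>i<p. (x ^ p + 1) ^ i) = (x ^ p + 1) ^ p - 1"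
    using power_diff_1_eq[of "x ^ p + 1" p] by simp
  then have "x ^ p * \<Psi> - (x ^ p) ^ p = x ^ p * (\<Psi> - (\<Sum>i<p. (x ^ p + 1) ^ i)) + ((x ^ p + 1) ^ p - ((x ^ p) ^ p + 1))"
    by (simp add: algebra_simps)
  also have "of_nat p dvd \<dots>" using 2 3 by (intro dvd_add dvd_mult)
  finally have "of_nat p dvd x ^ p * \<Psi> - (x ^ p) ^ p" .
  then have "[:int p:] dvd Polynomial.monom 1 p * \<Psi> - Polynomial.monom 1 (p * p)"
    by (simp add: x_def monom_power of_nat_poly mult.commute)
  then have "int p dvd Polynomial.coeff (Polynomial.monom 1 p * \<Psi> - Polynomial.monom 1 (p * p)) (k + p)"
    by (subst (asm) const_poly_dvd_iff) blast
  moreover have "k + p \<noteq> p * p" using k p0 by (cases p) auto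
  ultimately show ?thesis by (simp add: coeff_monom_mult \<Psi>_def)
qed

text \<open>Eisenstein's criterion applies after the shift X \<mapsto> X + 1; the constant term of
  the shifted polynomial is the value at 1, which is p.\<close>

lemma cyclo_factor:
  fixes P Q :: "int poly"
  assumes p: "Factorial_Ring.prime (p::nat)" and PQ: "cyclo p = P * Q"
  shows "Polynomial.degree P = 0 \<or> Polynomial.degree Q = 0"
proof -
  define \<Psi> where "\<Psi> = pcompose (cyclo p) [:1, 1:]"
  have p1: "p > 1" using p by (rule prime_gt_1_nat)
  then have p0: "p > 0" by simp
  have \<Psi>: "\<Psi> = pcompose P [:1, 1:] * pcompose Q [:1, 1:]" by (simp add: \<Psi>_def PQ pcompose_mult)
  have deg: "Polynomial.degree \<Psi> = p * (p - 1)" by (simp add: \<Psi>_def degree_cyclo(1)[OF p0] Polynomial.degree_pcompose)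
  have "lead_coeff \<Psi> = 1"
    unfolding \<Psi>_def by (subst lead_coeff_comp) (simp_all add: degree_cyclo(2)[OF p0])
  then have lead: "\<not> int p dvd lead_coeff \<Psi>" using p1 by (simp add: zdvd_not_zless)
  have "Polynomial.coeff \<Psi> 0 = poly (cyclo p) 1"
    by (simp add: \<Psi>_def poly_0_coeff_0[symmetric] poly_pcompose)
  also have "\<dots> = int p" by (simp add: cyclo_def poly_sum poly_monom)
  finally have c0: "\<not> (int p)\<^sup>2 dvd Polynomial.coeff \<Psi> 0"
    using p1 by (auto simp: power2_eq_square dest!: zdvd_imp_le)
  have pp: "Factorial_Ring.prime (int p)" using p by simp
  have "Polynomial.degree (pcompose P [:1, 1:]) = 0 \<or> Polynomial.degree (pcompose Q [:1, 1:]) = 0"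
  proof (rule eisenstein[OF pp])
    show "int p dvd Polynomial.coeff (pcompose P [:1, 1:] * pcompose Q [:1, 1:]) k" if "k < p * (p - 1)" for k
      using cyclo_shift_coeff_dvd[OF p that] \<Psi> by (simp add: \<Psi>_def)
  qed (use deg lead c0 p1 in \<open>auto simp: \<Psi>\<close>)
  then show ?thesis by (simp add: Polynomial.degree_pcompose)
qed

section \<open>Integer relations satisfied by a primitive p^2-th root of unity\<close>

definition ipoly :: "int poly \<Rightarrow> 'k::field_char_0 poly" where
  "ipoly A = map_poly of_int A"

lemma coeff_ipoly: "Polynomial.coeff (ipoly A) i = of_int (Polynomial.coeff A i)"
  by (simp add: ipoly_def coeff_map_poly)

lemma ipoly_simps:
  "ipoly (A * B) = ipoly A * ipoly B" "ipoly (A - B) = ipoly A - ipoly B" "ipoly (A + B) = ipoly A + ipoly B"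
  "ipoly (Polynomial.smult c A) = Polynomial.smult (of_int c) (ipoly A)"
  "ipoly (Polynomial.monom c n) = Polynomial.monom (of_int c) n" "ipoly 0 = 0"
  "ipoly A = 0 \<longleftrightarrow> A = 0" "ipoly [:c:] = [:of_int c:]"
  by (auto simp: poly_eq_iff coeff_ipoly coeff_mult coeff_pCons split: nat.splits)

lemma ipoly_sum: "ipoly (sum f I) = (\<Sum>i\<in>I. ipoly (f i))"
  by (induction I rule: infinite_finite_induct) (auto simp: ipoly_simps)

text \<open>An integer polynomial P of least degree vanishing at \<open>z\<close>, made primitive,
  divides all others: pseudo-division leaves no remainder, and Gauss's lemma on contents removes the
  multiplier. As \<open>cyclo p\<close> has no proper factor, P is equal to it up to sign.\<close>

lemma cyclo_dvd:
  fixes z :: "'k::field_char_0" and A :: "int poly"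
  assumes p: "Factorial_Ring.prime (p::nat)" and z: "primitive_root_of_unity (p\<^sup>2) z"
    and A: "poly (ipoly A) z = 0"
  shows "cyclo p dvd A"
proof -
  have p1: "p > 1" using p by (rule prime_gt_1_nat)
  then have p0: "p > 0" by simp
  have cz: "poly (ipoly (cyclo p)) z = 0"
  proof -
    have "poly (ipoly (cyclo p)) z = (\<Sum>i<p. (z ^ p) ^ i)"
      by (simp add: cyclo_def ipoly_sum ipoly_simps poly_sum poly_monom power_mult)
    moreover have "z ^ p \<noteq> 1"
      using primitive_root_pow_eq_1_iff[OF z, of p] p1 by (auto simp: power2_eq_square dest!: dvd_imp_le)
    moreover have "(z ^ p) ^ p = 1" using z by (simp add: primitive_root_of_unity_def power2_eq_square flip: power_mult)
    ultimately show ?thesis using power_diff_1_eq[of "z ^ p" p] by simp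
  qed
  define S where "S = {B. B \<noteq> 0 \<and> poly (ipoly B) z = 0}"
  have "cyclo p \<in> S" using cz degree_cyclo[OF p0] by (simp add: S_def)
  then obtain B where B: "B \<in> S" and min: "\<And>C. C \<in> S \<Longrightarrow> Polynomial.degree B \<le> Polynomial.degree C"
    using ex_has_least_nat[of "\<lambda>f. f \<in> S" _ Polynomial.degree] by blast
  define P where "P = primitive_part B"
  have B0: "B \<noteq> 0" "poly (ipoly B) z = 0" using B by (auto simp: S_def)
  have BP: "B = Polynomial.smult (content B) P" by (simp add: P_def)
  have P: "P \<noteq> 0" "content P = 1" "Polynomial.degree P = Polynomial.degree B"
    using B0 by (auto simp: P_def)
  have Pz: "poly (ipoly P) z = 0"
  proof -
    have "of_int (content B) * poly (ipoly P) z = poly (ipoly (Polynomial.smult (content B) P)) z"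
      by (simp add: ipoly_simps)
    also have "\<dots> = 0" using B0 BP by simp
    finally show ?thesis using B0 by simp
  qed
  have dvd: "P dvd C" if C: "poly (ipoly C) z = 0" for C
  proof -
    obtain a q where a: "a \<noteq> 0" "Polynomial.smult a C = P * q + pseudo_mod C P"
      "pseudo_mod C P = 0 \<or> Polynomial.degree (pseudo_mod C P) < Polynomial.degree P"
      using pseudo_mod[OF P(1), of C] by blast
    have "poly (ipoly (pseudo_mod C P)) z = poly (ipoly (Polynomial.smult a C - P * q)) z" using a(2) by simp
    also have "\<dots> = 0" using C Pz by (simp add: ipoly_simps)
    finally have "pseudo_mod C P = 0" using a(3) min[of "pseudo_mod C P"] P(3) by (force simp: S_def)
    then have e: "Polynomial.smult a C = P * q" using a(2) by simp
    then have "content (Polynomial.smult a C) = content P * content q" by (simp add: content_mult)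
    then have "a dvd content q" using P(2) by (metis content_smult dvd_triv_left mult_1 normalize_dvd_iff)
    then have "[:a:] dvd q" by (simp add: const_poly_dvd_iff_dvd_content)
    then obtain q' where "q = Polynomial.smult a q'" by (auto elim!: dvdE)
    then have "Polynomial.smult a C = Polynomial.smult a (P * q')" using e by simp
    then have "C = P * q'" using a(1) by (simp add: smult_cancel)
    then show ?thesis by simp
  qed
  obtain Q where Q: "cyclo p = P * Q" using dvd[OF cz] by (elim dvdE)
  have "Polynomial.degree P \<noteq> 0"
  proof
    assume "Polynomial.degree P = 0"
    then obtain c where "P = [:c:]" by (meson degree_eq_zeroE)
    then show False using Pz P(1) by (simp add: ipoly_simps)
  qed
  then have "Polynomial.degree Q = 0" using cyclo_factor[OF p Q] by simp
  then obtain c where c: "Q = [:c:]" by (meson degree_eq_zeroE)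
  have "lead_coeff P * lead_coeff Q = 1" using degree_cyclo(2)[OF p0] by (simp add: Q lead_coeff_mult)
  then have "c dvd 1" using c by (metis dvd_triv_right lead_coeff_pCons(2))
  then have "cyclo p dvd P" unfolding Q c by (auto simp: dvd_def intro!: exI[of _ "[:c:]"] simp: zmult_eq_1_iff)
  then show ?thesis using dvd[OF A] dvd_trans by blast
qed

lemma common_denominator:
  fixes f :: "'i \<Rightarrow> 'k::field_char_0"
  assumes "finite I" "\<And>i. i \<in> I \<Longrightarrow> f i \<in> \<rat>"
  shows "\<exists>D::int. D \<noteq> 0 \<and> (\<forall>i\<in>I. of_int D * f i \<in> \<int>)"
  using assms
proof (induction I rule: finite_induct)
  case empty
  show ?case by (intro exI[of _ 1]) simp
next
  case (insert j I)
  then obtain D where D: "D \<noteq> 0" "\<forall>i\<in>I. of_int D * f i \<in> \<int>" by auto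
  have "f j \<in> \<rat>" using insert.prems by simp
  then obtain a b :: int where ab: "b > 0" "f j = of_int a / of_int b" by (auto elim!: Rats_cases')
  have "of_int (D * b) * f i \<in> \<int>" if "i \<in> insert j I" for i
  proof (cases "i = j")
    case True
    have "of_int (D * b) * f j = of_int (D * a)" using ab by simp
    then show ?thesis using True by (metis Ints_of_int)
  next
    case False
    then have "of_int D * f i \<in> \<int>" using D(2) that by auto
    then have "of_int b * (of_int D * f i) \<in> \<int>" by (rule Ints_mult[OF Ints_of_int])
    moreover have "of_int (D * b) * f i = of_int b * (of_int D * f i)" by simp
    ultimately show ?thesis by metis
  qed
  then show ?case using D(1) ab(1) by (intro exI[of _ "D * b"]) auto
qed

lemma subfield_of_Rats: "subfield_of (\<rat> :: 'k::field_char_0 set)"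
  by unfold_locales (auto simp: is_subfield_def)

context subfield_of_alg_closed
begin

lemma cyclotomic_field_subset_adjoin:
  assumes e: "primitive_root_of_unity n e"
  shows "cyclotomic_field n \<subseteq> adjoin \<rat> (e :: 'k)"
proof -
  interpret Q: subfield_of "\<rat> :: 'k set" by (rule subfield_of_Rats)
  have n: "n > 0" "e ^ n = 1" using e by (auto simp: primitive_root_of_unity_def)
  have sub: "is_subfield (adjoin \<rat> e)" using Q.adjoin_is_subfield[OF n] .
  have "mu n \<subseteq> adjoin \<rat> e"
    using alg_closed_type sub e Q.adjoin_gen by (rule mu_subset_if_primitive)
  then have "{z. primitive_root_of_unity n z} \<subseteq> adjoin \<rat> e"
    by (auto simp: mu_def primitive_root_of_unity_def)
  then show ?thesis using sub unfolding cyclotomic_field_def gen_subfield_def by blast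
qed

text \<open>The sum of the conjugates of \<open>z\<close> over \<open>K\<close> lies in the \<open>p\<close>-th cyclotomic field. If the conjugates had
  distinct \<open>p\<close>-th powers, this would be a rational relation between powers of \<open>z\<close> whose coefficients
  are not constant along the residue class of \<open>1\<close> modulo \<open>p\<close>.\<close>

lemma primitive_p_square_root_not_in_adjoin:
  fixes z :: 'k
  assumes p: "Factorial_Ring.prime (p::nat)" and z: "primitive_root_of_unity (p\<^sup>2) z"
    and K: "K \<inter> cyclotomic_field (p\<^sup>2) \<subseteq> cyclotomic_field p"
  shows "z \<notin> adjoin K (z ^ p)"
proof
  assume gen: "z \<in> adjoin K (z ^ p)"
  have p1: "p > 1" using p by (rule prime_gt_1_nat)
  have n: "p\<^sup>2 > 0" "z ^ (p\<^sup>2) = 1" using z by (auto simp: primitive_root_of_unity_def)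
  obtain R where R: "finite R" "z \<in> R" "R \<subseteq> mu (p\<^sup>2)" "\<Prod>R \<in> K" "\<Sum>R \<in> K" and inj: "inj_on (\<lambda>r. r ^ p) R"
    and roots: "\<forall>f r. poly_over K f \<longrightarrow> poly f z = 0 \<longrightarrow> r \<in> R \<longrightarrow> poly f r = 0"
    by (rule conjugates_of_generating_power[OF n gen])
  define \<Gamma> where "\<Gamma> = {c\<in>{..<p\<^sup>2}. z ^ c \<in> R}"
  have zinj: "inj_on (\<lambda>i. z ^ i) {..<p\<^sup>2}" by (rule primitive_root_pow_inj_on[OF z])
  have "(\<lambda>c. z ^ c) ` \<Gamma> = R"
    using R(3) roots_of_unity_eq_powers[OF z] by (auto simp: \<Gamma>_def mu_def)
  moreover have "inj_on (\<lambda>c. z ^ c) \<Gamma>" using zinj by (rule inj_on_subset) (auto simp: \<Gamma>_def)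
  ultimately have sumR: "\<Sum>R = (\<Sum>c\<in>\<Gamma>. z ^ c)" using sum.reindex[of "\<lambda>c. z ^ c" \<Gamma> "\<lambda>x. x"] by simp
  have "\<Sum>R \<in> L" if L: "is_subfield L" "{z. primitive_root_of_unity (p\<^sup>2) z} \<subseteq> L" for L
  proof -
    interpret L: subfield_of L by unfold_locales (rule L)
    show ?thesis unfolding sumR using z L(2) by (intro L.sum_in L.power_in) auto
  qed
  then have "\<Sum>R \<in> cyclotomic_field (p\<^sup>2)" by (auto simp: cyclotomic_field_def gen_subfield_def)
  then have "\<Sum>R \<in> cyclotomic_field p" using K R(5) by blast
  moreover have e: "primitive_root_of_unity p (z ^ p)"
    using primitive_root_power[of p p z] z by (simp add: power2_eq_square)
  ultimately obtain q where q: "poly_over \<rat> q" "\<Sum>R = poly q (z ^ p)"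
    using cyclotomic_field_subset_adjoin[OF e] unfolding adjoin_def by blast
  interpret Q: subfield_of "\<rat> :: 'k set" by (rule subfield_of_Rats)
  \<comment> \<open>Reduction modulo X^p - 1 leaves powers z^(p i) with i < p, all of exponent below
    p^2.\<close>
  define u where "u = Polynomial.monom (1::'k) p - 1"
  have u: "poly_over \<rat> u" "lead_coeff u = 1" "Polynomial.degree u = p" "poly u (z ^ p) = 0"
  proof -
    show "poly_over \<rat> u" unfolding u_def by (intro Q.poly_over_diff Q.poly_over_monom Q.poly_over_1) simp
    show d: "Polynomial.degree u = p" using degree_monom_minus_const[of p "1::'k"] p1 by (simp add: u_def one_pCons)
    show "lead_coeff u = 1" unfolding d using p1 by (simp add: u_def)
    show "poly u (z ^ p) = 0" using e by (simp add: u_def poly_monom primitive_root_of_unity_def)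
  qed
  obtain s r where sr: "poly_over \<rat> s" "poly_over \<rat> r" "q = s * u + r" "r = 0 \<or> Polynomial.degree r < Polynomial.degree u"
    using Q.poly_over_division[OF u(1,2) q(1)] by blast
  have rsum: "poly r x = (\<Sum>i<p. Polynomial.coeff r i * x ^ i)" for x
  proof -
    have "Polynomial.degree r < p" using sr(4) u(3) p1 by auto
    then have "(\<Sum>i\<le>Polynomial.degree r. Polynomial.coeff r i * x ^ i) = (\<Sum>i<p. Polynomial.coeff r i * x ^ i)"
      by (intro sum.mono_neutral_left) (auto simp: coeff_eq_0)
    then show ?thesis by (simp add: poly_altdef)
  qed
  have Rr: "\<Sum>R = poly r (z ^ p)" using q(2) sr(3) u(4) by simp
  obtain D :: int where D: "D \<noteq> 0" "\<forall>i\<in>{..<p}. of_int D * Polynomial.coeff r i \<in> \<int>"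
    using common_denominator[of "{..<p}" "Polynomial.coeff r"] sr(2) by (auto simp: poly_over_def)
  then have "\<forall>i\<in>{..<p}. \<exists>b::int. of_int D * Polynomial.coeff r i = of_int b" by (auto elim!: Ints_cases)
  then obtain b :: "nat \<Rightarrow> int" where b: "\<And>i. i < p \<Longrightarrow> of_int D * Polynomial.coeff r i = of_int (b i)"
    by (metis lessThan_iff)
  \<comment> \<open>The relation with cleared denominators: D times the sum of the conjugates, minus
    its expression in powers of z^p. Coefficients of A at exponents not divisible by p come from the
    conjugates alone.\<close>
  define A where "A = (\<Sum>c\<in>\<Gamma>. Polynomial.monom D c) - (\<Sum>i<p. Polynomial.monom (b i) (p * i))"
  have fin: "finite \<Gamma>" by (simp add: \<Gamma>_def)
  have "poly (ipoly A) z = of_int D * (\<Sum>c\<in>\<Gamma>. z ^ c) - (\<Sum>i<p. of_int (b i) * (z ^ p) ^ i)"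
    by (simp add: A_def ipoly_simps ipoly_sum poly_sum poly_monom sum_distrib_left power_mult)
  also have "(\<Sum>i<p. of_int (b i) * (z ^ p) ^ i) = of_int D * poly r (z ^ p)"
    unfolding rsum sum_distrib_left by (intro sum.cong) (auto simp flip: b)
  finally have "poly (ipoly A) z = 0" using Rr sumR by simp
  then obtain k where k: "A = cyclo p * k" using cyclo_dvd[OF p z] by (auto elim: dvdE)
  have coeffA: "Polynomial.coeff A i = (if i \<in> \<Gamma> then D else 0) - (\<Sum>l<p. if p * l = i then b l else 0)" for i
    using fin by (simp add: A_def coeff_sum)
  have zeroA: "Polynomial.coeff A i = 0" if "i \<ge> p\<^sup>2" for i
  proof -
    have "p * l < p * p" if "l < p" for l using that p1 by simp
    then have "(\<Sum>l<p. if p * l = i then b l else 0) = 0"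
      using that by (intro sum.neutral) (fastforce simp: power2_eq_square)
    moreover have "i \<notin> \<Gamma>" using that by (auto simp: \<Gamma>_def)
    ultimately show ?thesis by (simp add: coeffA)
  qed
  have p0: "p > 0" using p1 by simp
  \<comment> \<open>A has degree below p^2 and \<open>cyclo p\<close> has degree p^2 - p, so the
    cofactor \<open>k\<close> has degree below p. Multiplication by \<open>cyclo p\<close> then
    repeats its coefficients with period p.\<close>
  have kzero: "Polynomial.coeff k i = 0" if "i \<ge> p" for i
  proof (rule ccontr)
    assume ki: "Polynomial.coeff k i \<noteq> 0"
    then have k0: "k \<noteq> 0" by auto
    have "p \<le> Polynomial.degree k" using le_degree[OF ki] that by simp
    moreover have "Polynomial.degree A = p * (p - 1) + Polynomial.degree k"
      using k0 degree_cyclo[OF p0] by (simp add: k degree_mult_eq)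
    ultimately have "Polynomial.degree A \<ge> p * (p - 1) + p" by simp
    moreover have "p * (p - 1) + p = p\<^sup>2" using p0 by (cases p) (auto simp: power2_eq_square)
    ultimately have "lead_coeff A = 0" using zeroA by simp
    then show False using k k0 degree_cyclo(3)[OF p0] by simp
  qed
  \<comment> \<open>Two exponents of residue 1 suffice: 1 belongs to the conjugate \<open>z\<close>
    itself, while z^(1 + p) has the same p-th power as \<open>z\<close> and therefore is no
    conjugate.\<close>
  have "Polynomial.coeff A (1 + p * i) = Polynomial.coeff k 1" if i: "i < 2" for i
  proof -
    have "cyclo p * k = (\<Sum>l<p. Polynomial.monom 1 (p * l) * k)" by (simp add: cyclo_def sum_distrib_right)
    then have "Polynomial.coeff A (1 + p * i) = (\<Sum>l<p. if p * l \<le> 1 + p * i then Polynomial.coeff k (1 + p * i - p * l) else 0)"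
      by (simp add: k coeff_sum coeff_monom_mult) (intro sum.cong, auto)
    also have "\<dots> = (\<Sum>l<p. if l = i then Polynomial.coeff k 1 else 0)"
    proof (intro sum.cong refl)
      fix l assume "l \<in> {..<p}"
      consider "l = i" | "l < i" | "l > i" by linarith
      then show "(if p * l \<le> 1 + p * i then Polynomial.coeff k (1 + p * i - p * l) else 0) = (if l = i then Polynomial.coeff k 1 else 0)"
      proof cases
        case 2
        then have "l = 0" "i = 1" using i by auto
        then show ?thesis using kzero[of "1 + p"] by simp
      next
        case 3
        then have "p * (i + 1) \<le> p * l" by (intro mult_le_mono2) simp
        then have "\<not> p * l \<le> 1 + p * i" using p1 by (simp add: distrib_left)
        then show ?thesis using 3 by simp
      qed simp
    qed
    also have "\<dots> = Polynomial.coeff k 1" using i p1 by simp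
    finally show ?thesis .
  qed
  from this[of 0] this[of 1] have eq: "Polynomial.coeff A 1 = Polynomial.coeff A (1 + p)" by simp
  have ndvd: "\<not> p dvd 1 + p * i" for i
  proof
    assume "p dvd 1 + p * i"
    then have "p dvd (1 + p * i) - p * i" by (rule dvd_diff_nat) simp
    then show False using p1 by simp
  qed
  have coeff1: "Polynomial.coeff A (1 + p * i) = (if 1 + p * i \<in> \<Gamma> then D else 0)" for i
  proof -
    have "(\<Sum>l<p. if p * l = 1 + p * i then b l else 0) = 0"
      using ndvd[of i] by (intro sum.neutral) (metis dvd_triv_left)
    then show ?thesis by (simp add: coeffA)
  qed
  have "1 + p < p\<^sup>2"
  proof -
    show ?thesis
    proof (cases "p = 2")
      case False
      then have "p \<ge> 3" using p1 by simp
      then have "p * 3 \<le> p * p" by (rule mult_le_mono2)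
      then show ?thesis unfolding power2_eq_square using p1 by linarith
    qed simp
  qed
  then have less: "1 < p\<^sup>2" "1 + p < p\<^sup>2" by auto
  have 1: "1 \<in> \<Gamma>" using R(2) less by (simp add: \<Gamma>_def)
  have 2: "1 + p \<notin> \<Gamma>"
  proof
    assume "1 + p \<in> \<Gamma>"
    then have "z ^ (1 + p) \<in> R" by (simp add: \<Gamma>_def)
    moreover have "(z ^ (1 + p)) ^ p = z ^ p"
      using n(2) by (simp add: power_add power_mult_distrib power2_eq_square flip: power_mult)
    ultimately have "z ^ (1 + p) = z ^ 1" using inj_onD[OF inj, of "z ^ (1 + p)" z] R(2) by simp
    then have "1 + p = 1" using inj_onD[OF zinj, of "1 + p" 1] less by simp
    then show False using p0 by simp
  qed
  show False using eq coeff1[of 0] coeff1[of 1] 1 2 D(1) by simp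
qed

end

section \<open>Cyclotomic towers\<close>

text \<open>The p-power roots of unity in \<open>L\<close> are exactly the p^j-th ones. All later
  arguments ask only whether such an overfield exists for a given j, so the tower itself is never
  named.\<close>

definition at_level :: "'k::field set \<Rightarrow> nat \<Rightarrow> nat \<Rightarrow> 'k set \<Rightarrow> bool" where
  "at_level F p j L \<longleftrightarrow> is_subfield L \<and> F \<subseteq> L \<and> mu (p ^ j) \<subseteq> L \<and> \<not> mu (p ^ Suc j) \<subseteq> L"

context alg_closed_char_0
begin

lemma mu_subset_iff:
  fixes z :: 'k
  assumes "is_subfield K" "primitive_root_of_unity n z"
  shows "mu n \<subseteq> K \<longleftrightarrow> z \<in> K"
  using mu_subset_if_primitive[OF alg_closed_type assms] assms(2)
  by (auto simp: mu_def primitive_root_of_unity_def)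

lemma subfield_of_alg_closedI: "is_subfield K \<Longrightarrow> subfield_of_alg_closed (K :: 'k set)"
  by (intro subfield_of_alg_closed.intro subfield_of.intro alg_closed_type)

lemma at_level_adjoin:
  fixes w :: 'k
  assumes K: "is_subfield K" "F \<subseteq> K" and p: "Factorial_Ring.prime p"
    and w: "primitive_root_of_unity (p ^ Suc j) w" and not: "w \<notin> adjoin K (w ^ p)"
  shows "at_level F p j (adjoin K (w ^ p))"
proof -
  interpret K: subfield_of_alg_closed K by (rule subfield_of_alg_closedI[OF K(1)])
  have wp: "primitive_root_of_unity (p ^ j) (w ^ p)" using primitive_root_power[of p "p ^ j" w] w by simp
  then have sub: "is_subfield (adjoin K (w ^ p))"
    using K.adjoin_is_subfield[of "p ^ j" "w ^ p"] by (simp add: primitive_root_of_unity_def)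
  show ?thesis
    unfolding at_level_def mu_subset_iff[OF sub w] mu_subset_iff[OF sub wp]
    using sub K(2) K.adjoin_superset K.adjoin_gen not by blast
qed

text \<open>For \<open>w\<close> of order p^(j+2), the step from K to K(w^p) adjoins an element with
  p-th power in K, and \<open>root_not_in_adjoin\<close> shows that it does not produce
  \<open>w\<close> as well. The lower bounds on j put the p-th roots of unity, and for p = 2 the
  fourth ones, into K.\<close>

lemma at_level_Suc:
  fixes F K :: "'k set"
  assumes p: "Factorial_Ring.prime p" and j: "j > 0" "p = 2 \<Longrightarrow> j \<ge> 2" and K: "at_level F p j K"
  shows "\<exists>L. at_level F p (Suc j) L"
proof -
  have Ks: "is_subfield K" "F \<subseteq> K" "mu (p ^ j) \<subseteq> K" "\<not> mu (p ^ Suc j) \<subseteq> K"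
    using K by (auto simp: at_level_def)
  interpret K: subfield_of_alg_closed K by (rule subfield_of_alg_closedI[OF Ks(1)])
  have p0: "p > 0" using p by (rule prime_gt_0_nat)
  obtain w :: 'k where w: "primitive_root_of_unity (p ^ Suc (Suc j)) w"
    using primitive_root_exists[of "p ^ Suc (Suc j)"] p0 by auto
  have w1: "primitive_root_of_unity (p ^ Suc j) (w ^ p)" using primitive_root_power[of p "p ^ Suc j" w] w by simp
  have w2: "primitive_root_of_unity (p ^ j) (w ^ (p\<^sup>2))"
    using primitive_root_power[of "p\<^sup>2" "p ^ j" w] w by (simp add: power2_eq_square mult.assoc)
  have "w \<notin> adjoin K (w ^ p)"
  proof (rule K.root_not_in_adjoin[OF p])
    show "mu p \<subseteq> K" using Ks(3) mu_dvd[of p "p ^ j"] j(1) by (auto simp: dvd_power)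
    show "mu 4 \<subseteq> K" if "p = 2"
    proof -
      have "(4::nat) dvd 2 ^ j" using le_imp_power_dvd[of 2 j "2::nat"] j(2)[OF that] by simp
      then show ?thesis using Ks(3) mu_dvd[of 4 "p ^ j"] that by blast
    qed
    show "p ^ Suc (Suc j) > 0" "w ^ p ^ Suc (Suc j) = 1" using w by (auto simp: primitive_root_of_unity_def)
    show "w ^ (p\<^sup>2) \<in> K" using Ks(3) mu_subset_iff[OF Ks(1) w2] by blast
    show "w ^ p \<notin> K" using Ks(4) mu_subset_iff[OF Ks(1) w1] by blast
  qed
  then show ?thesis using at_level_adjoin[OF Ks(1,2) p w] by blast
qed

lemma at_level_add:
  fixes F K :: "'k set"
  assumes p: "Factorial_Ring.prime p" and j: "j > 0" "p = 2 \<Longrightarrow> j \<ge> 2" and K: "at_level F p j K"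
  shows "\<exists>L. at_level F p (j + i) L"
proof (induction i)
  case 0 show ?case using K by auto
next
  case (Suc i)
  then obtain L where L: "at_level F p (j + i) L" by blast
  have ji: "j + i > 0" "p = 2 \<Longrightarrow> j + i \<ge> 2" using j by (auto intro: trans_le_add1)
  show ?case using at_level_Suc[OF p ji L] by simp
qed

text \<open>Once the p-th roots of unity are present, or the fourth ones if p = 2, the tower climbs
  by itself. The conditions on F enter at the step leading there: from level 0 to 1 for odd p, and
  from level 1 to 2 for p = 2.\<close>

lemma at_level_exists:
  fixes F :: "'k set"
  assumes F: "is_subfield F" and p: "Factorial_Ring.prime p"
    and odd: "odd p \<Longrightarrow> (\<exists>z\<in>F. primitive_root_of_unity p z) \<or> F \<inter> cyclotomic_field (p\<^sup>2) \<subseteq> cyclotomic_field p"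
    and two: "p = 2 \<Longrightarrow> (\<exists>z\<in>F. primitive_root_of_unity 4 z) \<or> F \<inter> cyclotomic_field 8 \<subseteq> \<rat>"
    and m: "at_level F p m F" and j: "j \<ge> m"
  shows "\<exists>L. at_level F p j L"
proof -
  interpret F: subfield_of_alg_closed F by (rule subfield_of_alg_closedI[OF F])
  have mF: "mu (p ^ m) \<subseteq> F" "\<not> mu (p ^ Suc m) \<subseteq> F" using m by (auto simp: at_level_def)
  have p0: "p > 0" using p by (rule prime_gt_0_nat)
  consider "j = m" | "j > m" "m > 0 \<and> (p = 2 \<longrightarrow> m \<ge> 2)" | "j > m" "m = 0" | "j > m" "p = 2" "m = 1" using j by linarith
  then show ?thesis
  proof cases
    case 1
    then show ?thesis using m by blast
  next
    case 2
    then show ?thesis using at_level_add[OF p _ _ m, of "j - m"] by auto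
  next
    case 3
    \<comment> \<open>Since -1 lies in F, the prime 2 never starts at level 0.\<close>
    have "mu 2 \<subseteq> F"
    proof
      fix x :: 'k assume "x \<in> mu 2"
      then have "x = 1 \<or> x = -1" by (simp add: mu_def power2_eq_1_iff)
      then show "x \<in> F" using F.one_in F.uminus_in by auto
    qed
    then have "p \<noteq> 2" using mF(2) 3 by auto
    then have "odd p" using p primes_dvd_imp_eq two_is_prime_nat by blast
    moreover have "\<not> (\<exists>z\<in>F. primitive_root_of_unity p z)"
      using mF(2) 3 mu_subset_iff[OF F, of p] by auto
    ultimately have cyc: "F \<inter> cyclotomic_field (p\<^sup>2) \<subseteq> cyclotomic_field p" using odd by blast
    obtain w :: 'k where w: "primitive_root_of_unity (p\<^sup>2) w" using primitive_root_exists[of "p\<^sup>2"] p0 by auto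
    have "w \<notin> adjoin F (w ^ p)" by (rule F.primitive_p_square_root_not_in_adjoin[OF p w cyc])
    then have "at_level F p 1 (adjoin F (w ^ p))"
      using w by (intro at_level_adjoin[OF F subset_refl p]) (simp_all add: power2_eq_square)
    then show ?thesis using at_level_add[OF p, of 1 F _ "j - 1"] 3 \<open>p \<noteq> 2\<close> by auto
  next
    case 4
    have "\<not> (\<exists>z\<in>F. primitive_root_of_unity 4 z)"
      using mF(2) 4 mu_subset_iff[OF F, of 4] by auto
    then have rat: "F \<inter> cyclotomic_field 8 \<subseteq> \<rat>" using two 4 by blast
    obtain w :: 'k where w: "primitive_root_of_unity 8 w" using primitive_root_exists[of 8] by auto
    have w2: "primitive_root_of_unity 4 (w\<^sup>2)" using primitive_root_power[of 2 4 w] w by simp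
    have "w\<^sup>2 \<notin> F" using mF(2) 4 mu_subset_iff[OF F w2] by simp
    then have "w \<notin> adjoin F (w\<^sup>2)" using F.eighth_root_not_in_adjoin[OF w _ rat] by blast
    then have "at_level F 2 2 (adjoin F (w\<^sup>2))"
      using w p 4 by (intro at_level_adjoin[OF F subset_refl]) (simp_all add: power2_eq_square)
    then have "\<exists>L. at_level F p (2 + (j - 2)) L" using at_level_add[OF p, of 2 F _ "j - 2"] 4 by simp
    moreover have "2 + (j - 2) = j" using 4 by simp
    ultimately show ?thesis by metis
  qed
qed

end

section \<open>Characters of group rings\<close>

abbreviation group_ring :: "('g, 'x) monoid_scheme \<Rightarrow> 'k::field set \<Rightarrow> ('g \<Rightarrow> 'k) ring" where
  "group_ring G F \<equiv> twisted_group_ring G F (\<lambda>_ _. 1)"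

definition ev :: "('g, 'x) monoid_scheme \<Rightarrow> ('g \<Rightarrow> 'k::field) \<Rightarrow> ('g \<Rightarrow> 'k) \<Rightarrow> 'k" where
  "ev G \<chi> x = (\<Sum>g\<in>carrier G. x g * \<chi> g)"

definition unit_vec :: "'g \<Rightarrow> 'g \<Rightarrow> 'k::field" where
  "unit_vec g = (\<lambda>k. if k = g then 1 else 0)"

text \<open>Stated with closure alone, so that it applies to group rings without verifying the ring
  axioms for them.\<close>

lemma ring_iso_inv:
  assumes h: "h \<in> ring_iso R S"
    and closed: "\<And>x y. x \<in> carrier R \<Longrightarrow> y \<in> carrier R \<Longrightarrow> x \<otimes>\<^bsub>R\<^esub> y \<in> carrier R"
      "\<And>x y. x \<in> carrier R \<Longrightarrow> y \<in> carrier R \<Longrightarrow> x \<oplus>\<^bsub>R\<^esub> y \<in> carrier R" "\<one>\<^bsub>R\<^esub> \<in> carrier R"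
  shows "inv_into (carrier R) h \<in> ring_iso S R"
proof -
  have bij: "bij_betw h (carrier R) (carrier S)" and hom: "h \<in> ring_hom R S"
    using h by (auto simp: ring_iso_def)
  let ?i = "inv_into (carrier R) h"
  have bi: "bij_betw ?i (carrier S) (carrier R)" by (rule bij_betw_inv_into[OF bij])
  have im: "?i y \<in> carrier R" "h (?i y) = y" if "y \<in> carrier S" for y
    using bij_betwE[OF bi] that bij_betw_inv_into_right[OF bij that] by auto
  have inv: "?i (h x) = x" if "x \<in> carrier R" for x using bij_betw_inv_into_left[OF bij that] .
  have "?i \<in> ring_hom S R"
  proof (rule ring_hom_memI)
    show "?i x \<in> carrier R" if "x \<in> carrier S" for x using im(1)[OF that] .
    show "?i (x \<otimes>\<^bsub>S\<^esub> y) = ?i x \<otimes>\<^bsub>R\<^esub> ?i y" if "x \<in> carrier S" "y \<in> carrier S" for x y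
      using inv[OF closed(1)[OF im(1)[OF that(1)] im(1)[OF that(2)]]] im that ring_hom_mult[OF hom] by simp
    show "?i (x \<oplus>\<^bsub>S\<^esub> y) = ?i x \<oplus>\<^bsub>R\<^esub> ?i y" if "x \<in> carrier S" "y \<in> carrier S" for x y
      using inv[OF closed(2)[OF im(1)[OF that(1)] im(1)[OF that(2)]]] im that ring_hom_add[OF hom] by simp
    show "?i \<one>\<^bsub>S\<^esub> = \<one>\<^bsub>R\<^esub>" using inv[OF closed(3)] ring_hom_one[OF hom] by simp
  qed
  then show ?thesis using bi by (simp add: ring_iso_def)
qed

text \<open>\<open>N\<close> is any positive multiple of the exponent, so that two groups can share
  it and it can be enlarged to admit more roots of unity.\<close>

locale group_algebra = comm_group G + subfield_of_alg_closed F
  for G :: "('g, 'x) monoid_scheme" (structure) and F :: "'k::field_char_0 set" +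
  fixes N :: nat
  assumes finite_G: "finite (carrier G)" and N_pos: "N > 0"
    and pow_N: "\<And>x. x \<in> carrier G \<Longrightarrow> x [^] N = \<one>"
begin

lemma gr_memI: "(\<And>g. g \<in> carrier G \<Longrightarrow> x g \<in> F) \<Longrightarrow> (\<And>g. g \<notin> carrier G \<Longrightarrow> x g = 0) \<Longrightarrow> x \<in> carrier (group_ring G F)"
  and gr_coeff: "x \<in> carrier (group_ring G F) \<Longrightarrow> x g \<in> F"
  and gr_outside: "x \<in> carrier (group_ring G F) \<Longrightarrow> g \<notin> carrier G \<Longrightarrow> x g = 0"
  using zero_in by (auto simp: twisted_group_ring_def)

lemma gr_add: "x \<oplus>\<^bsub>group_ring G F\<^esub> y = (\<lambda>g. x g + y g)"
  and gr_one: "\<one>\<^bsub>group_ring G F\<^esub> = unit_vec \<one>"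
  and gr_mult: "x \<otimes>\<^bsub>group_ring G F\<^esub> y = (\<lambda>k. if k \<in> carrier G then
    (\<Sum>g\<in>carrier G. \<Sum>h\<in>{h\<in>carrier G. g \<otimes> h = k}. x g * y h) else 0)"
  by (auto simp: twisted_group_ring_def unit_vec_def)

lemma gr_add_closed: "x \<in> carrier (group_ring G F) \<Longrightarrow> y \<in> carrier (group_ring G F) \<Longrightarrow>
    x \<oplus>\<^bsub>group_ring G F\<^esub> y \<in> carrier (group_ring G F)"
  by (rule gr_memI) (auto simp: gr_add gr_coeff add_in gr_outside)

lemma gr_mult_closed: "x \<in> carrier (group_ring G F) \<Longrightarrow> y \<in> carrier (group_ring G F) \<Longrightarrow>
    x \<otimes>\<^bsub>group_ring G F\<^esub> y \<in> carrier (group_ring G F)"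
  by (rule gr_memI) (auto simp: gr_mult gr_coeff intro!: sum_in mult_in)

lemma unit_vec_closed: "g \<in> carrier G \<Longrightarrow> unit_vec g \<in> carrier (group_ring G F)"
  by (rule gr_memI) (auto simp: unit_vec_def one_in zero_in)

lemma gr_one_closed: "\<one>\<^bsub>group_ring G F\<^esub> \<in> carrier (group_ring G F)"
  unfolding gr_one by (rule unit_vec_closed) simp

lemma smult_closed: "c \<in> F \<Longrightarrow> x \<in> carrier (group_ring G F) \<Longrightarrow> (\<lambda>g. c * x g) \<in> carrier (group_ring G F)"
  by (rule gr_memI) (auto simp: mult_in gr_coeff gr_outside)

lemma lincomb_closed: "(\<And>i. i \<in> I \<Longrightarrow> c i \<in> F) \<Longrightarrow> (\<And>i. i \<in> I \<Longrightarrow> x i \<in> carrier (group_ring G F)) \<Longrightarrow>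
    (\<lambda>g. \<Sum>i\<in>I. c i * x i g) \<in> carrier (group_ring G F)"
  by (rule gr_memI) (auto intro!: sum_in mult_in sum.neutral simp: gr_coeff gr_outside)

lemma ev_add: "ev G \<chi> (x \<oplus>\<^bsub>group_ring G F\<^esub> y) = ev G \<chi> x + ev G \<chi> y"
  by (simp add: ev_def gr_add distrib_right sum.distrib)

lemma ev_smult: "ev G \<chi> (\<lambda>g. c * x g) = c * ev G \<chi> x"
  by (simp add: ev_def sum_distrib_left mult.assoc)

lemma ev_diff: "ev G \<chi> (\<lambda>g. x g - y g) = ev G \<chi> x - ev G \<chi> y"
  by (simp add: ev_def left_diff_distrib sum_subtractf)

lemma ev_lincomb: "ev G \<chi> (\<lambda>g. \<Sum>i\<in>I. c i * x i g) = (\<Sum>i\<in>I. c i * ev G \<chi> (x i))"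
proof -
  have "ev G \<chi> (\<lambda>g. \<Sum>i\<in>I. c i * x i g) = (\<Sum>g\<in>carrier G. \<Sum>i\<in>I. c i * (x i g * \<chi> g))"
    by (simp add: ev_def sum_distrib_right mult.assoc)
  also have "\<dots> = (\<Sum>i\<in>I. \<Sum>g\<in>carrier G. c i * (x i g * \<chi> g))" by (rule sum.swap)
  finally show ?thesis by (simp add: ev_def sum_distrib_left)
qed

lemma ev_unit_vec: "g \<in> carrier G \<Longrightarrow> ev G \<chi> (unit_vec g) = \<chi> g"
proof -
  assume g: "g \<in> carrier G"
  have "ev G \<chi> (unit_vec g) = (\<Sum>k\<in>carrier G. if k = g then \<chi> k else 0)"
    unfolding ev_def unit_vec_def by (intro sum.cong) auto
  then show ?thesis using g finite_G by simp
qed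

lemma ev_mult:
  assumes "\<And>g h. g \<in> carrier G \<Longrightarrow> h \<in> carrier G \<Longrightarrow> \<chi> (g \<otimes> h) = \<chi> g * \<chi> h"
  shows "ev G \<chi> (x \<otimes>\<^bsub>group_ring G F\<^esub> y) = ev G \<chi> x * ev G \<chi> y"
proof -
  have "ev G \<chi> (x \<otimes>\<^bsub>group_ring G F\<^esub> y) =
      (\<Sum>k\<in>carrier G. \<Sum>g\<in>carrier G. \<Sum>h\<in>{h\<in>carrier G. g \<otimes> h = k}. x g * y h * \<chi> k)"
    unfolding ev_def gr_mult by (intro sum.cong) (simp_all add: sum_distrib_right)
  also have "\<dots> = (\<Sum>k\<in>carrier G. \<Sum>g\<in>carrier G. \<Sum>h\<in>{h\<in>carrier G. g \<otimes> h = k}. (x g * \<chi> g) * (y h * \<chi> h))"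
    by (intro sum.cong) (auto simp: assms)
  also have "\<dots> = (\<Sum>g\<in>carrier G. \<Sum>k\<in>carrier G. \<Sum>h\<in>{h\<in>carrier G. g \<otimes> h = k}. (x g * \<chi> g) * (y h * \<chi> h))"
    by (rule sum.swap)
  also have "\<dots> = (\<Sum>g\<in>carrier G. \<Sum>h\<in>carrier G. (x g * \<chi> g) * (y h * \<chi> h))"
    by (intro sum.cong refl sum.group) (use finite_G in auto)
  finally show ?thesis by (simp add: ev_def sum_product)
qed

lemma unit_vec_mult:
  assumes g: "g \<in> carrier G" "h \<in> carrier G"
  shows "unit_vec g \<otimes>\<^bsub>group_ring G F\<^esub> unit_vec h = unit_vec (g \<otimes> h)"
proof
  fix k
  have "(\<Sum>a\<in>carrier G. \<Sum>b\<in>{b\<in>carrier G. a \<otimes> b = k}. unit_vec g a * unit_vec h b) =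
      (\<Sum>a\<in>carrier G. if a = g then \<Sum>b\<in>{b\<in>carrier G. a \<otimes> b = k}. unit_vec h b else (0::'k))"
    by (intro sum.cong refl) (simp add: unit_vec_def)
  also have "\<dots> = (\<Sum>b\<in>{b\<in>carrier G. g \<otimes> b = k}. unit_vec h b)" using g finite_G by simp
  also have "\<dots> = (\<Sum>b\<in>{b\<in>carrier G. g \<otimes> b = k}. if b = h then 1 else 0)" by (simp add: unit_vec_def)
  also have "\<dots> = unit_vec (g \<otimes> h) k" using g finite_G by (auto simp: unit_vec_def)
  finally show "(unit_vec g \<otimes>\<^bsub>group_ring G F\<^esub> unit_vec h) k = unit_vec (g \<otimes> h) k"
    using g by (auto simp: gr_mult unit_vec_def)
qed

abbreviation Ch :: "('g \<Rightarrow> 'k) set" where "Ch \<equiv> chars G (mu N)"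

lemma zero_notin_mu: "0 \<notin> (mu N :: 'k set)" using mu_nonzero[OF _ N_pos] by blast

lemma finite_Ch: "finite Ch"
  by (rule finite_chars[OF finite_G finite_mu[OF N_pos]])

lemma ChI:
  fixes \<chi> :: "'g \<Rightarrow> 'k"
  assumes ext: "\<chi> \<in> extensional (carrier G)" and one: "\<chi> \<one> = 1"
    and mult: "\<And>x y. x \<in> carrier G \<Longrightarrow> y \<in> carrier G \<Longrightarrow> \<chi> (x \<otimes> y) = \<chi> x * \<chi> y"
  shows "\<chi> \<in> Ch"
proof -
  have "\<chi> x \<noteq> 0" if "x \<in> carrier G" for x using mult[of x "inv x"] one that by auto
  then have "is_char G (carrier G) \<chi>" using mult by (simp add: is_char_def)
  then have "\<chi> x ^ N = 1" if "x \<in> carrier G" for x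
    using is_char_pow[OF _ subgroup_self that, of \<chi> N] pow_N[OF that] one by simp
  then show ?thesis using ext mult by (auto simp: chars_def mu_def PiE_def)
qed

lemma Ch_separates:
  assumes t: "t \<in> carrier G" "t \<noteq> \<one>"
  shows "\<exists>\<chi>\<in>Ch. \<chi> t \<noteq> 1"
proof -
  have ot: "ord t > 1" using ord_ge_1[OF finite_G t(1)] ord_eq_1[OF t(1)] t(2) by linarith
  obtain z :: 'k where z: "primitive_root_of_unity (ord t) z" using primitive_root_exists[of "ord t"] ot by auto
  have "z ^ 1 \<noteq> 1" using primitive_root_pow_eq_1_iff[OF z, of 1] ot by simp
  then have z1: "z \<noteq> 1" "z ^ ord t = 1" using z by (auto simp: primitive_root_of_unity_def)
  obtain \<chi> where chi: "is_char G (carrier G) \<chi>" "\<chi> t = z"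
    using char_with_value[OF comm_group_axioms finite_G t(1) z1(2)] by blast
  have "restrict \<chi> (carrier G) \<in> Ch"
    using chi is_char_one[OF chi(1)] by (intro ChI) (auto simp: is_char_def)
  then show ?thesis using chi t z1 by (intro bexI[of _ "restrict \<chi> (carrier G)"]) auto
qed

lemma Ch_times: "\<chi> \<in> Ch \<Longrightarrow> \<psi> \<in> Ch \<Longrightarrow> (\<lambda>x\<in>carrier G. \<chi> x * \<psi> x) \<in> Ch"
  by (auto simp: chars_def mu_mult PiE_def Pi_def)

text \<open>Multiplication by a character that is not 1 at \<open>t\<close> permutes
  \<open>Ch\<close>, so the sum equals itself times a number different from 1.\<close>

lemma sum_Ch:
  assumes t: "t \<in> carrier G" "t \<noteq> \<one>"
  shows "(\<Sum>\<chi>\<in>Ch. \<chi> t) = 0"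
proof -
  obtain \<chi>0 where c0: "\<chi>0 \<in> Ch" "\<chi>0 t \<noteq> 1" using Ch_separates[OF t] by blast
  define m where "m \<chi> = (\<lambda>x\<in>carrier G. \<chi>0 x * \<chi> x)" for \<chi>
  have mCh: "m ` Ch \<subseteq> Ch" using Ch_times[OF c0(1)] by (auto simp: m_def)
  have inj: "inj_on m Ch"
  proof (rule inj_onI)
    fix \<chi> \<psi> assume h: "\<chi> \<in> Ch" "\<psi> \<in> Ch" "m \<chi> = m \<psi>"
    show "\<chi> = \<psi>"
    proof (rule chars_eqI[OF h(1,2)])
      fix x assume x: "x \<in> carrier G"
      have "\<chi>0 x * \<chi> x = \<chi>0 x * \<psi> x" using fun_cong[OF h(3), of x] x by (simp add: m_def)
      then show "\<chi> x = \<psi> x" using mu_nonzero[OF chars_in[OF c0(1) x] N_pos] by simp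
    qed
  qed
  have "m ` Ch = Ch" using endo_inj_surj[OF finite_Ch mCh inj] .
  then have "(\<Sum>\<chi>\<in>Ch. \<chi> t) = (\<Sum>\<chi>\<in>Ch. m \<chi> t)" using sum.reindex[OF inj, of "\<lambda>\<chi>. \<chi> t"] by simp
  also have "\<dots> = \<chi>0 t * (\<Sum>\<chi>\<in>Ch. \<chi> t)" using t by (simp add: m_def sum_distrib_left)
  finally have "(1 - \<chi>0 t) * (\<Sum>\<chi>\<in>Ch. \<chi> t) = 0" by (simp add: algebra_simps)
  then show ?thesis using c0(2) by simp
qed

text \<open>Fourier inversion: the sum of \<chi>(inv k) times the evaluation of x at \<chi> is x k
  times the number of characters, which is nonzero in characteristic 0.\<close>

lemma ev_all_zero:
  assumes x: "x \<in> carrier (group_ring G F)" and zero: "\<And>\<chi>. \<chi> \<in> Ch \<Longrightarrow> ev G \<chi> x = 0"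
  shows "x = (\<lambda>_. 0)"
proof
  fix k
  show "x k = 0"
  proof (cases "k \<in> carrier G")
    case True
    have "(\<Sum>\<chi>\<in>Ch. \<chi> (inv k) * ev G \<chi> x) = (\<Sum>\<chi>\<in>Ch. \<Sum>g\<in>carrier G. x g * \<chi> (g \<otimes> inv k))"
      using True by (intro sum.cong) (auto simp: ev_def sum_distrib_left chars_mult mult_ac)
    also have "\<dots> = (\<Sum>g\<in>carrier G. \<Sum>\<chi>\<in>Ch. x g * \<chi> (g \<otimes> inv k))" by (rule sum.swap)
    also have "\<dots> = (\<Sum>g\<in>carrier G. if g = k then x g * of_nat (card Ch) else 0)"
    proof (intro sum.cong refl)
      fix g assume g: "g \<in> carrier G"
      show "(\<Sum>\<chi>\<in>Ch. x g * \<chi> (g \<otimes> inv k)) = (if g = k then x g * of_nat (card Ch) else 0)"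
      proof (cases "g = k")
        case eq: True
        have "\<chi> \<one> = 1" if "\<chi> \<in> Ch" for \<chi> using chars_one[OF that zero_notin_mu] .
        then have "(\<Sum>\<chi>\<in>Ch. x g * \<chi> (g \<otimes> inv k)) = (\<Sum>\<chi>\<in>Ch. x g)"
          using eq True by (intro sum.cong) auto
        then show ?thesis using eq by simp
      next
        case False
        have "g \<otimes> inv k \<noteq> \<one>"
        proof
          assume "g \<otimes> inv k = \<one>"
          then have "g \<otimes> inv k \<otimes> k = k" using True by simp
          then show False using False g True by (simp add: m_assoc)
        qed
        then show ?thesis using sum_Ch[of "g \<otimes> inv k"] g True False by (simp flip: sum_distrib_left)
      qed
    qed
    also have "\<dots> = x k * of_nat (card Ch)" using True finite_G by simp
    finally have "x k * of_nat (card Ch) = 0" using zero by simp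
    moreover have "card Ch \<noteq> 0" using card_chars_pos[OF is_group finite_G N_pos] by simp
    ultimately show ?thesis by simp
  qed (simp add: gr_outside[OF x])
qed

text \<open>The values of \<chi> are the powers of a single value \<chi>(h), so the image of the
  evaluation is F(\<chi>(h)), a field. This is the maximality of the kernel.\<close>

lemma ev_inverse:
  assumes chi: "\<chi> \<in> Ch" and x: "x \<in> carrier (group_ring G F)" "ev G \<chi> x \<noteq> 0"
  shows "\<exists>y\<in>carrier (group_ring G F). ev G \<chi> y * ev G \<chi> x = 1"
proof -
  let ?R = "carrier (group_ring G F)"
  have mult: "\<chi> (g \<otimes> h) = \<chi> g * \<chi> h" if "g \<in> carrier G" "h \<in> carrier G" for g h
    using chars_mult[OF chi that] .
  have "\<exists>w>0. \<chi> ` carrier G = {z. z ^ w = 1} \<and> (\<exists>z\<in>\<chi> ` carrier G. primitive_root_of_unity w z)"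
  proof (rule finite_mult_group_eq_roots_of_unity[OF N_pos])
    show "z ^ N = 1" if "z \<in> \<chi> ` carrier G" for z using chars_in[OF chi] that by (auto simp: mu_def)
    show "1 \<in> \<chi> ` carrier G" using chars_one[OF chi zero_notin_mu] by (metis image_eqI one_closed)
    show "a * b \<in> \<chi> ` carrier G" if "a \<in> \<chi> ` carrier G" "b \<in> \<chi> ` carrier G" for a b
      using that by (auto simp: mult[symmetric])
  qed
  then obtain w h where w: "w > 0" and img: "\<chi> ` carrier G = {z. z ^ w = 1}" and h: "h \<in> carrier G"
    and prim: "primitive_root_of_unity w (\<chi> h)" by blast
  have sub: "is_subfield (adjoin F (\<chi> h))"
    using adjoin_is_subfield[OF w] prim by (simp add: primitive_root_of_unity_def)
  interpret L: subfield_of "adjoin F (\<chi> h)" by unfold_locales (rule sub)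
  have chiL: "\<chi> g \<in> adjoin F (\<chi> h)" if "g \<in> carrier G" for g
    using mu_subset_iff[OF sub prim] adjoin_gen img that by (auto simp: mu_def)
  have "ev G \<chi> x \<in> adjoin F (\<chi> h)"
    unfolding ev_def using adjoin_superset gr_coeff[OF x(1)] chiL by (intro L.sum_in L.mult_in) auto
  then have "inverse (ev G \<chi> x) \<in> adjoin F (\<chi> h)" by (rule L.inverse_in)
  moreover have "poly f (\<chi> h) \<in> ev G \<chi> ` ?R" if "poly_over F f" for f
    using that
  proof (induction f)
    case 0
    have "(\<lambda>_. 0) \<in> ?R" by (rule gr_memI) (auto simp: zero_in)
    then show ?case by (intro image_eqI[of _ _ "\<lambda>_. 0"]) (auto simp: ev_def)
  next
    case (pCons a f)
    have a: "a \<in> F" using pCons.prems by (auto simp: poly_over_def dest: spec[of _ 0])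
    have "poly_over F f" using pCons.prems by (auto simp: poly_over_def coeff_pCons dest: spec[of _ "Suc _"])
    then obtain y where y: "y \<in> ?R" "poly f (\<chi> h) = ev G \<chi> y" using pCons.IH by auto
    define v where "v = (\<lambda>g. a * unit_vec \<one> g) \<oplus>\<^bsub>group_ring G F\<^esub> (unit_vec h \<otimes>\<^bsub>group_ring G F\<^esub> y)"
    have "v \<in> ?R" unfolding v_def
      by (intro gr_add_closed gr_mult_closed smult_closed unit_vec_closed a h y one_closed)
    moreover have "ev G \<chi> v = poly (pCons a f) (\<chi> h)"
      unfolding v_def by (simp add: ev_add ev_smult ev_mult[OF mult] ev_unit_vec h chars_one[OF chi zero_notin_mu] y)
    ultimately show ?case by (metis image_eqI)
  qed
  ultimately have "inverse (ev G \<chi> x) \<in> ev G \<chi> ` ?R" by (auto simp: adjoin_def)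
  then obtain y where "y \<in> ?R" "ev G \<chi> y = inverse (ev G \<chi> x)" by auto
  then show ?thesis using x(2) by (intro bexI[of _ y]) auto
qed

text \<open>The kernel of \<open>\<rho>\<close> is prime and the characters have trivial common kernel, so it contains the kernel
  of some character, which is maximal. Note that \<open>\<rho>\<close> need not be \<open>F\<close>-linear.\<close>

lemma ring_hom_factors_through_char:
  fixes \<rho> :: "('g \<Rightarrow> 'k) \<Rightarrow> 'k"
  assumes mult: "\<And>x y. x \<in> carrier (group_ring G F) \<Longrightarrow> y \<in> carrier (group_ring G F) \<Longrightarrow>
      \<rho> (x \<otimes>\<^bsub>group_ring G F\<^esub> y) = \<rho> x * \<rho> y"
    and add: "\<And>x y. x \<in> carrier (group_ring G F) \<Longrightarrow> y \<in> carrier (group_ring G F) \<Longrightarrow>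
      \<rho> (x \<oplus>\<^bsub>group_ring G F\<^esub> y) = \<rho> x + \<rho> y"
    and one: "\<rho> \<one>\<^bsub>group_ring G F\<^esub> = 1"
  shows "\<exists>\<chi>\<in>Ch. \<forall>x\<in>carrier (group_ring G F). \<rho> x = 0 \<longleftrightarrow> ev G \<chi> x = 0"
proof -
  let ?R = "carrier (group_ring G F)"
  have zR: "(\<lambda>_. 0) \<in> ?R" by (rule gr_memI) (auto simp: zero_in)
  have "\<rho> (\<lambda>_. 0) = \<rho> (\<lambda>_. 0) + \<rho> (\<lambda>_. 0)" using add[OF zR zR] by (simp add: gr_add)
  then have zero: "\<rho> (\<lambda>_. 0) = 0" by simp
  have "\<exists>\<chi>\<in>Ch. \<forall>x\<in>?R. ev G \<chi> x = 0 \<longrightarrow> \<rho> x = 0"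
  proof (rule ccontr)
    assume "\<not> ?thesis"
    then have bad: "\<And>\<chi>. \<chi> \<in> Ch \<Longrightarrow> \<exists>x\<in>?R. ev G \<chi> x = 0 \<and> \<rho> x \<noteq> 0" by blast
    \<comment> \<open>Multiply together, for each character, an element killed by that character but
      not by \<rho>. As \<rho> takes values in a field, the product is not killed by \<rho>,
      although all characters kill it.\<close>
    have "\<exists>x\<in>?R. \<rho> x \<noteq> 0 \<and> (\<forall>\<chi>\<in>S. ev G \<chi> x = 0)" if "finite S" "S \<subseteq> Ch" for S
      using that
    proof (induction S rule: finite_induct)
      case empty
      show ?case using gr_one_closed one by (intro bexI[of _ "\<one>\<^bsub>group_ring G F\<^esub>"]) auto
    next
      case (insert \<chi> S)
      then obtain x where x: "x \<in> ?R" "\<rho> x \<noteq> 0" "\<forall>\<psi>\<in>S. ev G \<psi> x = 0" by auto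
      obtain y where y: "y \<in> ?R" "ev G \<chi> y = 0" "\<rho> y \<noteq> 0" using bad insert.prems by blast
      have "ev G \<psi> (x \<otimes>\<^bsub>group_ring G F\<^esub> y) = ev G \<psi> x * ev G \<psi> y" if "\<psi> \<in> insert \<chi> S" for \<psi>
        using that insert.prems by (intro ev_mult chars_mult[of \<psi>]) auto
      then show ?case using x y gr_mult_closed mult
        by (intro bexI[of _ "x \<otimes>\<^bsub>group_ring G F\<^esub> y"]) auto
    qed
    from this[OF finite_Ch subset_refl] obtain x where "x \<in> ?R" "\<rho> x \<noteq> 0" "\<forall>\<chi>\<in>Ch. ev G \<chi> x = 0" by blast
    then show False using ev_all_zero zero by blast
  qed
  then obtain \<chi> where chi: "\<chi> \<in> Ch" "\<And>x. x \<in> ?R \<Longrightarrow> ev G \<chi> x = 0 \<Longrightarrow> \<rho> x = 0" by blast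
  have "ev G \<chi> x = 0" if x: "x \<in> ?R" "\<rho> x = 0" for x
  proof (rule ccontr)
    assume "ev G \<chi> x \<noteq> 0"
    then obtain y where y: "y \<in> ?R" "ev G \<chi> y * ev G \<chi> x = 1" using ev_inverse[OF chi(1) x(1)] by blast
    \<comment> \<open>v is -yx. The character kills 1 - yx, hence so does \<rho>, which contradicts
      \<rho>(x) = 0.\<close>
    define v where "v = (\<lambda>g. - 1 * (y \<otimes>\<^bsub>group_ring G F\<^esub> x) g)"
    have yx: "y \<otimes>\<^bsub>group_ring G F\<^esub> x \<in> ?R" using gr_mult_closed[OF y(1) x(1)] .
    have v: "v \<in> ?R" unfolding v_def by (rule smult_closed[OF uminus_in[OF one_in] yx])
    have "ev G \<chi> (\<one>\<^bsub>group_ring G F\<^esub> \<oplus>\<^bsub>group_ring G F\<^esub> v) = 1 - ev G \<chi> (y \<otimes>\<^bsub>group_ring G F\<^esub> x)"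
      unfolding ev_add v_def ev_smult gr_one by (simp add: ev_unit_vec chars_one[OF chi(1) zero_notin_mu])
    also have "\<dots> = 0" using ev_mult[of \<chi> y x] chars_mult[OF chi(1)] y(2) by simp
    finally have 1: "1 + \<rho> v = 0"
      using chi(2) gr_add_closed[OF gr_one_closed v] add[OF gr_one_closed v] one by simp
    have "(y \<otimes>\<^bsub>group_ring G F\<^esub> x) \<oplus>\<^bsub>group_ring G F\<^esub> v = (\<lambda>_. 0)" by (simp add: gr_add v_def)
    then have "\<rho> v = 0" using add[OF yx v] zero mult[OF y(1) x(1)] x(2) by simp
    then show False using 1 by simp
  qed
  then show ?thesis using chi by blast
qed

end

section \<open>Transport of characters along a ring isomorphism\<close>

context alg_closed_char_0
begin

text \<open>The value \<open>\<chi>' h\<close> and the image of the basis element at \<open>h\<close> are roots of unity of the same order.\<close>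

lemma char_value_in_image:
  fixes F :: "'k set"
  assumes gG: "group_algebra G F N" and gH: "group_algebra H F N"
    and chi: "\<chi> \<in> chars G (mu N)" and chi': "\<chi>' \<in> chars H (mu N)"
    and hom: "\<tau> \<in> ring_hom (group_ring H F) (group_ring G F)"
    and ker: "\<And>y. y \<in> carrier (group_ring H F) \<Longrightarrow> ev H \<chi>' y = 0 \<longleftrightarrow> ev G \<chi> (\<tau> y) = 0"
    and h: "h \<in> carrier H"
  shows "\<exists>x\<in>carrier (group_ring G F). ev G \<chi> x = \<chi>' h"
proof -
  interpret G: group_algebra G F N by (rule gG)
  interpret H: group_algebra H F N by (rule gH)
  define \<rho> where "\<rho> y = ev G \<chi> (\<tau> y)" for y
  have hi: "h [^]\<^bsub>H\<^esub> (i::nat) \<in> carrier H" for i using h by simp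
  have add: "\<rho> (x \<oplus>\<^bsub>group_ring H F\<^esub> y) = \<rho> x + \<rho> y"
    if "x \<in> carrier (group_ring H F)" "y \<in> carrier (group_ring H F)" for x y
    unfolding \<rho>_def ring_hom_add[OF hom that] by (rule G.ev_add)
  have mult: "\<rho> (x \<otimes>\<^bsub>group_ring H F\<^esub> y) = \<rho> x * \<rho> y"
    if "x \<in> carrier (group_ring H F)" "y \<in> carrier (group_ring H F)" for x y
    unfolding \<rho>_def ring_hom_mult[OF hom that] by (rule G.ev_mult) (rule chars_mult[OF chi])
  have one: "\<rho> (unit_vec \<one>\<^bsub>H\<^esub>) = 1"
    using ring_hom_one[OF hom] G.chars_one[OF chi G.zero_notin_mu]
    by (simp add: \<rho>_def G.gr_one H.gr_one G.ev_unit_vec)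
  have zH: "(\<lambda>_. 0) \<in> carrier (group_ring H F)" by (rule H.gr_memI) (auto simp: G.zero_in)
  have "\<rho> (\<lambda>_. 0) = \<rho> (\<lambda>_. 0) + \<rho> (\<lambda>_. 0)" using add[OF zH zH] by (simp add: H.gr_add)
  then have zero: "\<rho> (\<lambda>_. 0) = 0" by simp
  \<comment> \<open>This is -1 in the group ring of H. The two kernels are compared on elements u -
    1 with u a basis element, which detects the exponents i for which the i-th power of a value is
    1.\<close>
  define w where "w = (\<lambda>k. - 1 * (unit_vec \<one>\<^bsub>H\<^esub> k :: 'k))"
  have u1: "unit_vec \<one>\<^bsub>H\<^esub> \<in> carrier (group_ring H F)" by (rule H.unit_vec_closed) simp
  have w: "w \<in> carrier (group_ring H F)"
    unfolding w_def by (rule H.smult_closed[OF G.uminus_in[OF G.one_in] u1])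
  have "w \<oplus>\<^bsub>group_ring H F\<^esub> unit_vec \<one>\<^bsub>H\<^esub> = (\<lambda>_. 0)" by (simp add: w_def H.gr_add)
  then have rw: "\<rho> w = -1" using add[OF w u1] zero one by (simp add: eq_neg_iff_add_eq_0)
  have evw: "ev H \<chi>' w = -1"
    unfolding w_def H.ev_smult using H.chars_one[OF chi' H.zero_notin_mu] by (simp add: H.ev_unit_vec)
  have pow: "\<rho> (unit_vec (h [^]\<^bsub>H\<^esub> i)) = \<rho> (unit_vec h) ^ i" for i :: nat
  proof (induction i)
    case (Suc i)
    have "\<rho> (unit_vec (h [^]\<^bsub>H\<^esub> Suc i)) = \<rho> (unit_vec (h [^]\<^bsub>H\<^esub> i) \<otimes>\<^bsub>group_ring H F\<^esub> unit_vec h)"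
      using h by (simp add: H.unit_vec_mult)
    also have "\<dots> = \<rho> (unit_vec (h [^]\<^bsub>H\<^esub> i)) * \<rho> (unit_vec h)"
      by (rule mult) (auto intro!: H.unit_vec_closed h)
    finally show ?case using Suc by simp
  qed (simp add: one)
  define \<zeta> where "\<zeta> = \<rho> (unit_vec h)"
  have iff: "\<zeta> ^ i = 1 \<longleftrightarrow> \<chi>' h ^ i = 1" for i
  proof -
    let ?u = "unit_vec (h [^]\<^bsub>H\<^esub> i)"
    have u: "?u \<in> carrier (group_ring H F)" by (rule H.unit_vec_closed[OF hi])
    have "ev H \<chi>' (?u \<oplus>\<^bsub>group_ring H F\<^esub> w) = \<chi>' h ^ i - 1"
      by (simp add: H.ev_add evw H.ev_unit_vec[OF hi] H.chars_pow[OF chi' H.zero_notin_mu h])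
    moreover have "\<rho> (?u \<oplus>\<^bsub>group_ring H F\<^esub> w) = \<zeta> ^ i - 1"
      using add[OF u w] rw pow[of i] by (simp add: \<zeta>_def)
    ultimately show ?thesis using ker[OF H.gr_add_closed[OF u w]] by (simp add: \<rho>_def)
  qed
  define d where "d = (LEAST d. d > 0 \<and> \<chi>' h ^ d = 1)"
  have "N > 0 \<and> \<chi>' h ^ N = 1" using H.N_pos chars_in[OF chi' h] by (simp add: mu_def)
  then have d: "d > 0 \<and> \<chi>' h ^ d = 1" unfolding d_def by (rule LeastI)
  have "primitive_root_of_unity d (\<chi>' h)"
    using d not_less_Least unfolding primitive_root_of_unity_def d_def by blast
  then have "primitive_root_of_unity d \<zeta>" using iff by (simp add: primitive_root_of_unity_def)
  then obtain i where "\<chi>' h = \<zeta> ^ i" using roots_of_unity_eq_powers[of d \<zeta>] d by auto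
  then have "\<chi>' h = \<rho> (unit_vec (h [^]\<^bsub>H\<^esub> i))" by (simp add: pow \<zeta>_def)
  moreover have "\<tau> (unit_vec (h [^]\<^bsub>H\<^esub> i)) \<in> carrier (group_ring G F)"
    using ring_hom_closed[OF hom H.unit_vec_closed[OF hi]] .
  ultimately show ?thesis unfolding \<rho>_def by metis
qed

text \<open>Evaluating \<chi> after the inverse of \<theta> is a ring homomorphism on the group ring
  of H, so its kernel is that of a character of H. The last two clauses express that the two
  characters generate the same field over F.\<close>

lemma matching_char_exists:
  fixes F :: "'k set"
  assumes gG: "group_algebra G F N" and gH: "group_algebra H F N"
    and chi: "\<chi> \<in> chars G (mu N)"
    and iso: "\<theta> \<in> ring_iso (group_ring G F) (group_ring H F)"
  shows "\<exists>\<chi>'\<in>chars H (mu N). (\<forall>x\<in>carrier (group_ring G F). ev G \<chi> x = 0 \<longleftrightarrow> ev H \<chi>' (\<theta> x) = 0) \<and>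
    (\<forall>h\<in>carrier H. \<exists>x\<in>carrier (group_ring G F). ev G \<chi> x = \<chi>' h) \<and>
    (\<forall>g\<in>carrier G. \<exists>y\<in>carrier (group_ring H F). ev H \<chi>' y = \<chi> g)"
proof -
  interpret G: group_algebra G F N by (rule gG)
  interpret H: group_algebra H F N by (rule gH)
  have bij: "bij_betw \<theta> (carrier (group_ring G F)) (carrier (group_ring H F))"
    and hom: "\<theta> \<in> ring_hom (group_ring G F) (group_ring H F)"
    using iso by (auto simp: ring_iso_def)
  let ?i = "inv_into (carrier (group_ring G F)) \<theta>"
  have "?i \<in> ring_iso (group_ring H F) (group_ring G F)"
    by (rule ring_iso_inv[OF iso G.gr_mult_closed G.gr_add_closed G.gr_one_closed])
  then have ihom: "?i \<in> ring_hom (group_ring H F) (group_ring G F)" by (simp add: ring_iso_def)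
  have "\<exists>\<chi>'\<in>chars H (mu N). \<forall>y\<in>carrier (group_ring H F). ev G \<chi> (?i y) = 0 \<longleftrightarrow> ev H \<chi>' y = 0"
  proof (rule H.ring_hom_factors_through_char)
    fix x y assume xy: "x \<in> carrier (group_ring H F)" "y \<in> carrier (group_ring H F)"
    show "ev G \<chi> (?i (x \<otimes>\<^bsub>group_ring H F\<^esub> y)) = ev G \<chi> (?i x) * ev G \<chi> (?i y)"
      unfolding ring_hom_mult[OF ihom xy] by (rule G.ev_mult) (rule chars_mult[OF chi])
    show "ev G \<chi> (?i (x \<oplus>\<^bsub>group_ring H F\<^esub> y)) = ev G \<chi> (?i x) + ev G \<chi> (?i y)"
      unfolding ring_hom_add[OF ihom xy] by (rule G.ev_add)
  next
    show "ev G \<chi> (?i \<one>\<^bsub>group_ring H F\<^esub>) = 1"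
      using ring_hom_one[OF ihom] G.chars_one[OF chi G.zero_notin_mu] by (simp add: G.gr_one G.ev_unit_vec)
  qed
  then obtain \<chi>' where chi': "\<chi>' \<in> chars H (mu N)"
    and ker: "\<And>y. y \<in> carrier (group_ring H F) \<Longrightarrow> ev H \<chi>' y = 0 \<longleftrightarrow> ev G \<chi> (?i y) = 0" by blast
  have ker': "ev G \<chi> x = 0 \<longleftrightarrow> ev H \<chi>' (\<theta> x) = 0" if x: "x \<in> carrier (group_ring G F)" for x
    using ker[OF ring_hom_closed[OF hom x]] bij_betw_inv_into_left[OF bij x] by simp
  show ?thesis
    using chi' ker' char_value_in_image[OF gG gH chi chi' ihom ker] char_value_in_image[OF gH gG chi' chi hom ker']
    by blast
qed

text \<open>A character with the same kernel as a chosen representative differs from it by an \<open>F\<close>-automorphism of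
  the common image. The injection applies this automorphism to the character of \<open>H\<close> matching
  the representative.\<close>

lemma card_chars_le_if_group_rings_iso:
  fixes F :: "'k set"
  assumes gG: "group_algebra G F N" and gH: "group_algebra H F N"
    and iso: "\<theta> \<in> ring_iso (group_ring G F) (group_ring H F)"
    and K: "is_subfield K" "F \<subseteq> K"
  shows "card (chars G (mu N \<inter> K)) \<le> card (chars H (mu N \<inter> K))"
proof -
  interpret G: group_algebra G F N by (rule gG)
  interpret H: group_algebra H F N by (rule gH)
  interpret K: subfield_of K by unfold_locales (rule K(1))
  let ?R = "carrier (group_ring G F)" and ?S = "carrier (group_ring H F)"
  have bij: "bij_betw \<theta> ?R ?S" using iso by (simp add: ring_iso_def)
  define ker where "ker \<chi> = {x\<in>?R. ev G \<chi> x = 0}" for \<chi>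
  \<comment> \<open>Characters are grouped by kernel, with one representative for each, so that the
    matching character of H is chosen once per kernel.\<close>
  define rep where "rep M = (SOME \<chi>. \<chi> \<in> chars G (mu N) \<and> ker \<chi> = M)" for M
  have rep: "rep (ker \<chi>) \<in> chars G (mu N)" "ker (rep (ker \<chi>)) = ker \<chi>" if "\<chi> \<in> chars G (mu N)" for \<chi>
    using someI[of "\<lambda>\<psi>. \<psi> \<in> chars G (mu N) \<and> ker \<psi> = ker \<chi>" \<chi>] that by (auto simp: rep_def)
  have "\<forall>\<chi>\<in>chars G (mu N). \<exists>\<chi>'. \<chi>' \<in> chars H (mu N) \<and> (\<forall>x\<in>?R. ev G \<chi> x = 0 \<longleftrightarrow> ev H \<chi>' (\<theta> x) = 0) \<and>
    (\<forall>h\<in>carrier H. \<exists>x\<in>?R. ev G \<chi> x = \<chi>' h) \<and> (\<forall>g\<in>carrier G. \<exists>y\<in>?S. ev H \<chi>' y = \<chi> g)"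
    using matching_char_exists[OF gG gH _ iso] by blast
  from bchoice[OF this] obtain mt where mt_all: "\<forall>\<chi>\<in>chars G (mu N). mt \<chi> \<in> chars H (mu N) \<and>
    (\<forall>x\<in>?R. ev G \<chi> x = 0 \<longleftrightarrow> ev H (mt \<chi>) (\<theta> x) = 0) \<and>
    (\<forall>h\<in>carrier H. \<exists>x\<in>?R. ev G \<chi> x = mt \<chi> h) \<and> (\<forall>g\<in>carrier G. \<exists>y\<in>?S. ev H (mt \<chi>) y = \<chi> g)"
    by (elim exE)
  have mt: "mt \<chi> \<in> chars H (mu N)" if "\<chi> \<in> chars G (mu N)" for \<chi>
    using mt_all that by blast
  have mt_ker: "ev G \<chi> x = 0 \<longleftrightarrow> ev H (mt \<chi>) (\<theta> x) = 0" if "\<chi> \<in> chars G (mu N)" "x \<in> ?R" for \<chi> x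
    using mt_all that by blast
  have mt_H: "\<exists>x\<in>?R. ev G \<chi> x = mt \<chi> h" if "\<chi> \<in> chars G (mu N)" "h \<in> carrier H" for \<chi> h
    using mt_all that by blast
  have mt_G: "\<exists>y\<in>?S. ev H (mt \<chi>) y = \<chi> g" if "\<chi> \<in> chars G (mu N)" "g \<in> carrier G" for \<chi> g
    using mt_all that by blast
  \<comment> \<open>For r the representative, ev r x \<mapsto> ev \<chi> x is an isomorphism from
    the image of r to that of \<chi>. \<open>lift\<close> picks a preimage under r of the value of
    the matching character at \<open>h\<close>, and \<open>J\<close> below evaluates it at \<chi>,
    which applies that isomorphism.\<close>
  define lift where "lift \<chi> h = (SOME x. x \<in> ?R \<and> ev G (rep (ker \<chi>)) x = mt (rep (ker \<chi>)) h)" for \<chi> h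
  have lift: "lift \<chi> h \<in> ?R" "ev G (rep (ker \<chi>)) (lift \<chi> h) = mt (rep (ker \<chi>)) h"
    if "\<chi> \<in> chars G (mu N)" "h \<in> carrier H" for \<chi> h
    using someI_ex[of "\<lambda>x. x \<in> ?R \<and> ev G (rep (ker \<chi>)) x = mt (rep (ker \<chi>)) h"] mt_H[OF rep(1)[OF that(1)] that(2)]
    unfolding lift_def by auto
  define J where "J \<chi> = (\<lambda>h\<in>carrier H. ev G \<chi> (lift \<chi> h))" for \<chi>
  have same: "ev G \<chi> x = ev G \<chi> y"
    if chi: "\<chi> \<in> chars G (mu N)" and x: "x \<in> ?R" and y: "y \<in> ?R" and e: "ev G (rep (ker \<chi>)) x = ev G (rep (ker \<chi>)) y" for \<chi> x y
  proof -
    have d: "(\<lambda>g. x g - y g) \<in> ?R"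
      by (rule G.gr_memI) (auto simp: G.diff_in G.gr_coeff[OF x] G.gr_coeff[OF y] G.gr_outside[OF x] G.gr_outside[OF y])
    then have "(\<lambda>g. x g - y g) \<in> ker (rep (ker \<chi>))" using e by (simp add: ker_def G.ev_diff)
    then have "(\<lambda>g. x g - y g) \<in> ker \<chi>" using rep(2)[OF chi] by simp
    then show ?thesis by (simp add: ker_def G.ev_diff)
  qed
  have J_ev: "ev H (J \<chi>) y = ev G \<chi> x"
    if chi: "\<chi> \<in> chars G (mu N)" and x: "x \<in> ?R" and y: "y \<in> ?S" and e: "ev G (rep (ker \<chi>)) x = ev H (mt (rep (ker \<chi>))) y" for \<chi> x y
  proof -
    define v where "v = (\<lambda>g. \<Sum>h\<in>carrier H. y h * lift \<chi> h g)"
    have v: "v \<in> ?R" unfolding v_def by (rule G.lincomb_closed) (auto simp: H.gr_coeff[OF y] lift[OF chi])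
    have "ev H (J \<chi>) y = ev G \<chi> v"
      unfolding v_def G.ev_lincomb by (auto simp: ev_def[of H] J_def intro!: sum.cong)
    moreover have "ev G (rep (ker \<chi>)) v = ev H (mt (rep (ker \<chi>))) y"
      unfolding v_def G.ev_lincomb using lift(2)[OF chi] by (auto simp: ev_def[of H] intro!: sum.cong)
    ultimately show ?thesis using same[OF chi v x] e by simp
  qed
  have J_val: "J \<chi> h = ev G \<chi> x"
    if chi: "\<chi> \<in> chars G (mu N)" and h: "h \<in> carrier H" and x: "x \<in> ?R" and e: "ev G (rep (ker \<chi>)) x = mt (rep (ker \<chi>)) h" for \<chi> x h
    using J_ev[OF chi x H.unit_vec_closed[OF h]] e by (simp add: H.ev_unit_vec[OF h])
  have JH: "J \<chi> \<in> chars H (mu N)" if chi: "\<chi> \<in> chars G (mu N)" for \<chi>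
  proof (rule H.ChI)
    show "J \<chi> \<in> extensional (carrier H)" by (simp add: J_def)
    have "J \<chi> \<one>\<^bsub>H\<^esub> = ev G \<chi> (unit_vec \<one>\<^bsub>G\<^esub>)"
      using G.chars_one[OF rep(1)[OF chi] G.zero_notin_mu] H.chars_one[OF mt[OF rep(1)[OF chi]] H.zero_notin_mu]
      by (intro J_val[OF chi] G.unit_vec_closed) (auto simp: G.ev_unit_vec)
    then show "J \<chi> \<one>\<^bsub>H\<^esub> = 1" using G.chars_one[OF chi G.zero_notin_mu] by (simp add: G.ev_unit_vec)
    fix h h' assume h: "h \<in> carrier H" "h' \<in> carrier H"
    note l = lift[OF chi h(1)] lift[OF chi h(2)]
    have "J \<chi> (h \<otimes>\<^bsub>H\<^esub> h') = ev G \<chi> (lift \<chi> h \<otimes>\<^bsub>group_ring G F\<^esub> lift \<chi> h')"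
    proof (rule J_val[OF chi])
      show "ev G (rep (ker \<chi>)) (lift \<chi> h \<otimes>\<^bsub>group_ring G F\<^esub> lift \<chi> h') = mt (rep (ker \<chi>)) (h \<otimes>\<^bsub>H\<^esub> h')"
        using G.ev_mult[OF chars_mult[OF rep(1)[OF chi]]] l chars_mult[OF mt[OF rep(1)[OF chi]] h] by simp
    qed (use h l G.gr_mult_closed in auto)
    also have "\<dots> = ev G \<chi> (lift \<chi> h) * ev G \<chi> (lift \<chi> h')"
      using G.ev_mult[OF chars_mult[OF chi]] by simp
    finally show "J \<chi> (h \<otimes>\<^bsub>H\<^esub> h') = J \<chi> h * J \<chi> h'" using h by (simp add: J_def)
  qed
  have sub: "\<chi> \<in> chars G (mu N)" if "\<chi> \<in> chars G (mu N \<inter> K)" for \<chi>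
    using that by (auto simp: chars_def PiE_def Pi_def)
  have maps: "J ` chars G (mu N \<inter> K) \<subseteq> chars H (mu N \<inter> K)"
  proof
    fix \<psi> assume "\<psi> \<in> J ` chars G (mu N \<inter> K)"
    then obtain \<chi> where chi: "\<chi> \<in> chars G (mu N \<inter> K)" "\<psi> = J \<chi>" by blast
    have "J \<chi> h \<in> K" if h: "h \<in> carrier H" for h
    proof -
      have "ev G \<chi> (lift \<chi> h) \<in> K"
        unfolding ev_def using chars_in[OF chi(1)] G.gr_coeff[OF lift(1)[OF sub[OF chi(1)] h]] K(2)
        by (intro K.sum_in K.mult_in) auto
      then show ?thesis using h by (simp add: J_def)
    qed
    then show "\<psi> \<in> chars H (mu N \<inter> K)"
      using JH[OF sub[OF chi(1)]] chi(2) by (auto simp: chars_def PiE_def Pi_def)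
  qed
  have inj: "inj_on J (chars G (mu N \<inter> K))"
  proof (rule inj_onI)
    fix \<chi> \<psi> assume a: "\<chi> \<in> chars G (mu N \<inter> K)" "\<psi> \<in> chars G (mu N \<inter> K)" and e: "J \<chi> = J \<psi>"
    \<comment> \<open>The kernel of \<open>J \<chi>\<close> is that of the matching character, the
      image of \<open>ker \<chi>\<close>. So \<open>J \<chi>\<close> determines the kernel and with
      it the representative, after which the values of \<chi> can be read off from those of
      \<open>J \<chi>\<close>.\<close>
    have kerJ: "{y\<in>?S. ev H (J \<chi>) y = 0} = \<theta> ` ker \<chi>" if chi: "\<chi> \<in> chars G (mu N)" for \<chi>
    proof -
      let ?r = "rep (ker \<chi>)"
      have r: "?r \<in> chars G (mu N)" using rep(1)[OF chi] .
      have iff: "ev H (J \<chi>) y = 0 \<longleftrightarrow> ev H (mt ?r) y = 0" if y: "y \<in> ?S" for y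
      proof -
        define v where "v = (\<lambda>g. \<Sum>h\<in>carrier H. y h * lift \<chi> h g)"
        have v: "v \<in> ?R" unfolding v_def by (rule G.lincomb_closed) (auto simp: H.gr_coeff[OF y] lift[OF chi])
        have ev: "ev G ?r v = ev H (mt ?r) y"
          unfolding v_def G.ev_lincomb using lift(2)[OF chi] by (auto simp: ev_def[of H] intro!: sum.cong)
        have "ev G \<chi> v = 0 \<longleftrightarrow> v \<in> ker \<chi>" using v by (simp add: ker_def)
        also have "\<dots> \<longleftrightarrow> v \<in> ker ?r" using rep(2)[OF chi] by simp
        also have "\<dots> \<longleftrightarrow> ev G ?r v = 0" using v by (simp add: ker_def)
        finally show ?thesis using J_ev[OF chi v y ev] ev by simp
      qed
      have "{y\<in>?S. ev H (J \<chi>) y = 0} = {y\<in>\<theta> ` ?R. ev H (mt ?r) y = 0}"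
        using iff bij by (auto simp: bij_betw_def)
      also have "\<dots> = \<theta> ` ker ?r" using mt_ker[OF r] by (auto simp: ker_def)
      finally show ?thesis using rep(2)[OF chi] by simp
    qed
    have "\<theta> ` ker \<chi> = \<theta> ` ker \<psi>" using kerJ[OF sub[OF a(1)]] kerJ[OF sub[OF a(2)]] e by simp
    then have k: "ker \<chi> = ker \<psi>"
      using bij inj_on_image_eq_iff[of \<theta> ?R "ker \<chi>" "ker \<psi>"] by (auto simp: bij_betw_def ker_def)
    show "\<chi> = \<psi>"
    proof (rule chars_eqI[OF a])
      fix g assume g: "g \<in> carrier G"
      let ?r = "rep (ker \<chi>)"
      have r: "?r \<in> chars G (mu N)" using rep(1)[OF sub[OF a(1)]] .
      obtain y where y: "y \<in> ?S" "ev H (mt ?r) y = ?r g" using mt_G[OF r g] by blast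
      have e': "ev G ?r (unit_vec g) = ev H (mt ?r) y" using y g by (simp add: G.ev_unit_vec)
      have "ev H (J \<chi>) y = \<chi> g"
        using J_ev[OF sub[OF a(1)] G.unit_vec_closed[OF g] y(1) e'] g by (simp add: G.ev_unit_vec)
      moreover have "ev H (J \<psi>) y = \<psi> g"
        using J_ev[OF sub[OF a(2)] G.unit_vec_closed[OF g] y(1)] e' g by (simp add: G.ev_unit_vec k)
      ultimately show "\<chi> g = \<psi> g" using e by simp
    qed
  qed
  have "finite (chars H (mu N \<inter> K))"
    by (rule finite_chars) (use H.finite_G finite_mu[OF H.N_pos] in auto)
  then show ?thesis using card_inj_on_le[OF inj maps] by blast
qed

theorem card_chars_eq_if_group_rings_iso:
  fixes F :: "'k set"
  assumes gG: "group_algebra G F N" and gH: "group_algebra H F N"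
    and iso: "\<theta> \<in> ring_iso (group_ring G F) (group_ring H F)"
    and K: "is_subfield K" "F \<subseteq> K"
  shows "card (chars G (mu N \<inter> K)) = card (chars H (mu N \<inter> K))"
proof (rule antisym)
  interpret G: group_algebra G F N by (rule gG)
  have "inv_into (carrier (group_ring G F)) \<theta> \<in> ring_iso (group_ring H F) (group_ring G F)"
    by (rule ring_iso_inv[OF iso G.gr_mult_closed G.gr_add_closed G.gr_one_closed])
  then show "card (chars H (mu N \<inter> K)) \<le> card (chars G (mu N \<inter> K))"
    by (rule card_chars_le_if_group_rings_iso[OF gH gG _ K])
qed (rule card_chars_le_if_group_rings_iso[OF gG gH iso K])

end

section \<open>Symmetric cocycle classes\<close>

definition symmetric_on :: "('g, 'x) monoid_scheme \<Rightarrow> ('g \<Rightarrow> 'g \<Rightarrow> 'k) \<Rightarrow> bool" where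
  "symmetric_on G \<alpha> \<longleftrightarrow> (\<forall>g\<in>carrier G. \<forall>h\<in>carrier G. \<alpha> g h = \<alpha> h g)"

text \<open>For abelian G this is the scalar c with u_x u_y = c u_y u_x in the twisted group ring.
  It depends only on the class of \<alpha>, coboundaries being symmetric.\<close>

definition commutator_form :: "('g, 'x) monoid_scheme \<Rightarrow> ('g \<Rightarrow> 'g \<Rightarrow> 'k::field) \<Rightarrow> 'g \<times> 'g \<Rightarrow> 'k" where
  "commutator_form G \<alpha> = (\<lambda>(x, y)\<in>carrier G \<times> carrier G. \<alpha> x y / \<alpha> y x)"

lemma cocycle_nonzero: "cocycle G F \<alpha> \<Longrightarrow> g \<in> carrier G \<Longrightarrow> h \<in> carrier G \<Longrightarrow> \<alpha> g h \<noteq> 0"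
  and cocycle_in: "cocycle G F \<alpha> \<Longrightarrow> g \<in> carrier G \<Longrightarrow> h \<in> carrier G \<Longrightarrow> \<alpha> g h \<in> F"
  and cocycle_eq: "cocycle G F \<alpha> \<Longrightarrow> g \<in> carrier G \<Longrightarrow> h \<in> carrier G \<Longrightarrow> k \<in> carrier G \<Longrightarrow>
    \<alpha> g h * \<alpha> (g \<otimes>\<^bsub>G\<^esub> h) k = \<alpha> h k * \<alpha> g (h \<otimes>\<^bsub>G\<^esub> k)"
  by (auto simp: cocycle_def)

lemma symmetric_on_iff_commutator_form:
  assumes "cocycle G F \<alpha>"
  shows "symmetric_on G \<alpha> \<longleftrightarrow> (\<forall>x\<in>carrier G. \<forall>y\<in>carrier G. commutator_form G \<alpha> (x, y) = 1)"
  using cocycle_nonzero[OF assms] by (auto simp: symmetric_on_def commutator_form_def)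

lemma commutator_form_mult:
  "x \<in> carrier G \<Longrightarrow> y \<in> carrier G \<Longrightarrow> commutator_form G (\<lambda>g h. \<alpha> g h * \<beta> g h) (x, y) =
    commutator_form G \<alpha> (x, y) * commutator_form G \<beta> (x, y)"
  and commutator_form_power:
  "x \<in> carrier G \<Longrightarrow> y \<in> carrier G \<Longrightarrow> commutator_form G (\<lambda>g h. \<alpha> g h ^ n) (x, y) =
    commutator_form G \<alpha> (x, y) ^ n"
  by (auto simp: commutator_form_def power_divide)

text \<open>Multiplicativity on the left follows by combining the cocycle identities for (x, y, z),
  (x, z, y) and (z, x, y) and cancelling the common factor P; on the right it follows by taking
  inverses.\<close>

lemma (in comm_group) commutator_form_alt:
  assumes \<alpha>: "cocycle G F \<alpha>" and U: "\<And>x y. x \<in> carrier G \<Longrightarrow> y \<in> carrier G \<Longrightarrow> commutator_form G \<alpha> (x, y) \<in> U"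
  shows "commutator_form G \<alpha> \<in> alt_forms G U"
proof -
  have left: "\<alpha> (x \<otimes> y) z / \<alpha> z (x \<otimes> y) = (\<alpha> x z / \<alpha> z x) * (\<alpha> y z / \<alpha> z y)"
    if xyz: "x \<in> carrier G" "y \<in> carrier G" "z \<in> carrier G" for x y z
  proof -
    have nz: "\<alpha> a b \<noteq> 0" if "a \<in> carrier G" "b \<in> carrier G" for a b
      using cocycle_nonzero[OF \<alpha>] that by blast
    have 1: "\<alpha> x y * \<alpha> (x \<otimes> y) z = \<alpha> y z * \<alpha> x (y \<otimes> z)" using cocycle_eq[OF \<alpha> xyz] .
    have 2: "\<alpha> x z * \<alpha> (x \<otimes> z) y = \<alpha> z y * \<alpha> x (y \<otimes> z)"
      using cocycle_eq[OF \<alpha> xyz(1,3,2)] m_comm[OF xyz(2,3)] by simp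
    have 3: "\<alpha> z x * \<alpha> (x \<otimes> z) y = \<alpha> x y * \<alpha> z (x \<otimes> y)"
      using cocycle_eq[OF \<alpha> xyz(3,1,2)] m_comm[OF xyz(1,3)] by simp
    define P where "P = \<alpha> x y * \<alpha> x (y \<otimes> z) * \<alpha> (x \<otimes> z) y"
    have "P \<noteq> 0" unfolding P_def using nz xyz by simp
    moreover have "(\<alpha> (x \<otimes> y) z * (\<alpha> z x * \<alpha> z y)) * P = (\<alpha> x z * \<alpha> y z * \<alpha> z (x \<otimes> y)) * P"
    proof -
      have "(\<alpha> (x \<otimes> y) z * (\<alpha> z x * \<alpha> z y)) * P =
        (\<alpha> x y * \<alpha> (x \<otimes> y) z) * (\<alpha> z x * \<alpha> (x \<otimes> z) y) * (\<alpha> z y * \<alpha> x (y \<otimes> z))"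
        by (simp add: P_def mult_ac)
      also have "\<dots> = (\<alpha> y z * \<alpha> x (y \<otimes> z)) * (\<alpha> x y * \<alpha> z (x \<otimes> y)) * (\<alpha> x z * \<alpha> (x \<otimes> z) y)"
        by (simp only: 1 2 3)
      also have "\<dots> = (\<alpha> x z * \<alpha> y z * \<alpha> z (x \<otimes> y)) * P" by (simp add: P_def mult_ac)
      finally show ?thesis .
    qed
    ultimately have "\<alpha> (x \<otimes> y) z * (\<alpha> z x * \<alpha> z y) = \<alpha> x z * \<alpha> y z * \<alpha> z (x \<otimes> y)" by simp
    then show ?thesis using nz xyz by (simp add: field_simps)
  qed
  have right: "\<alpha> z (x \<otimes> y) / \<alpha> (x \<otimes> y) z = (\<alpha> z x / \<alpha> x z) * (\<alpha> z y / \<alpha> y z)"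
    if xyz: "x \<in> carrier G" "y \<in> carrier G" "z \<in> carrier G" for x y z
    using arg_cong[OF left[OF xyz], of inverse] by simp
  show ?thesis
    unfolding alt_forms_def bimult_def
  proof (intro CollectI conjI ballI)
    show "commutator_form G \<alpha> \<in> carrier G \<times> carrier G \<rightarrow>\<^sub>E U"
      using U by (auto simp: commutator_form_def)
    fix x y z assume xyz: "x \<in> carrier G" "y \<in> carrier G" "z \<in> carrier G"
    show "commutator_form G \<alpha> (x \<otimes> y, z) = commutator_form G \<alpha> (x, z) * commutator_form G \<alpha> (y, z)"
      using left[OF xyz] xyz by (simp add: commutator_form_def)
    show "commutator_form G \<alpha> (x, y \<otimes> z) = commutator_form G \<alpha> (x, y) * commutator_form G \<alpha> (x, z)"
      using right[OF xyz(2,3,1)] xyz by (simp add: commutator_form_def)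
  next
    fix x assume "x \<in> carrier G"
    then show "commutator_form G \<alpha> (x, x) = 1" using cocycle_nonzero[OF \<alpha>] by (simp add: commutator_form_def)
  qed
qed

section \<open>Cocycles modulo coboundaries and commutativity of twisted group rings\<close>

context subfield_of
begin

lemma cocycle_one: "group G \<Longrightarrow> cocycle G K (\<lambda>_ _. 1)"
  using one_in by (simp add: cocycle_def)

lemma cocycle_mult:
  assumes "cocycle G K \<alpha>" "cocycle G K \<beta>"
  shows "cocycle G K (\<lambda>g h. \<alpha> g h * \<beta> g h)"
  unfolding cocycle_def
proof (intro conjI ballI)
  fix g h assume gh: "g \<in> carrier G" "h \<in> carrier G"
  show "\<alpha> g h * \<beta> g h \<in> K - {0}"
    using cocycle_in[OF assms(1) gh] cocycle_in[OF assms(2) gh] cocycle_nonzero[OF assms(1) gh] cocycle_nonzero[OF assms(2) gh]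
    by (simp add: mult_in)
  fix k assume k: "k \<in> carrier G"
  have "(\<alpha> g h * \<beta> g h) * (\<alpha> (g \<otimes>\<^bsub>G\<^esub> h) k * \<beta> (g \<otimes>\<^bsub>G\<^esub> h) k) =
    (\<alpha> g h * \<alpha> (g \<otimes>\<^bsub>G\<^esub> h) k) * (\<beta> g h * \<beta> (g \<otimes>\<^bsub>G\<^esub> h) k)" by (simp only: mult_ac)
  also have "\<dots> = (\<alpha> h k * \<alpha> g (h \<otimes>\<^bsub>G\<^esub> k)) * (\<beta> h k * \<beta> g (h \<otimes>\<^bsub>G\<^esub> k))"
    by (simp only: cocycle_eq[OF assms(1) gh k] cocycle_eq[OF assms(2) gh k])
  also have "\<dots> = (\<alpha> h k * \<beta> h k) * (\<alpha> g (h \<otimes>\<^bsub>G\<^esub> k) * \<beta> g (h \<otimes>\<^bsub>G\<^esub> k))" by (simp only: mult_ac)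
  finally show "(\<alpha> g h * \<beta> g h) * (\<alpha> (g \<otimes>\<^bsub>G\<^esub> h) k * \<beta> (g \<otimes>\<^bsub>G\<^esub> h) k) =
    (\<alpha> h k * \<beta> h k) * (\<alpha> g (h \<otimes>\<^bsub>G\<^esub> k) * \<beta> g (h \<otimes>\<^bsub>G\<^esub> k))" .
qed

lemma cohomologous_refl: "cohomologous G K \<alpha> \<alpha>"
  unfolding cohomologous_def using one_in by (intro exI[of _ "\<lambda>_. 1"]) auto

lemma cohomologous_sym:
  assumes G: "group G" and "cohomologous G K \<alpha> \<beta>"
  shows "cohomologous G K \<beta> \<alpha>"
proof -
  interpret group G by (rule G)
  obtain f where f: "\<And>g. g \<in> carrier G \<Longrightarrow> f g \<in> K - {0}"
    "\<And>g h. g \<in> carrier G \<Longrightarrow> h \<in> carrier G \<Longrightarrow> \<beta> g h = \<alpha> g h * (f g * f h / f (g \<otimes>\<^bsub>G\<^esub> h))"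
    using assms(2) unfolding cohomologous_def by auto
  have "\<alpha> g h = \<beta> g h * (inverse (f g) * inverse (f h) / inverse (f (g \<otimes>\<^bsub>G\<^esub> h)))"
    if "g \<in> carrier G" "h \<in> carrier G" for g h
    using f(1)[OF that(1)] f(1)[OF that(2)] f(1)[OF m_closed[OF that]] f(2)[OF that] by (simp add: field_simps)
  moreover have "inverse (f g) \<in> K - {0}" if "g \<in> carrier G" for g using f(1)[OF that] inverse_in by auto
  ultimately show ?thesis unfolding cohomologous_def by (intro exI[of _ "\<lambda>g. inverse (f g)"]) blast
qed

lemma cohomologous_mult:
  assumes "cohomologous G K \<alpha> \<beta>" "cohomologous G K \<alpha>' \<beta>'"
  shows "cohomologous G K (\<lambda>g h. \<alpha> g h * \<alpha>' g h) (\<lambda>g h. \<beta> g h * \<beta>' g h)"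
proof -
  obtain f where f: "\<And>g. g \<in> carrier G \<Longrightarrow> f g \<in> K - {0}"
    "\<And>g h. g \<in> carrier G \<Longrightarrow> h \<in> carrier G \<Longrightarrow> \<beta> g h = \<alpha> g h * (f g * f h / f (g \<otimes>\<^bsub>G\<^esub> h))"
    using assms(1) unfolding cohomologous_def by auto
  obtain f' where f': "\<And>g. g \<in> carrier G \<Longrightarrow> f' g \<in> K - {0}"
    "\<And>g h. g \<in> carrier G \<Longrightarrow> h \<in> carrier G \<Longrightarrow> \<beta>' g h = \<alpha>' g h * (f' g * f' h / f' (g \<otimes>\<^bsub>G\<^esub> h))"
    using assms(2) unfolding cohomologous_def by auto
  show ?thesis
    unfolding cohomologous_def
    by (intro exI[of _ "\<lambda>g. f g * f' g"]) (use f f' in \<open>auto simp: mult_in\<close>)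
qed

lemma cohomologous_trans:
  assumes "cohomologous G K \<alpha> \<beta>" "cohomologous G K \<beta> \<gamma>"
  shows "cohomologous G K \<alpha> \<gamma>"
proof -
  obtain f where f: "\<And>g. g \<in> carrier G \<Longrightarrow> f g \<in> K - {0}"
    "\<And>g h. g \<in> carrier G \<Longrightarrow> h \<in> carrier G \<Longrightarrow> \<beta> g h = \<alpha> g h * (f g * f h / f (g \<otimes>\<^bsub>G\<^esub> h))"
    using assms(1) unfolding cohomologous_def by auto
  obtain f' where f': "\<And>g. g \<in> carrier G \<Longrightarrow> f' g \<in> K - {0}"
    "\<And>g h. g \<in> carrier G \<Longrightarrow> h \<in> carrier G \<Longrightarrow> \<gamma> g h = \<beta> g h * (f' g * f' h / f' (g \<otimes>\<^bsub>G\<^esub> h))"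
    using assms(2) unfolding cohomologous_def by auto
  show ?thesis
    unfolding cohomologous_def
    by (intro exI[of _ "\<lambda>g. f g * f' g"]) (use f f' in \<open>auto simp: mult_in\<close>)
qed

lemma coh_class_eq_iff:
  assumes G: "group G" and "cocycle G K \<alpha>" "cocycle G K \<beta>"
  shows "coh_class G K \<alpha> = coh_class G K \<beta> \<longleftrightarrow> cohomologous G K \<alpha> \<beta>"
proof
  assume "coh_class G K \<alpha> = coh_class G K \<beta>"
  moreover have "\<beta> \<in> coh_class G K \<beta>" using assms(3) cohomologous_refl by (simp add: coh_class_def)
  ultimately show "cohomologous G K \<alpha> \<beta>" by (auto simp: coh_class_def)
next
  assume c: "cohomologous G K \<alpha> \<beta>"
  then have "cohomologous G K \<beta> \<alpha>" using cohomologous_sym G by blast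
  then show "coh_class G K \<alpha> = coh_class G K \<beta>"
    using c cohomologous_trans by (auto simp: coh_class_def)
qed

text \<open>\<open>H2\<close> multiplies classes through representatives picked by
  \<open>SOME\<close>; any other choice gives a cohomologous product.\<close>

lemma H2_mult:
  assumes G: "group G" and \<alpha>: "cocycle G K \<alpha>" and \<beta>: "cocycle G K \<beta>"
  shows "coh_class G K \<alpha> \<otimes>\<^bsub>H2 G K\<^esub> coh_class G K \<beta> = coh_class G K (\<lambda>g h. \<alpha> g h * \<beta> g h)"
proof -
  define a where "a = (SOME a. a \<in> coh_class G K \<alpha>)"
  define b where "b = (SOME b. b \<in> coh_class G K \<beta>)"
  have "\<alpha> \<in> coh_class G K \<alpha>" "\<beta> \<in> coh_class G K \<beta>"
    using \<alpha> \<beta> cohomologous_refl by (auto simp: coh_class_def)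
  then have "a \<in> coh_class G K \<alpha>" "b \<in> coh_class G K \<beta>"
    unfolding a_def b_def by (metis someI)+
  then have ab: "cocycle G K a" "cocycle G K b" "cohomologous G K \<alpha> a" "cohomologous G K \<beta> b"
    by (auto simp: coh_class_def)
  have "coh_class G K (\<lambda>g h. \<alpha> g h * \<beta> g h) = coh_class G K (\<lambda>g h. a g h * b g h)"
    using coh_class_eq_iff[OF G cocycle_mult[OF \<alpha> \<beta>] cocycle_mult[OF ab(1,2)]] cohomologous_mult[OF ab(3,4)] by blast
  then show ?thesis by (simp add: H2_def a_def b_def)
qed

lemma twisted_commutative_iff:
  assumes G: "comm_group G" and fin: "finite (carrier G)" and \<alpha>: "cocycle G K \<alpha>"
  shows "symmetric_on G \<alpha> \<longleftrightarrow> (\<forall>x\<in>carrier (twisted_group_ring G K \<alpha>). \<forall>y\<in>carrier (twisted_group_ring G K \<alpha>).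
    x \<otimes>\<^bsub>twisted_group_ring G K \<alpha>\<^esub> y = y \<otimes>\<^bsub>twisted_group_ring G K \<alpha>\<^esub> x)"
proof
  interpret comm_group G by (rule G)
  let ?T = "twisted_group_ring G K \<alpha>"
  have mult: "(x \<otimes>\<^bsub>?T\<^esub> y) k = (\<Sum>g\<in>carrier G. \<Sum>h\<in>carrier G. if g \<otimes>\<^bsub>G\<^esub> h = k then x g * y h * \<alpha> g h else 0)"
    if "k \<in> carrier G" for x y k
    using that fin by (simp add: twisted_group_ring_def sum.inter_filter)
  {
    assume sym: "symmetric_on G \<alpha>"
    show "\<forall>x\<in>carrier ?T. \<forall>y\<in>carrier ?T. x \<otimes>\<^bsub>?T\<^esub> y = y \<otimes>\<^bsub>?T\<^esub> x"
    proof (intro ballI ext)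
      fix x y k
      show "(x \<otimes>\<^bsub>?T\<^esub> y) k = (y \<otimes>\<^bsub>?T\<^esub> x) k"
      proof (cases "k \<in> carrier G")
        case True
        have "(x \<otimes>\<^bsub>?T\<^esub> y) k = (\<Sum>h\<in>carrier G. \<Sum>g\<in>carrier G. if g \<otimes>\<^bsub>G\<^esub> h = k then x g * y h * \<alpha> g h else 0)"
          unfolding mult[OF True] by (rule sum.swap)
        also have "\<dots> = (y \<otimes>\<^bsub>?T\<^esub> x) k"
          unfolding mult[OF True] using sym
          by (intro sum.cong refl) (auto simp: symmetric_on_def m_comm mult_ac)
        finally show ?thesis .
      qed (simp add: twisted_group_ring_def)
    qed
  }
  {
    assume comm: "\<forall>x\<in>carrier ?T. \<forall>y\<in>carrier ?T. x \<otimes>\<^bsub>?T\<^esub> y = y \<otimes>\<^bsub>?T\<^esub> x"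
    show "symmetric_on G \<alpha>"
      unfolding symmetric_on_def
    proof (intro ballI)
      fix g h assume gh: "g \<in> carrier G" "h \<in> carrier G"
      define u where "u a = (\<lambda>k. if k = a then 1 else 0 :: 'k)" for a :: 'a
      have uT: "u a \<in> carrier ?T" if "a \<in> carrier G" for a
        using that zero_in one_in by (auto simp: twisted_group_ring_def u_def)
      have val: "(u a \<otimes>\<^bsub>?T\<^esub> u b) (a \<otimes>\<^bsub>G\<^esub> b) = \<alpha> a b" if ab: "a \<in> carrier G" "b \<in> carrier G" for a b
      proof -
        have "(u a \<otimes>\<^bsub>?T\<^esub> u b) (a \<otimes>\<^bsub>G\<^esub> b) = (\<Sum>g\<in>carrier G. \<Sum>h\<in>carrier G. if h = b then (if g = a then \<alpha> a b else 0) else 0)"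
          unfolding mult[OF m_closed[OF ab]] by (intro sum.cong refl) (auto simp: u_def)
        also have "\<dots> = \<alpha> a b" using fin ab by simp
        finally show ?thesis .
      qed
      have "u g \<otimes>\<^bsub>?T\<^esub> u h = u h \<otimes>\<^bsub>?T\<^esub> u g" using comm uT gh by blast
      then show "\<alpha> g h = \<alpha> h g" using val[OF gh] val[OF gh(2,1)] m_comm[OF gh] by metis
    qed
  }
qed

lemma twisted_mult_closed:
  assumes "cocycle G K \<alpha>" "x \<in> carrier (twisted_group_ring G K \<alpha>)" "y \<in> carrier (twisted_group_ring G K \<alpha>)"
  shows "x \<otimes>\<^bsub>twisted_group_ring G K \<alpha>\<^esub> y \<in> carrier (twisted_group_ring G K \<alpha>)"
  using assms(2,3) cocycle_in[OF assms(1)] by (auto simp: twisted_group_ring_def intro!: sum_in mult_in)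

end

text \<open>\<open>M \<alpha> \<beta>\<close> stands for the class of \<beta> being the image of the
  class of \<alpha>. A relation between cocycles, in place of a map between classes, can be
  reversed, so that one inequality between counts also yields the opposite one.\<close>

locale cocycle_matching = subfield_of_alg_closed F for F :: "'k::field_char_0 set" +
  fixes G :: "('g, 'x) monoid_scheme" and H :: "('h, 'y) monoid_scheme"
    and M :: "('g \<Rightarrow> 'g \<Rightarrow> 'k) \<Rightarrow> ('h \<Rightarrow> 'h \<Rightarrow> 'k) \<Rightarrow> bool"
  assumes G: "comm_group G" "finite (carrier G)" and H: "comm_group H" "finite (carrier H)"
    and M_cocycle: "M \<alpha> \<beta> \<Longrightarrow> cocycle G F \<alpha> \<and> cocycle H F \<beta>"
    and M_total: "cocycle G F \<alpha> \<Longrightarrow> \<exists>\<beta>. M \<alpha> \<beta>"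
    and M_one: "M (\<lambda>_ _. 1) (\<lambda>_ _. 1)"
    and M_mult: "M \<alpha> \<beta> \<Longrightarrow> M \<alpha>' \<beta>' \<Longrightarrow> M (\<lambda>g h. \<alpha> g h * \<alpha>' g h) (\<lambda>g h. \<beta> g h * \<beta>' g h)"
    and M_symmetric: "M \<alpha> \<beta> \<Longrightarrow> symmetric_on G \<alpha> \<longleftrightarrow> symmetric_on H \<beta>"
begin

lemma M_power: "M \<alpha> \<beta> \<Longrightarrow> M (\<lambda>g h. \<alpha> g h ^ n) (\<lambda>g h. \<beta> g h ^ n)"
  by (induction n) (auto simp: M_one M_mult)

text \<open>A form is lifted to a cocycle on \<open>G\<close>, matched with one on \<open>H\<close>,
  and sent to the commutator form of the latter. Everything is phrased through symmetry, the
  property that \<open>M\<close> preserves: a commutator form takes n-th roots of unity as values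
  exactly when the n-th power of the cocycle is symmetric.\<close>

lemma card_alt_forms_le:
  assumes n: "n > 0" and mu: "mu n \<subseteq> F"
  shows "card (alt_forms G (mu n :: 'k set)) \<le> card (alt_forms H (mu n :: 'k set))"
proof -
  interpret G: comm_group G by (rule G)
  interpret H: comm_group H by (rule H)
  have "\<exists>\<alpha> \<beta>. M \<alpha> \<beta> \<and> commutator_form G \<alpha> = b" if b: "b \<in> alt_forms G (mu n)" for b
  proof -
    obtain a where bim: "bimult G a"
      and a: "\<And>x y. x \<in> carrier G \<Longrightarrow> y \<in> carrier G \<Longrightarrow> a (x, y) \<in> mu n \<and> b (x, y) = a (x, y) / a (y, x)"
      using alt_form_eq_commutator[OF G n b] by blast
    define \<alpha> where "\<alpha> x y = a (x, y)" for x y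
    have "cocycle G F \<alpha>"
      unfolding cocycle_def
    proof (intro conjI ballI)
      fix x y z assume "x \<in> carrier G" "y \<in> carrier G"
      then show "\<alpha> x y \<in> F - {0}" using a mu mu_nonzero[OF _ n] by (auto simp: \<alpha>_def)
      assume "z \<in> carrier G"
      then show "\<alpha> x y * \<alpha> (x \<otimes>\<^bsub>G\<^esub> y) z = \<alpha> y z * \<alpha> x (y \<otimes>\<^bsub>G\<^esub> z)"
        using bim \<open>x \<in> carrier G\<close> \<open>y \<in> carrier G\<close> by (simp add: bimult_def \<alpha>_def mult_ac)
    qed
    moreover have "commutator_form G \<alpha> = b"
      by (rule extensionalityI[of _ "carrier G \<times> carrier G"])
        (use b a in \<open>auto simp: commutator_form_def \<alpha>_def alt_forms_def PiE_def\<close>)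
    ultimately show ?thesis using M_total by blast
  qed
  then have "\<forall>b\<in>alt_forms G (mu n). \<exists>p. M (fst p) (snd p) \<and> commutator_form G (fst p) = b" by simp
  from bchoice[OF this] obtain p where p: "\<forall>b\<in>alt_forms G (mu n). M (fst (p b)) (snd (p b)) \<and> commutator_form G (fst (p b)) = b"
    by (elim exE)
  define \<Phi> where "\<Phi> b = commutator_form H (snd (p b))" for b
  have M: "M (fst (p b)) (snd (p b))" and cf: "commutator_form G (fst (p b)) = b" if "b \<in> alt_forms G (mu n)" for b
    using p that by auto
  have maps: "\<Phi> ` alt_forms G (mu n) \<subseteq> alt_forms H (mu n)"
  proof
    fix c assume "c \<in> \<Phi> ` alt_forms G (mu n)"
    then obtain b where b: "b \<in> alt_forms G (mu n)" "c = \<Phi> b" by blast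
    note Mn = M_power[OF M[OF b(1)], of n]
    have "symmetric_on G (\<lambda>g h. fst (p b) g h ^ n)"
      using M_cocycle[OF Mn] alt_forms_in[OF b(1)]
      by (auto simp: symmetric_on_iff_commutator_form commutator_form_power cf[OF b(1)] mu_def)
    then have "symmetric_on H (\<lambda>g h. snd (p b) g h ^ n)" using M_symmetric[OF Mn] by simp
    then have "commutator_form H (snd (p b)) (x, y) \<in> mu n" if "x \<in> carrier H" "y \<in> carrier H" for x y
      using M_cocycle[OF Mn] that by (auto simp: symmetric_on_iff_commutator_form commutator_form_power mu_def)
    then show "c \<in> alt_forms H (mu n)"
      using H.commutator_form_alt M_cocycle[OF M[OF b(1)]] b(2) unfolding \<Phi>_def by blast
  qed
  have inj: "inj_on \<Phi> (alt_forms G (mu n))"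
  proof (rule inj_onI)
    fix b b' assume b: "b \<in> alt_forms G (mu n)" "b' \<in> alt_forms G (mu n)" and e: "\<Phi> b = \<Phi> b'"
    \<comment> \<open>The power n - 1 stands for the inverse, as the forms take values in the n-th
      roots of unity. Equality of two forms thus becomes symmetry of one product of
      cocycles.\<close>
    note M' = M_mult[OF M[OF b(1)] M_power[OF M[OF b(2)], of "n - 1"]]
    have bn: "\<Phi> b' (x, y) ^ n = 1" if "x \<in> carrier H" "y \<in> carrier H" for x y
      using maps b(2) alt_forms_in[of "\<Phi> b'" H "mu n"] that by (auto simp: mu_def)
    have cfm: "commutator_form H (\<lambda>g h. snd (p b) g h * snd (p b') g h ^ (n - 1)) (x, y) = 1"
      if xy: "x \<in> carrier H" "y \<in> carrier H" for x y
    proof -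
      have "commutator_form H (\<lambda>g h. snd (p b) g h * snd (p b') g h ^ (n - 1)) (x, y) = \<Phi> b (x, y) * \<Phi> b' (x, y) ^ (n - 1)"
        unfolding \<Phi>_def using xy by (simp add: commutator_form_mult commutator_form_power)
      also have "\<dots> = \<Phi> b' (x, y) ^ n" using n by (simp add: e flip: power_Suc)
      finally show ?thesis using bn[OF xy] by simp
    qed
    have "symmetric_on H (\<lambda>g h. snd (p b) g h * snd (p b') g h ^ (n - 1))"
      unfolding symmetric_on_iff_commutator_form[OF conjunct2[OF M_cocycle[OF M']]] using cfm by blast
    then have sG: "symmetric_on G (\<lambda>g h. fst (p b) g h * fst (p b') g h ^ (n - 1))"
      using M_symmetric[OF M'] by simp
    show "b = b'"
    proof (rule alt_forms_eqI[OF b])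
      fix x y assume xy: "x \<in> carrier G" "y \<in> carrier G"
      have "commutator_form G (\<lambda>g h. fst (p b) g h * fst (p b') g h ^ (n - 1)) (x, y) = 1"
        using sG M_cocycle[OF M'] xy by (auto simp: symmetric_on_iff_commutator_form)
      then have 1: "b (x, y) * b' (x, y) ^ (n - 1) = 1"
        using xy by (simp add: commutator_form_mult commutator_form_power cf[OF b(1)] cf[OF b(2)])
      have "b' (x, y) ^ n = 1" using alt_forms_in[OF b(2) xy] by (simp add: mu_def)
      then have 2: "b' (x, y) * b' (x, y) ^ (n - 1) = 1" using n by (simp flip: power_Suc)
      then have "b' (x, y) ^ (n - 1) \<noteq> 0" by auto
      moreover have "b (x, y) * b' (x, y) ^ (n - 1) = b' (x, y) * b' (x, y) ^ (n - 1)" using 1 2 by simp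
      ultimately show "b (x, y) = b' (x, y)" by (rule mult_right_cancel[THEN iffD1])
    qed
  qed
  have "finite (alt_forms H (mu n :: 'k set))" by (rule finite_alt_forms[OF H(2) finite_mu[OF n]])
  then show ?thesis using card_inj_on_le[OF inj maps] by blast
qed

end

lemma twisted_equiv_matching:
  fixes F :: "'k::field_char_0 set" and G :: "('g, 'x) monoid_scheme" and H :: "('h, 'y) monoid_scheme"
  assumes F: "subfield_of_alg_closed F" and G: "comm_group G" "finite (carrier G)"
    and H: "comm_group H" "finite (carrier H)" and eq: "twisted_equiv G F H"
  shows "\<exists>M. cocycle_matching F G H M \<and> cocycle_matching F H G (\<lambda>\<beta> \<alpha>. M \<alpha> \<beta>) \<and>
    twisted_group_ring G F (\<lambda>_ _. 1) \<simeq> twisted_group_ring H F (\<lambda>_ _. 1)"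
proof -
  interpret subfield_of_alg_closed F by (rule F)
  interpret G: comm_group G by (rule G)
  interpret H: comm_group H by (rule H)
  obtain \<psi> where iso: "\<psi> \<in> iso (H2 G F) (H2 H F)"
    and rings: "\<And>\<alpha> \<beta>. cocycle G F \<alpha> \<Longrightarrow> cocycle H F \<beta> \<Longrightarrow> coh_class H F \<beta> = \<psi> (coh_class G F \<alpha>) \<Longrightarrow>
      twisted_group_ring G F \<alpha> \<simeq> twisted_group_ring H F \<beta>"
    using eq unfolding twisted_equiv_def by blast
  have carrG: "carrier (H2 G F) = coh_class G F ` {\<alpha>. cocycle G F \<alpha>}"
    and carrH: "carrier (H2 H F) = coh_class H F ` {\<alpha>. cocycle H F \<alpha>}" by (simp_all add: H2_def)
  have im: "\<psi> ` carrier (H2 G F) = carrier (H2 H F)" using iso by (auto simp: iso_def bij_betw_def)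
  have hom: "\<psi> (c \<otimes>\<^bsub>H2 G F\<^esub> d) = \<psi> c \<otimes>\<^bsub>H2 H F\<^esub> \<psi> d" if "c \<in> carrier (H2 G F)" "d \<in> carrier (H2 G F)" for c d
    using iso that by (auto simp: iso_def hom_def)
  define M where "M \<alpha> \<beta> \<longleftrightarrow> cocycle G F \<alpha> \<and> cocycle H F \<beta> \<and> coh_class H F \<beta> = \<psi> (coh_class G F \<alpha>)" for \<alpha> \<beta>
  have totG: "\<exists>\<beta>. M \<alpha> \<beta>" if "cocycle G F \<alpha>" for \<alpha>
  proof -
    have "\<psi> (coh_class G F \<alpha>) \<in> carrier (H2 H F)" using im carrG that by blast
    then show ?thesis using that unfolding carrH M_def by auto
  qed
  have totH: "\<exists>\<alpha>. M \<alpha> \<beta>" if "cocycle H F \<beta>" for \<beta>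
  proof -
    have "coh_class H F \<beta> \<in> \<psi> ` carrier (H2 G F)" using im carrH that by blast
    then show ?thesis using that unfolding carrG M_def by auto
  qed
  have mult: "M (\<lambda>g h. \<alpha> g h * \<alpha>' g h) (\<lambda>g h. \<beta> g h * \<beta>' g h)" if "M \<alpha> \<beta>" "M \<alpha>' \<beta>'" for \<alpha> \<beta> \<alpha>' \<beta>'
  proof -
    have c: "cocycle G F \<alpha>" "cocycle G F \<alpha>'" "cocycle H F \<beta>" "cocycle H F \<beta>'"
      and e: "coh_class H F \<beta> = \<psi> (coh_class G F \<alpha>)" "coh_class H F \<beta>' = \<psi> (coh_class G F \<alpha>')"
      using that by (auto simp: M_def)
    have "coh_class H F (\<lambda>g h. \<beta> g h * \<beta>' g h) = \<psi> (coh_class G F \<alpha>) \<otimes>\<^bsub>H2 H F\<^esub> \<psi> (coh_class G F \<alpha>')"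
      using H2_mult[OF H.is_group c(3,4)] e by simp
    also have "\<dots> = \<psi> (coh_class G F \<alpha> \<otimes>\<^bsub>H2 G F\<^esub> coh_class G F \<alpha>')"
      using hom carrG c by simp
    also have "\<dots> = \<psi> (coh_class G F (\<lambda>g h. \<alpha> g h * \<alpha>' g h))" using H2_mult[OF G.is_group c(1,2)] by simp
    finally show ?thesis using cocycle_mult[OF c(1,2)] cocycle_mult[OF c(3,4)] by (simp add: M_def)
  qed
  \<comment> \<open>The image of the trivial class is idempotent, and cancelling \<beta> shows it to
    be trivial. This rests on multiplicativity alone, without setting up \<open>H2\<close> as a
    group.\<close>
  have one: "M (\<lambda>_ _. 1) (\<lambda>_ _. 1)"
  proof -
    have c1: "cocycle G F (\<lambda>_ _. 1)" "cocycle H F (\<lambda>_ _. 1)" using cocycle_one G.is_group H.is_group by auto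
    obtain \<beta> where \<beta>: "M (\<lambda>_ _. 1) \<beta>" using totG[OF c1(1)] by blast
    then have b: "cocycle H F \<beta>" "coh_class H F \<beta> = \<psi> (coh_class G F (\<lambda>_ _. 1))" by (auto simp: M_def)
    have "coh_class H F (\<lambda>g h. \<beta> g h * \<beta> g h) = coh_class H F \<beta>" using mult[OF \<beta> \<beta>] b(2) by (simp add: M_def)
    then have "cohomologous H F (\<lambda>g h. \<beta> g h * \<beta> g h) \<beta>"
      using coh_class_eq_iff[OF H.is_group cocycle_mult[OF b(1,1)] b(1)] by simp
    then obtain f where f: "\<And>g. g \<in> carrier H \<Longrightarrow> f g \<in> F - {0}"
      "\<And>g h. g \<in> carrier H \<Longrightarrow> h \<in> carrier H \<Longrightarrow> \<beta> g h = \<beta> g h * \<beta> g h * (f g * f h / f (g \<otimes>\<^bsub>H\<^esub> h))"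
      unfolding cohomologous_def by auto
    have "1 = \<beta> g h * (f g * f h / f (g \<otimes>\<^bsub>H\<^esub> h))" if gh: "g \<in> carrier H" "h \<in> carrier H" for g h
    proof -
      have "\<beta> g h * 1 = \<beta> g h * (\<beta> g h * (f g * f h / f (g \<otimes>\<^bsub>H\<^esub> h)))" using f(2)[OF gh] by (simp only: mult.assoc mult_1_right)
      then show ?thesis using cocycle_nonzero[OF b(1) gh] by (simp only: mult_cancel_left) simp
    qed
    then have "cohomologous H F \<beta> (\<lambda>_ _. 1)" unfolding cohomologous_def using f(1) by blast
    then have "coh_class H F \<beta> = coh_class H F (\<lambda>_ _. 1)" using coh_class_eq_iff[OF H.is_group b(1) c1(2)] by simp
    then show ?thesis using b(2) c1 by (simp add: M_def)
  qed
  have sym: "symmetric_on G \<alpha> \<longleftrightarrow> symmetric_on H \<beta>" if Mab: "M \<alpha> \<beta>" for \<alpha> \<beta>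
  proof -
    have c: "cocycle G F \<alpha>" "cocycle H F \<beta>" using Mab by (auto simp: M_def)
    obtain \<theta> where "\<theta> \<in> ring_iso (twisted_group_ring G F \<alpha>) (twisted_group_ring H F \<beta>)"
      using rings[OF c] Mab unfolding M_def is_ring_iso_def by blast
    then have hom: "\<theta> \<in> ring_hom (twisted_group_ring G F \<alpha>) (twisted_group_ring H F \<beta>)"
      and bij: "bij_betw \<theta> (carrier (twisted_group_ring G F \<alpha>)) (carrier (twisted_group_ring H F \<beta>))"
      by (auto simp: ring_iso_def)
    let ?R = "twisted_group_ring G F \<alpha>" and ?S = "twisted_group_ring H F \<beta>"
    have "(\<forall>x\<in>carrier ?R. \<forall>y\<in>carrier ?R. x \<otimes>\<^bsub>?R\<^esub> y = y \<otimes>\<^bsub>?R\<^esub> x) \<longleftrightarrow>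
        (\<forall>x\<in>carrier ?R. \<forall>y\<in>carrier ?R. \<theta> (x \<otimes>\<^bsub>?R\<^esub> y) = \<theta> (y \<otimes>\<^bsub>?R\<^esub> x))"
      using twisted_mult_closed[OF c(1)] bij_betw_imp_inj_on[OF bij] by (auto simp: inj_on_eq_iff)
    also have "\<dots> \<longleftrightarrow> (\<forall>x\<in>carrier ?R. \<forall>y\<in>carrier ?R. \<theta> x \<otimes>\<^bsub>?S\<^esub> \<theta> y = \<theta> y \<otimes>\<^bsub>?S\<^esub> \<theta> x)"
      using ring_hom_mult[OF hom] by simp
    also have "\<dots> \<longleftrightarrow> (\<forall>x\<in>carrier ?S. \<forall>y\<in>carrier ?S. x \<otimes>\<^bsub>?S\<^esub> y = y \<otimes>\<^bsub>?S\<^esub> x)"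
      unfolding bij_betw_imp_surj_on[OF bij, symmetric] by blast
    finally show ?thesis using twisted_commutative_iff[OF G c(1)] twisted_commutative_iff[OF H c(2)] by simp
  qed
  have "cocycle_matching F G H M"
    by unfold_locales (use G H totG one mult sym in \<open>auto simp: M_def\<close>)
  moreover have "cocycle_matching F H G (\<lambda>\<beta> \<alpha>. M \<alpha> \<beta>)"
    by unfold_locales (use G H totH one mult sym in \<open>auto simp: M_def\<close>)
  moreover have "twisted_group_ring G F (\<lambda>_ _. 1) \<simeq> twisted_group_ring H F (\<lambda>_ _. 1)"
    using rings one by (auto simp: M_def)
  ultimately show ?thesis by blast
qed

section \<open>The isomorphism theorem\<close>

text \<open>x choose 2 is strictly increasing from x = 1 on, so \<open>r\<close> and
  \<open>s\<close> can differ only as 0 against 1. Two differences of opposite sign would contradict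
  monotonicity of \<open>r\<close> or of \<open>s\<close>, according to which comes first; hence all
  have one sign, and equal sums leave none.\<close>

lemma choose_two_sum_determines:
  fixes r s :: "nat \<Rightarrow> nat"
  assumes r: "antimono r" and s: "antimono s"
    and choose: "\<And>t. t < m \<Longrightarrow> (r t choose 2) = (s t choose 2)"
    and sum: "(\<Sum>t<m. r t) = (\<Sum>t<m. s t)"
  shows "\<forall>t<m. r t = s t"
proof (rule ccontr)
  have small: "a \<le> 1 \<and> b \<le> 1" if "(a choose 2) = (b choose 2)" "a \<noteq> b" for a b :: nat
  proof -
    have mono: "(x choose 2) < (y choose 2)" if xy: "x < y" "y \<ge> 2" for x y :: nat
    proof -
      obtain z where z: "y = Suc z" "x \<le> z" "z \<ge> 1" using xy by (cases y) auto
      have "(x choose 2) \<le> (z choose 2)" using z(2) by (rule binomial_right_mono)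
      also have "\<dots> < (Suc z choose 2)" using z(3) by (simp add: numeral_2_eq_2)
      finally show ?thesis using z by simp
    qed
    show ?thesis using mono[of a b] mono[of b a] that by linarith
  qed
  have contra: False if r: "antimono r" and s: "antimono s"
    and choose: "\<And>t. t < m \<Longrightarrow> (r t choose 2) = (s t choose 2)"
    and sum: "(\<Sum>t<m. r t) = (\<Sum>t<m. s t)" and t: "t < m" "r t < s t" for r s :: "nat \<Rightarrow> nat" and t
  proof -
    have rt: "r t = 0" "s t = 1" using small[OF choose[OF t(1)]] t(2) by auto
    have "r u \<le> s u" if u: "u < m" for u
    proof (rule ccontr)
      assume "\<not> r u \<le> s u"
      then have "s u < r u" by simp
      then have su: "s u = 0" "r u = 1" using small[OF choose[OF u]] by auto
      show False
      proof (cases "u \<le> t")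
        case True then show False using antimonoD[OF s True] su rt by simp
      next
        case False then show False using antimonoD[OF r, of t u] su rt by simp
      qed
    qed
    then have "(\<Sum>t<m. r t) < (\<Sum>t<m. s t)" using t by (intro sum_strict_mono_ex1) auto
    then show False using sum by simp
  qed
  assume "\<not> (\<forall>t<m. r t = s t)"
  then obtain t where "t < m" "r t \<noteq> s t" by blast
  then show False
    using contra[OF r s choose sum, of t] contra[OF s r choose[symmetric] sum[symmetric], of t] by linarith
qed

context alg_closed_char_0
begin

lemma mu_Int_subfield:
  fixes K :: "'k set"
  assumes K: "is_subfield K" and N: "N > 0"
  shows "\<exists>w>0. mu N \<inter> K = mu w"
proof -
  interpret subfield_of K by unfold_locales (rule K)
  have "\<exists>w>0. mu N \<inter> K = {z. z ^ w = 1} \<and> (\<exists>z\<in>mu N \<inter> K. primitive_root_of_unity w z)"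
    by (rule finite_mult_group_eq_roots_of_unity[OF N]) (auto simp: mu_one one_in mu_mult mult_in, simp add: mu_def)
  then show ?thesis by (auto simp: mu_def)
qed

lemma mu_subset_mu_iff:
  assumes "a > 0"
  shows "mu a \<subseteq> (mu b :: 'k set) \<longleftrightarrow> a dvd b"
proof
  obtain z :: 'k where z: "primitive_root_of_unity a z" using primitive_root_exists[OF assms] by blast
  assume "mu a \<subseteq> (mu b :: 'k set)"
  then show "a dvd b" using z primitive_root_pow_eq_1_iff[OF z, of b] by (auto simp: mu_def primitive_root_of_unity_def)
qed (rule mu_dvd)

theorem iso_if_twisted_equiv:
  fixes G :: "('g, 'x) monoid_scheme" and H :: "('h, 'y) monoid_scheme" and F :: "'k set"
  assumes G: "comm_group G" "finite (carrier G)" and H: "comm_group H" "finite (carrier H)"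
    and F: "is_subfield F"
    and odd: "\<And>p. Factorial_Ring.prime p \<Longrightarrow> odd p \<Longrightarrow> p dvd group_exponent G \<Longrightarrow>
      (\<exists>z\<in>F. primitive_root_of_unity p z) \<or> F \<inter> cyclotomic_field (p\<^sup>2) \<subseteq> cyclotomic_field p"
    and two: "2 dvd group_exponent G \<Longrightarrow>
      (\<exists>z\<in>F. primitive_root_of_unity 4 z) \<or> F \<inter> cyclotomic_field 8 \<subseteq> \<rat>"
    and eq: "twisted_equiv G F H"
  shows "G \<cong> H"
proof -
  interpret G: comm_group G by (rule G)
  interpret H: comm_group H by (rule H)
  interpret F: subfield_of_alg_closed F by (rule subfield_of_alg_closedI[OF F])
  obtain M where M: "cocycle_matching F G H M" "cocycle_matching F H G (\<lambda>\<beta> \<alpha>. M \<alpha> \<beta>)"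
    and "twisted_group_ring G F (\<lambda>_ _. 1) \<simeq> twisted_group_ring H F (\<lambda>_ _. 1)"
    using twisted_equiv_matching[OF F.subfield_of_alg_closed_axioms G H eq] by blast
  then obtain \<theta> where \<theta>: "\<theta> \<in> ring_iso (group_ring G F) (group_ring H F)" by (auto simp: is_ring_iso_def)
  have alt: "card (alt_forms G (mu n :: 'k set)) = card (alt_forms H (mu n :: 'k set))"
    if "n > 0" "mu n \<subseteq> F" for n
    using cocycle_matching.card_alt_forms_le[OF M(1) that] cocycle_matching.card_alt_forms_le[OF M(2) that]
    by (rule antisym)
  \<comment> \<open>e annihilates both groups, so every e * i is an admissible common
    \<open>N\<close>. The factor i will be a power of p, which makes the roots of unity of the
    required p-power order available.\<close>
  define e where "e = Coset.order G * Coset.order H"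
  have e: "e > 0" unfolding e_def using G.order_gt_0_iff_finite H.order_gt_0_iff_finite G(2) H(2) by simp
  have ga: "group_algebra G F (e * i)" "group_algebra H F (e * i)" if "i > 0" for i
  proof -
    have "x [^]\<^bsub>G\<^esub> (e * i) = \<one>\<^bsub>G\<^esub>" if "x \<in> carrier G" for x
      using G.pow_order_eq_1[OF that] that unfolding e_def by (simp add: mult.assoc flip: G.nat_pow_pow)
    moreover have "x [^]\<^bsub>H\<^esub> (e * i) = \<one>\<^bsub>H\<^esub>" if "x \<in> carrier H" for x
      using H.pow_order_eq_1[OF that] that unfolding e_def
      by (simp add: mult.assoc mult.left_commute[of "Coset.order G"] flip: H.nat_pow_pow)
    ultimately show "group_algebra G F (e * i)" "group_algebra H F (e * i)"
      using G H e that by (auto intro!: group_algebra.intro group_algebra_axioms.intro F.subfield_of_alg_closed_axioms)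
  qed
  have chr: "\<exists>w>0. (mu (e * i) \<inter> K = mu w) \<and> card (chars G (mu w :: 'k set)) = card (chars H (mu w :: 'k set))"
    if i: "i > 0" and K: "is_subfield K" "F \<subseteq> K" for i and K :: "'k set"
  proof -
    obtain w where w: "w > 0" "mu (e * i) \<inter> K = mu w"
      using mu_Int_subfield[OF K(1), of "e * i"] e i by auto
    then show ?thesis
      using card_chars_eq_if_group_rings_iso[OF ga[OF i] \<theta> K] by auto
  qed
  have mult_eq: "multiplicity p (card (chars G (mu n :: 'k set))) = multiplicity p (card (chars H (mu n :: 'k set)))"
    if p: "Factorial_Ring.prime p" and n: "n > 0" for p n
  proof -
    have p0: "p > 0" using p by (rule prime_gt_0_nat)
    have p1: "p > 1" using p by (rule prime_gt_1_nat)
    obtain r where r: "antimono r"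
      and rc: "\<And>n. n > 0 \<Longrightarrow> multiplicity p (card (chars G (mu n :: 'k set))) = (\<Sum>t<multiplicity p n. r t)"
      and ra: "\<And>n. n > 0 \<Longrightarrow> multiplicity p (card (alt_forms G (mu n :: 'k set))) = (\<Sum>t<multiplicity p n. r t choose 2)"
      using counting_profile[OF G p] by blast
    obtain s where s: "antimono s"
      and sc: "\<And>n. n > 0 \<Longrightarrow> multiplicity p (card (chars H (mu n :: 'k set))) = (\<Sum>t<multiplicity p n. s t)"
      and sa: "\<And>n. n > 0 \<Longrightarrow> multiplicity p (card (alt_forms H (mu n :: 'k set))) = (\<Sum>t<multiplicity p n. s t choose 2)"
      using counting_profile[OF H p] by blast
    \<comment> \<open>With N = e * p^j, the resulting w is divisible by p^j because L contains these
      roots of unity, and not by p^(j+1) because L omits some of the next ones.\<close>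
    have level: "(\<Sum>t<j. r t) = (\<Sum>t<j. s t)" if L: "at_level F p j L" for j L
    proof -
      have L': "is_subfield L" "F \<subseteq> L" "mu (p ^ j) \<subseteq> L" "\<not> mu (p ^ Suc j) \<subseteq> L"
        using L by (auto simp: at_level_def)
      obtain w where w: "w > 0" "mu (e * p ^ j) \<inter> L = mu w"
        "card (chars G (mu w :: 'k set)) = card (chars H (mu w :: 'k set))"
        using chr[OF _ L'(1,2), of "p ^ j"] p0 by auto
      have "mu (p ^ j) \<subseteq> (mu w :: 'k set)"
        using L'(3) mu_dvd[of "p ^ j" "e * p ^ j"] w(2) by auto
      then have 1: "p ^ j dvd w" using mu_subset_mu_iff[of "p ^ j"] p0 by simp
      have 2: "\<not> p ^ Suc j dvd w" using mu_dvd[of "p ^ Suc j" w] L'(4) w(2) by blast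
      have "multiplicity p w = j" by (rule multiplicity_eqI[OF 1 2])
      then show ?thesis using rc[OF w(1)] sc[OF w(1)] w(3) by simp
    qed
    \<comment> \<open>Values in the p^t-th and in the p^(t+1)-th roots of unity give consecutive
      partial sums, whose difference is a single term.\<close>
    have choose: "(r t choose 2) = (s t choose 2)" if "mu (p ^ Suc t) \<subseteq> F" for t
    proof -
      have mult: "multiplicity p (p ^ k) = k" for k using p p1 by (simp add: multiplicity_same_power)
      have "mu (p ^ t) \<subseteq> F" using that mu_dvd[of "p ^ t" "p ^ Suc t"] by auto
      then have a: "(\<Sum>u<t. r u choose 2) = (\<Sum>u<t. s u choose 2)"
        using alt[of "p ^ t"] ra[of "p ^ t"] sa[of "p ^ t"] p0 by (simp add: mult)
      have "(\<Sum>u<Suc t. r u choose 2) = (\<Sum>u<Suc t. s u choose 2)"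
        using alt[OF _ that] ra[of "p ^ Suc t"] sa[of "p ^ Suc t"] p0 mult[of "Suc t"] by simp
      then show ?thesis using a by simp
    qed
    \<comment> \<open>If F contains all p-power roots of unity, no overfield has a finite level;
      instead K = F itself provides w divisible by arbitrarily high powers of p.\<close>
    have big: "\<exists>j\<ge>k. mu (p ^ j) \<subseteq> F \<and> (\<Sum>t<j. r t) = (\<Sum>t<j. s t)" if inf: "\<And>j. mu (p ^ j) \<subseteq> F" for k
    proof -
      obtain w where w: "w > 0" "mu (e * p ^ k) \<inter> F = mu w"
        "card (chars G (mu w :: 'k set)) = card (chars H (mu w :: 'k set))"
        using chr[OF _ F subset_refl, of "p ^ k"] p0 by auto
      have "mu (p ^ k) \<subseteq> (mu w :: 'k set)"
        using inf[of k] mu_dvd[of "p ^ k" "e * p ^ k"] w(2) by auto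
      then have "p ^ k dvd w" using mu_subset_mu_iff[of "p ^ k"] p0 by simp
      then have "multiplicity p w \<ge> k" using w(1) p p1 by (intro multiplicity_geI) auto
      then show ?thesis using rc[OF w(1)] sc[OF w(1)] w(3) inf by (intro exI[of _ "multiplicity p w"]) auto
    qed
    have "\<forall>t. r t = s t"
    proof (cases "p dvd group_exponent G")
      case False
      have rz: "r t = 0" for t
      proof -
        have exp: "\<forall>x\<in>carrier G. x [^]\<^bsub>G\<^esub> group_exponent G = \<one>\<^bsub>G\<^esub>"
          by (auto simp: group_exponent_def G.pow_eq_id)
        have "group_exponent G > 0"
        proof -
          have "group_exponent G \<noteq> 0"
          proof
            assume "group_exponent G = 0"
            then have "0 \<in> G.ord ` carrier G" using G(2) by (simp add: group_exponent_def Lcm_0_iff)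
            then obtain x where x: "x \<in> carrier G" "G.ord x = 0" by (metis imageE)
            then show False using G.ord_ge_1[OF G(2) x(1)] by simp
          qed
          then show ?thesis by simp
        qed
        moreover have "coprime (group_exponent G) (p ^ Suc t)"
          using False p by (simp add: coprime_commute prime_imp_coprime)
        ultimately have "chars G (mu (p ^ Suc t)) = chars G (mu 1 :: 'k set)"
          using G.chars_mu_exponent[OF exp, of "p ^ Suc t", where 'k = 'k] p0 by (simp add: coprime_iff_gcd_eq_1)
        then have "(\<Sum>u<Suc t. r u) = 0"
          using rc[of "p ^ Suc t"] rc[of 1] p p0 p1 by (simp add: multiplicity_same_power del: power_Suc)
        then show ?thesis by simp
      qed
      \<comment> \<open>The conditions on F say nothing about a prime that does not divide the
        exponent of G. Here K is the whole field, so that all characters count and the absence of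
        p-parts in G passes to H.\<close>
      have sz: "s t = 0" for t
      proof -
        have "is_subfield (UNIV :: 'k set)" by (simp add: is_subfield_def)
        then obtain w where w: "w > 0" "mu (e * p ^ Suc t) \<inter> UNIV = (mu w :: 'k set)"
          "card (chars G (mu w :: 'k set)) = card (chars H (mu w :: 'k set))"
          using chr[of "p ^ Suc t" UNIV] p0 by auto
        have "p ^ Suc t dvd w"
          using mu_subset_mu_iff[of "p ^ Suc t" w] mu_dvd[of "p ^ Suc t" "e * p ^ Suc t"] w(2) p0 by auto
        then have "multiplicity p w \<ge> Suc t" using w(1) p p1 by (intro multiplicity_geI) auto
        moreover have "(\<Sum>u<multiplicity p w. s u) = 0" using rc[OF w(1)] sc[OF w(1)] w(3) rz by simp
        ultimately show ?thesis by simp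
      qed
      show ?thesis using rz sz by simp
    next
      case True
      have hyps: "odd p \<Longrightarrow> (\<exists>z\<in>F. primitive_root_of_unity p z) \<or> F \<inter> cyclotomic_field (p\<^sup>2) \<subseteq> cyclotomic_field p"
        "p = 2 \<Longrightarrow> (\<exists>z\<in>F. primitive_root_of_unity 4 z) \<or> F \<inter> cyclotomic_field 8 \<subseteq> \<rat>"
        using odd[OF p _ True] two True by auto
      show ?thesis
      proof (cases "\<forall>j. mu (p ^ j) \<subseteq> F")
        case inf: True
        have "r t = s t" for t
        proof -
          obtain j where j: "j \<ge> Suc t" "(\<Sum>t<j. r t) = (\<Sum>t<j. s t)" using big[of "Suc t"] inf by blast
          have "\<forall>t<j. r t = s t"
            by (rule choose_two_sum_determines[OF r s choose j(2)]) (rule inf[rule_format])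
          then show ?thesis using j(1) by simp
        qed
        then show ?thesis by blast
      next
        case False
        \<comment> \<open>The index is shifted inside \<open>LEAST\<close>, so that m is the last
          exponent for which F contains the roots of unity and not the first for which it does
          not.\<close>
        define m where "m = (LEAST j. \<not> mu (p ^ Suc j) \<subseteq> F)"
        have "\<exists>j. \<not> mu (p ^ Suc j) \<subseteq> F"
        proof -
          obtain j where j: "\<not> mu (p ^ j) \<subseteq> F" using False by blast
          then show ?thesis using F.one_in by (cases j) (auto simp: mu_def)
        qed
        then have m: "\<not> mu (p ^ Suc m) \<subseteq> F" unfolding m_def by (rule LeastI_ex)
        have below: "mu (p ^ Suc t) \<subseteq> F" if "t < m" for t
          using not_less_Least[of t "\<lambda>j. \<not> mu (p ^ Suc j) \<subseteq> F"] that unfolding m_def by blast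
        have "mu (p ^ m) \<subseteq> F" using below[of "m - 1"] F.one_in by (cases m) (auto simp: mu_def)
        then have lev: "at_level F p m F" using m F by (simp add: at_level_def)
        have sums: "(\<Sum>t<j. r t) = (\<Sum>t<j. s t)" if j: "j \<ge> m" for j
        proof -
          obtain L where "at_level F p j L" using at_level_exists[OF F p hyps lev j] by blast
          then show ?thesis by (rule level)
        qed
        have "r t = s t" for t
        proof (cases "t < m")
          case True
          then show ?thesis using choose_two_sum_determines[OF r s choose[OF below] sums[OF order_refl]] by blast
        next
          case False
          then show ?thesis using sums[of t] sums[of "Suc t"] by simp
        qed
        then show ?thesis by blast
      qed
    qed
    then show ?thesis using rc[OF n] sc[OF n] by simp
  qed
  show ?thesis
  proof (rule iso_if_card_chars_eq[OF G H])
    fix n :: nat assume n: "n > 0"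
    show "card (chars G (mu n :: 'k set)) = card (chars H (mu n :: 'k set))"
    proof (rule multiplicity_eq_nat)
      show "card (chars G (mu n :: 'k set)) > 0" by (rule card_chars_pos[OF G.is_group G(2) n])
      show "card (chars H (mu n :: 'k set)) > 0" by (rule card_chars_pos[OF H.is_group H(2) n])
    qed (rule mult_eq[OF _ n])
  qed
qed

end

theorem theorem2:
  fixes G :: "'g monoid" and H :: "'h monoid" and F :: "'k::field_char_0 set"
  assumes "comm_group G" and "finite (carrier G)"
    and "comm_group H" and "finite (carrier H)"
    and "alg_closed_field TYPE('k)"
    and "is_subfield F"
    and "\<forall>p::nat. Factorial_Ring.prime p \<and> odd p \<and> p dvd group_exponent G \<longrightarrow>
           (\<exists>z\<in>F. primitive_root_of_unity p z) \<or>
           F \<inter> cyclotomic_field (p ^ 2) \<subseteq> cyclotomic_field p"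
    and "2 dvd group_exponent G \<longrightarrow>
           (\<exists>z\<in>F. primitive_root_of_unity 4 z) \<or> F \<inter> cyclotomic_field 8 = \<rat>"
    and "twisted_equiv G F H"
  shows "G \<cong> H"
proof -
  interpret alg_closed_char_0 "TYPE('k)" by unfold_locales (rule assms(5))
  show ?thesis
    using assms(7,8) by (intro iso_if_twisted_equiv[OF assms(1-4,6) _ _ assms(9)]) auto
qed

end
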